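(* Let $n\ge2$, let $z_1,\dots,z_n\in\mathbb{C}$ be distinct points, and let $\gamma:[0,1]\to\mathbb{C}$ be an admissible path (in the sense of the context) from the tangential base point $(z_i,v_i)$ to the tangential base point $(z_j,v_j)$, $i\ne j$, with self-intersections $a_l=\gamma(t_l)=\gamma(s_l)$, $0<t_l<s_l<1$, $l=1,\dots,m$. For each $l=1,\dots,m$ let $C_l\in\exp(\mathfrak{t}_{n+2})$ be the regularized holonomy of the connection $A_{z,w}$ along the segment $L_l$, as defined in the context. Then for every $l$, $$ C_l=\mathrm{Hol}^{\mathrm{reg}}(A_z,\gamma_{[0,t_l]})\;\mathrm{Hol}^{\mathrm{reg}}(A_w,\gamma_{[1,s_l]})+O(t_{zw}), $$ where $O(t_{zw})$ denotes an element of the closed two-sided ideal of the completed $U(\mathfrak{t}_{n+2})$ generated by $t_{zw}$. Equivalently, if $\pi:\mathfrak{t}_{n+2}\to\mathfrak{t}_{n+2}/\langle t_{zw}\rangle$ is the projection onto the quotient by the Lie ideal generated by $t_{zw}$ (extended to completed enveloping algebras), then $$ \pi(C_l)=\mathrm{Hol}^{\mathrm{reg}}(\pi(A_z),\gamma_{[0,t_l]})\;\mathrm{Hol}^{\mathrm{reg}}(\pi(A_w),\gamma_{[1,s_l]}). $$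
   Context: **Lie algebra.** $\mathfrak{t}_{n+2}$ is the complex Drinfeld--Kohno Lie algebra on the strands $\{1,\dots,n,z,w\}$: generators $t_{a,b}=t_{b,a}=t_{ab}$ for $a\ne b$ in $\{1,\dots,n,z,w\}$, relations $[t_{a,b},t_{c,d}]=0$ and $[t_{a,b}+t_{a,c},t_{b,c}]=0$ for distinct indices $a,b,c,d$. The Lie algebra and its enveloping algebra are completed with respect to the grading in which all generators have degree $1$; $\exp(\mathfrak{t}_{n+2})$ is the group of exponentials of elements of the completed Lie algebra. **Admissible paths.** $v_i,v_j\in\mathbb{C}$ are nonzero. An admissible path $\gamma:[0,1]\to\mathbb{C}$ is smooth with $\dot\gamma\ne0$ everywhere, $\gamma(t)\in\mathbb{C}\setminus\{z_1,\dots,z_n\}$ for $0<t<1$, $\gamma(t)=z_i+v_it$ for $t$ close to $0$, $\gamma(t)=z_j+v_j(1-t)$ for $t$ close to $1$. It has finitely many self-intersections, i.e. pairs $(t_l,s_l)$ with $0<t_l<s_l<1$ and $\gamma(t_l)=\gamma(s_l)=a_l$, $l=1,\dots,m$, all transverse, and $\gamma$ is affine-linear near each $t_l$ and each $s_l$. Moreover the points $(t_l,s_l)$, $l=1,\dots,m$, lie on pairwise distinct rays emanating from the point $(0,1)$ of the $(t,s)$-plane. **Connections.** $A_z=\frac{1}{2\pi i}\sum_{k=1}^n t_{k,z}\,d\log(z-z_k)$, $\;A_w=\frac{1}{2\pi i}\sum_{k=1}^n t_{k,w}\,d\log(w-z_k)$, and $$A_{z,w}=\frac1{2\pi i}\Big(\sum_{k=1}^n\big(t_{k,z}\,d\log(z-z_k)+t_{k,w}\,d\log(w-z_k)\big)+t_{zw}\,d\log(z-w)\Big).$$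 The corresponding equations are $d\Psi=A\Psi$. $\pi(A_z)$, $\pi(A_w)$ are obtained by applying $\pi$ to the coefficients. **The elements $C_l$.** Let $L_l$ be the segment $t\mapsto(z,w)=(\gamma(t),\gamma(s(t)))$, $s(t)=\frac{s_l-1}{t_l}t+1$, $0<t<t_l$; it corresponds to the straight segment from $(0,1)$ to $(t_l,s_l)$ in the $(t,s)$-plane. Consider the linear ordinary differential equation on $(0,t_l)$, with values in the completed $U(\mathfrak{t}_{n+2})$, obtained by pulling back $d\Psi=A_{z,w}\Psi$ along $L_l$. Let $\Psi_5$ be the solution on $(0,t_l)$ which for $t$ near $0$ is the restriction to $L_l$ of a solution of $d\Psi=A_{z,w}\Psi$ of the form $$f(z-z_i,w-z_j)\Big(\frac{z-z_i}{v_i}\Big)^{t_{iz}/2\pi i}\Big(\frac{w-z_j}{v_j}\Big)^{t_{jw}/2\pi i},$$ with $f$ analytic near $(0,0)$ and $f(0,0)=1$ (on $L_l$ near $t=0$ both bases are positive real numbers and real logarithms are used). Put $u_l=\frac{d}{dt}\big(\gamma(s(t))-\gamma(t)\big)\big|_{t=t_l}\neq0$, and let $\Psi_{a_l}$ be the solution on $(0,t_l)$ which for $t$ near $t_l$ is the restriction to $L_l$ of a solution of $d\Psi=A_{z,w}\Psi$ of the form $$h(z-a_l,w-z)\Big(\frac{w-z}{-u_l}\Big)^{t_{zw}/2\pi i},$$ with $h$ analytic near $(0,0)$ and $h(0,0)=1$ (on $L_l$ near $t=t_l$ the base equals $t_l-t>0$ and the real logarithm is used). Both solutions are unique, and $C_l:=\Psi_{a_l}^{-1}\Psi_5$,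 which is independent of $t\in(0,t_l)$. **Regularized holonomies from a tangential base point to a regular point.** Let $A=\frac1{2\pi i}\sum_k x_k\,d\log(z-z_k)$ with coefficients $x_k$ in the enveloping algebra $U(\mathfrak{t}_{n+2})$ or $U(\mathfrak{t}_{n+2}/\langle t_{zw}\rangle)$, completed with respect to the grading in which all generators $t_{a,b}$ (respectively their images) have degree $1$, and let $\delta$ be a smooth path starting at $z_r$ with initial portion $\delta(t)=z_r+v_rt$ for small $t\geq0$, avoiding the marked points afterwards, and ending at a regular point $p\in\mathbb{C}\setminus\{z_1,\dots,z_n\}$. Then $\mathrm{Hol}^{\mathrm{reg}}(A,\delta)$ is the value at the end of $\delta$ of the solution of $d\Psi=A\Psi$ along $\delta$ which near the start of $\delta$ has the form $f\big(\frac{z-z_r}{v_r}\big)\exp\big(\frac{x_r}{2\pi i}\log\frac{z-z_r}{v_r}\big)$ with $f$ analytic near $0$, $f(0)=1$, and the logarithm real along $\delta$. (Equivalently, it is $\Psi_p^{-1}\Psi_{z_r,v_r}$, where $\Psi_p$ is the solution equal to $1$ at $p$ and $\Psi_{z_r,v_r}$ is the solution with the form just described near the start of $\delta$, both continued along $\delta$.) Here $\gamma_{[0,t_l]}$ is the part of $\gamma$ from the tangential base point $(z_i,v_i)$ to the regular point $a_l=\gamma(t_l)$, and $\gamma_{[1,s_l]}$ is the part of $\gamma$ traversed backwards from the tangential base point $(z_j,v_j)$ (parameter value $1$) to the regular point $a_l=\gamma(s_l)$. *)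

theory Defs
  imports "HOL-Analysis.Analysis"
begin

section \<open>Complex algebras with a topology\<close>

class complex_algebra_topology = ring_1 + topological_space +
  fixes scaleC :: "complex \<Rightarrow> 'a \<Rightarrow> 'a"  (infixr "*\<^sub>C" 75)
  assumes scaleC_add_right: "c *\<^sub>C (x + y) = c *\<^sub>C x + c *\<^sub>C y"
    and scaleC_add_left: "(b + c) *\<^sub>C x = b *\<^sub>C x + c *\<^sub>C x"
    and scaleC_scaleC: "b *\<^sub>C (c *\<^sub>C x) = (b * c) *\<^sub>C x"
    and scaleC_one: "1 *\<^sub>C x = x"
    and mult_scaleC_left: "(c *\<^sub>C x) * y = c *\<^sub>C (x * y)"
    and mult_scaleC_right: "x * (c *\<^sub>C y) = c *\<^sub>C (x * y)"

definition two_sided_ideal :: "'a::ring_1 set \<Rightarrow> bool" where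
  "two_sided_ideal I \<longleftrightarrow> 0 \<in> I \<and> (\<forall>x\<in>I. \<forall>y\<in>I. x + y \<in> I) \<and>
     (\<forall>x\<in>I. \<forall>a. a * x \<in> I \<and> x * a \<in> I)"

definition closed_ideal :: "'a::{ring_1, topological_space} set \<Rightarrow> 'a set" where
  "closed_ideal R = \<Inter>{I. two_sided_ideal I \<and> closed I \<and> R \<subseteq> I}"

lemma two_sided_ideal_closed_ideal: "two_sided_ideal (closed_ideal R)"
  unfolding closed_ideal_def two_sided_ideal_def by blast

lemma closed_ideal_least:
  "two_sided_ideal I \<Longrightarrow> closed I \<Longrightarrow> R \<subseteq> I \<Longrightarrow> closed_ideal R \<subseteq> I"
  unfolding closed_ideal_def by blast

lemma closed_ideal_mono: "R \<subseteq> S \<Longrightarrow> closed_ideal R \<subseteq> closed_ideal S"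
  unfolding closed_ideal_def by blast

lemma ideal_add: "two_sided_ideal I \<Longrightarrow> x \<in> I \<Longrightarrow> y \<in> I \<Longrightarrow> x + y \<in> I"
  unfolding two_sided_ideal_def by blast

lemma ideal_mult:
  "two_sided_ideal I \<Longrightarrow> x \<in> I \<Longrightarrow> a * x \<in> I"
  "two_sided_ideal I \<Longrightarrow> x \<in> I \<Longrightarrow> x * a \<in> I"
  unfolding two_sided_ideal_def by blast+

lemma ideal_uminus: "two_sided_ideal I \<Longrightarrow> x \<in> I \<Longrightarrow> - x \<in> I"
  using ideal_mult(1)[of I x "- 1"] by simp

lemma ideal_equivp:
  assumes "two_sided_ideal I"
  shows "equivp (\<lambda>x y. x - y \<in> I)"
proof (rule equivpI)
  show "reflp (\<lambda>x y. x - y \<in> I)"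
    using assms by (simp add: reflp_def two_sided_ideal_def)
  show "symp (\<lambda>x y. x - y \<in> I)"
  proof (rule sympI)
    show "y - x \<in> I" if "x - y \<in> I" for x y
      using ideal_uminus[OF assms that] by simp
  qed
  show "transp (\<lambda>x y. x - y \<in> I)"
  proof (rule transpI)
    show "x - z \<in> I" if "x - y \<in> I" "y - z \<in> I" for x y z
      using ideal_add[OF assms that] by simp
  qed
qed

lemma ideal_cong_add:
  "two_sided_ideal I \<Longrightarrow> x - x' \<in> I \<Longrightarrow> y - y' \<in> I \<Longrightarrow> (x + y) - (x' + y') \<in> I"
  using ideal_add[of I "x - x'" "y - y'"] by (simp add: algebra_simps)

lemma ideal_cong_uminus: "two_sided_ideal I \<Longrightarrow> x - x' \<in> I \<Longrightarrow> (- x) - (- x') \<in> I"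
  using ideal_uminus[of I "x - x'"] by (simp add: algebra_simps)

lemma ideal_cong_diff:
  "two_sided_ideal I \<Longrightarrow> x - x' \<in> I \<Longrightarrow> y - y' \<in> I \<Longrightarrow> (x - y) - (x' - y') \<in> I"
  using ideal_cong_add[of I x x' "- y" "- y'"] ideal_cong_uminus[of I y y'] by simp

lemma ideal_cong_mult:
  assumes "two_sided_ideal I" "x - x' \<in> I" "y - y' \<in> I"
  shows "x * y - x' * y' \<in> I"
proof -
  have "x * y - x' * y' = (x - x') * y + x' * (y - y')"
    by (simp add: algebra_simps)
  then show ?thesis
    using assms by (simp add: ideal_add ideal_mult)
qed

lemma ideal_cong_scaleC:
  fixes x :: "'a::complex_algebra_topology"
  assumes "two_sided_ideal I" "x - x' \<in> I"
  shows "c *\<^sub>C x - c *\<^sub>C x' \<in> I"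
proof -
  have "c *\<^sub>C x - c *\<^sub>C x' = (c *\<^sub>C 1) * (x - x')"
    by (simp add: mult_scaleC_left right_diff_distrib)
  then show ?thesis
    using assms by (simp add: ideal_mult)
qed


section \<open>Noncommutative formal power series\<close>

text \<open>The completed free associative algebra on the alphabet \<open>'g\<close>, all letters having
  degree \<open>1\<close>. A series is the family of its coefficients, indexed by words, and the topology is
  that of coefficientwise convergence.\<close>

typedef 'g ncs = "UNIV :: ('g list \<Rightarrow> complex) set"
  morphisms ncs_coeff Abs_ncs ..

setup_lifting type_definition_ncs

lemma ncs_eqI: "(\<And>w. ncs_coeff f w = ncs_coeff g w) \<Longrightarrow> f = g"
  by (metis ncs_coeff_inject ext)

instantiation ncs :: (type) ring_1
begin
lift_definition zero_ncs :: "'a ncs" is "\<lambda>w. 0" .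
lift_definition one_ncs :: "'a ncs" is "\<lambda>w. if w = [] then 1 else 0" .
lift_definition plus_ncs :: "'a ncs \<Rightarrow> 'a ncs \<Rightarrow> 'a ncs" is "\<lambda>f g w. f w + g w" .
lift_definition minus_ncs :: "'a ncs \<Rightarrow> 'a ncs \<Rightarrow> 'a ncs" is "\<lambda>f g w. f w - g w" .
lift_definition uminus_ncs :: "'a ncs \<Rightarrow> 'a ncs" is "\<lambda>f w. - f w" .
lift_definition times_ncs :: "'a ncs \<Rightarrow> 'a ncs \<Rightarrow> 'a ncs"
  is "\<lambda>f g w. \<Sum>k\<le>length w. f (take k w) * g (drop k w)" .
instance
proof
  fix a b c :: "'a ncs"
  show "a * b * c = a * (b * c)"
  proof (transfer, rule ext)
    fix f g h :: "'a list \<Rightarrow> complex" and w :: "'a list"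
    define n where "n = length w"
    define T where "T = (\<lambda>j k. f (take j w) * g (drop j (take k w)) * h (drop k w))"
    have "(\<Sum>k\<le>n. (\<Sum>j\<le>length (take k w). f (take j (take k w)) * g (drop j (take k w))) * h (drop k w))
        = (\<Sum>k\<le>n. \<Sum>j\<le>k. T j k)"
      by (auto simp: T_def n_def sum_distrib_right min_def intro!: sum.cong)
    also have "\<dots> = (\<Sum>j\<le>n. \<Sum>k=j..n. T j k)"
      by (simp add: sum.Sigma) (rule sum.reindex_bij_witness[where i = prod.swap and j = prod.swap], auto)
    also have "\<dots> = (\<Sum>j\<le>n. \<Sum>k\<le>n - j. T j (k + j))"
    proof (rule sum.cong[OF refl])
      fix j assume "j \<in> {..n}"
      then show "(\<Sum>k=j..n. T j k) = (\<Sum>k\<le>n - j. T j (k + j))"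
        by (intro sum.reindex_bij_witness[where i = "\<lambda>k. k + j" and j = "\<lambda>k. k - j"]) auto
    qed
    also have "\<dots> = (\<Sum>j\<le>n. f (take j w) *
        (\<Sum>k\<le>length (drop j w). g (take k (drop j w)) * h (drop k (drop j w))))"
      by (auto simp: T_def n_def sum_distrib_left drop_take mult.assoc intro!: sum.cong)
    finally show "(\<Sum>k\<le>length w. (\<Sum>j\<le>length (take k w). f (take j (take k w)) * g (drop j (take k w))) * h (drop k w))
        = (\<Sum>j\<le>length w. f (take j w) *
        (\<Sum>k\<le>length (drop j w). g (take k (drop j w)) * h (drop k (drop j w))))"
      by (simp add: n_def)
  qed
  show "1 * a = a"
  proof (transfer, rule ext)
    fix f :: "'a list \<Rightarrow> complex" and w :: "'a list"
    have "(\<Sum>k\<le>length w. (if take k w = [] then 1 else 0) * f (drop k w))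
        = (\<Sum>k\<le>length w. if k = 0 then f w else 0)"
      by (intro sum.cong) auto
    then show "(\<Sum>k\<le>length w. (if take k w = [] then 1 else 0) * f (drop k w)) = f w"
      by simp
  qed
  show "a * 1 = a"
  proof (transfer, rule ext)
    fix f :: "'a list \<Rightarrow> complex" and w :: "'a list"
    have "(\<Sum>k\<le>length w. f (take k w) * (if drop k w = [] then 1 else 0))
        = (\<Sum>k\<le>length w. if k = length w then f w else 0)"
      by (intro sum.cong) auto
    then show "(\<Sum>k\<le>length w. f (take k w) * (if drop k w = [] then 1 else 0)) = f w"
      by simp
  qed
  show "(0::'a ncs) \<noteq> 1"
    by transfer (auto simp: fun_eq_iff)
qed (transfer; simp add: algebra_simps sum.distrib fun_eq_iff; fail)+
end

instantiation ncs :: (type) complex_algebra_topology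
begin
definition open_ncs :: "'a ncs set \<Rightarrow> bool" where
  "open_ncs U \<longleftrightarrow> open (Abs_ncs -` U)"
lift_definition scaleC_ncs :: "complex \<Rightarrow> 'a ncs \<Rightarrow> 'a ncs" is "\<lambda>c f w. c * f w" .
instance
proof
  show "open (UNIV :: 'a ncs set)"
    by (simp add: open_ncs_def)
  show "open (S \<inter> T)" if "open S" "open T" for S T :: "'a ncs set"
    using that by (simp add: open_ncs_def open_Int)
  show "open (\<Union>K)" if "\<forall>S\<in>K. open S" for K :: "'a ncs set set"
    using that by (auto simp: open_ncs_def vimage_Union)
qed (transfer; simp add: algebra_simps sum_distrib_left fun_eq_iff; fail)+
end

lemma coeff_mult_Nil: "ncs_coeff (f * g) [] = ncs_coeff f [] * ncs_coeff g []"
  by transfer simp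

lemma ideal_coeff_Nil: "two_sided_ideal {f :: 'g ncs. ncs_coeff f [] = 0}"
  by (auto simp: two_sided_ideal_def coeff_mult_Nil zero_ncs.rep_eq plus_ncs.rep_eq)

lemma closed_coeff_Nil: "closed {f :: 'g ncs. ncs_coeff f [] = 0}"
proof -
  have "open ((\<lambda>f :: 'g list \<Rightarrow> complex. f []) -` (- {0}))"
    by (intro open_vimage open_Compl closed_singleton) (auto intro: continuous_intros)
  moreover have "Abs_ncs -` (- {f :: 'g ncs. ncs_coeff f [] = 0}) = (\<lambda>f. f []) -` (- {0})"
    by (auto simp: Abs_ncs_inverse)
  ultimately show ?thesis
    by (simp add: closed_def open_ncs_def)
qed


section \<open>The completed enveloping algebra of the Drinfeld--Kohno Lie algebra\<close>

datatype 'n strand = Pt 'n | Zs | Ws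

typedef 'n gen = "{S :: 'n strand set. card S = 2}"
proof
  show "{Zs, Ws} \<in> {S :: 'n strand set. card S = 2}" by simp
qed

text \<open>Generators are unordered pairs, so \<open>free_t a b = free_t b a\<close>; the value for \<open>a = b\<close> is
  meaningless and never used.\<close>

lift_definition free_t :: "'n strand \<Rightarrow> 'n strand \<Rightarrow> 'n gen ncs"
  is "\<lambda>a b w. if w = [Abs_gen {a, b}] then 1 else 0" .

definition commutator :: "'a::ring_1 \<Rightarrow> 'a \<Rightarrow> 'a" where
  "commutator x y = x * y - y * x"

definition dk_relators :: "'n gen ncs set" where
  "dk_relators =
     {commutator (free_t a b) (free_t c d) | a b c d. distinct [a, b, c, d]} \<union>
     {commutator (free_t a b + free_t a c) (free_t b c) | a b c. distinct [a, b, c]}"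

lemma coeff_Nil_closed_ideal:
  assumes "f \<in> closed_ideal (insert (free_t Zs Ws) dk_relators)"
  shows "ncs_coeff f [] = 0"
proof -
  have "insert (free_t Zs Ws) dk_relators \<subseteq> {f. ncs_coeff f [] = 0}"
    by (auto simp: dk_relators_def commutator_def minus_ncs.rep_eq coeff_mult_Nil
        plus_ncs.rep_eq free_t.rep_eq)
  from closed_ideal_least[OF ideal_coeff_Nil closed_coeff_Nil this] assms
  show ?thesis by auto
qed

text \<open>The enveloping algebra of a Lie algebra given by generators and relations is the associative
  algebra on the same generators and relations, with brackets read as commutators. As the relations
  are homogeneous, its completion with respect to the degree is the quotient of the algebra of
  noncommutative series by the closed ideal generated by the relators; it carries the quotient
  topology, which is the product topology of its finite-dimensional homogeneous components.
  \<open>'n dk\<close> is the completed enveloping algebra of the Lie algebra on the strands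
  \<open>Pt k\<close>, \<open>Zs\<close>, \<open>Ws\<close>, and \<open>'n dkq\<close> is that of its quotient by the Lie ideal generated by
  \<open>t_zw\<close>, which is presented by the additional relator \<open>t_zw\<close>.\<close>

quotient_type 'n dk = "'n gen ncs" / "\<lambda>f g. f - g \<in> closed_ideal dk_relators"
  by (intro ideal_equivp two_sided_ideal_closed_ideal)

quotient_type 'n dkq = "'n gen ncs"
  / "\<lambda>f g. f - g \<in> closed_ideal (insert (free_t Zs Ws) dk_relators)"
  by (intro ideal_equivp two_sided_ideal_closed_ideal)

instantiation dk :: (type) ring_1
begin
lift_definition zero_dk :: "'a dk" is 0 .
lift_definition one_dk :: "'a dk" is 1 .
lift_definition plus_dk :: "'a dk \<Rightarrow> 'a dk \<Rightarrow> 'a dk" is "(+)"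
  by (rule ideal_cong_add[OF two_sided_ideal_closed_ideal])
lift_definition minus_dk :: "'a dk \<Rightarrow> 'a dk \<Rightarrow> 'a dk" is "(-)"
  by (rule ideal_cong_diff[OF two_sided_ideal_closed_ideal])
lift_definition uminus_dk :: "'a dk \<Rightarrow> 'a dk" is uminus
  by (rule ideal_cong_uminus[OF two_sided_ideal_closed_ideal])
lift_definition times_dk :: "'a dk \<Rightarrow> 'a dk \<Rightarrow> 'a dk" is "(*)"
  by (rule ideal_cong_mult[OF two_sided_ideal_closed_ideal])
instance
proof
  show "(0::'a dk) \<noteq> 1"
  proof (transfer, rule notI)
    assume "0 - 1 \<in> closed_ideal (dk_relators :: 'a gen ncs set)"
    then have "0 - 1 \<in> closed_ideal (insert (free_t Zs Ws) dk_relators :: 'a gen ncs set)"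
      using closed_ideal_mono subset_insertI by blast
    from coeff_Nil_closed_ideal[OF this] show False
      by (simp add: uminus_ncs.rep_eq one_ncs.rep_eq)
  qed
qed (transfer; simp add: algebra_simps two_sided_ideal_closed_ideal[unfolded two_sided_ideal_def]; fail)+
end

instantiation dk :: (type) complex_algebra_topology
begin
definition open_dk :: "'a dk set \<Rightarrow> bool" where
  "open_dk U \<longleftrightarrow> open (abs_dk -` U)"
lift_definition scaleC_dk :: "complex \<Rightarrow> 'a dk \<Rightarrow> 'a dk" is scaleC
  by (rule ideal_cong_scaleC[OF two_sided_ideal_closed_ideal])
instance
proof
  show "open (UNIV :: 'a dk set)"
    by (simp add: open_dk_def)
  show "open (S \<inter> T)" if "open S" "open T" for S T :: "'a dk set"
    using that by (simp add: open_dk_def open_Int)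
  show "open (\<Union>K)" if "\<forall>S\<in>K. open S" for K :: "'a dk set set"
    using that by (auto simp: open_dk_def vimage_Union)
qed (transfer; simp add: scaleC_add_right scaleC_add_left scaleC_scaleC scaleC_one
    mult_scaleC_left mult_scaleC_right two_sided_ideal_closed_ideal[unfolded two_sided_ideal_def]; fail)+
end

instantiation dkq :: (type) ring_1
begin
lift_definition zero_dkq :: "'a dkq" is 0 .
lift_definition one_dkq :: "'a dkq" is 1 .
lift_definition plus_dkq :: "'a dkq \<Rightarrow> 'a dkq \<Rightarrow> 'a dkq" is "(+)"
  by (rule ideal_cong_add[OF two_sided_ideal_closed_ideal])
lift_definition minus_dkq :: "'a dkq \<Rightarrow> 'a dkq \<Rightarrow> 'a dkq" is "(-)"
  by (rule ideal_cong_diff[OF two_sided_ideal_closed_ideal])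
lift_definition uminus_dkq :: "'a dkq \<Rightarrow> 'a dkq" is uminus
  by (rule ideal_cong_uminus[OF two_sided_ideal_closed_ideal])
lift_definition times_dkq :: "'a dkq \<Rightarrow> 'a dkq \<Rightarrow> 'a dkq" is "(*)"
  by (rule ideal_cong_mult[OF two_sided_ideal_closed_ideal])
instance
proof
  show "(0::'a dkq) \<noteq> 1"
  proof (transfer, rule notI)
    assume "0 - 1 \<in> closed_ideal (insert (free_t Zs Ws) dk_relators :: 'a gen ncs set)"
    from coeff_Nil_closed_ideal[OF this] show False
      by (simp add: uminus_ncs.rep_eq one_ncs.rep_eq)
  qed
qed (transfer; simp add: algebra_simps two_sided_ideal_closed_ideal[unfolded two_sided_ideal_def]; fail)+
end

instantiation dkq :: (type) complex_algebra_topology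
begin
definition open_dkq :: "'a dkq set \<Rightarrow> bool" where
  "open_dkq U \<longleftrightarrow> open (abs_dkq -` U)"
lift_definition scaleC_dkq :: "complex \<Rightarrow> 'a dkq \<Rightarrow> 'a dkq" is scaleC
  by (rule ideal_cong_scaleC[OF two_sided_ideal_closed_ideal])
instance
proof
  show "open (UNIV :: 'a dkq set)"
    by (simp add: open_dkq_def)
  show "open (S \<inter> T)" if "open S" "open T" for S T :: "'a dkq set"
    using that by (simp add: open_dkq_def open_Int)
  show "open (\<Union>K)" if "\<forall>S\<in>K. open S" for K :: "'a dkq set set"
    using that by (auto simp: open_dkq_def vimage_Union)
qed (transfer; simp add: scaleC_add_right scaleC_add_left scaleC_scaleC scaleC_one
    mult_scaleC_left mult_scaleC_right two_sided_ideal_closed_ideal[unfolded two_sided_ideal_def]; fail)+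
end

lift_definition tt :: "'n strand \<Rightarrow> 'n strand \<Rightarrow> 'n dk" is free_t .

text \<open>The projection \<open>\<pi>\<close>, extended to the completed enveloping algebras.\<close>

lift_definition proj :: "'n dk \<Rightarrow> 'n dkq" is "\<lambda>f. f"
  using closed_ideal_mono subset_insertI by blast


section \<open>Calculus with values in a complex algebra with a topology\<close>

definition alg_inverse :: "'a::ring_1 \<Rightarrow> 'a" where
  "alg_inverse x = (THE y. x * y = 1 \<and> y * x = 1)"

definition alg_exp :: "'a::complex_algebra_topology \<Rightarrow> 'a" where
  "alg_exp x = (\<Sum>k. (1 / fact k) *\<^sub>C x ^ k)"

text \<open>The power \<open>b\<^bsup>x / 2\<pi>i\<^esup>\<close>. As \<open>Ln\<close> is the principal branch, it uses the real logarithm for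
  positive real \<open>b\<close> and is analytic in \<open>b\<close> off the nonpositive real axis.\<close>

definition monodromy_power :: "complex \<Rightarrow> 'a::complex_algebra_topology \<Rightarrow> 'a" where
  "monodromy_power b x = alg_exp ((Ln b / (2 * of_real pi * \<i>)) *\<^sub>C x)"

definition has_real_deriv ::
    "(real \<Rightarrow> 'a::complex_algebra_topology) \<Rightarrow> 'a \<Rightarrow> real \<Rightarrow> real set \<Rightarrow> bool" where
  "has_real_deriv \<Psi> D t S \<longleftrightarrow>
     ((\<lambda>s. complex_of_real (1 / (s - t)) *\<^sub>C (\<Psi> s - \<Psi> t)) \<longlongrightarrow> D) (at t within S)"

definition has_complex_deriv ::
    "(complex \<Rightarrow> 'a::complex_algebra_topology) \<Rightarrow> 'a \<Rightarrow> complex \<Rightarrow> bool" where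
  "has_complex_deriv \<Psi> D p \<longleftrightarrow> ((\<lambda>x. (1 / (x - p)) *\<^sub>C (\<Psi> x - \<Psi> p)) \<longlongrightarrow> D) (at p)"

definition analytic_disc :: "real \<Rightarrow> (complex \<Rightarrow> 'a::complex_algebra_topology) \<Rightarrow> bool" where
  "analytic_disc r f \<longleftrightarrow>
     (\<exists>c. \<forall>x. norm x < r \<longrightarrow> (\<lambda>k. x ^ k *\<^sub>C c k) sums f x)"

definition analytic_bidisc ::
    "real \<Rightarrow> (complex \<Rightarrow> complex \<Rightarrow> 'a::complex_algebra_topology) \<Rightarrow> bool" where
  "analytic_bidisc r f \<longleftrightarrow>
     (\<exists>c. \<forall>x y. norm x < r \<and> norm y < r \<longrightarrow>
        ((\<lambda>(p, q). (x ^ p * y ^ q) *\<^sub>C c p q) has_sum f x y) UNIV)"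


section \<open>Admissible paths\<close>

definition smooth_on_unit_interval :: "(real \<Rightarrow> complex) \<Rightarrow> bool" where
  "smooth_on_unit_interval \<gamma> \<longleftrightarrow>
     (\<exists>D :: nat \<Rightarrow> real \<Rightarrow> complex. D 0 = \<gamma> \<and>
        (\<forall>k. \<forall>t\<in>{0..1}. (D k has_vector_derivative D (Suc k) t) (at t within {0..1})))"

definition velocity :: "(real \<Rightarrow> complex) \<Rightarrow> real \<Rightarrow> complex" where
  "velocity \<gamma> t = vector_derivative \<gamma> (at t within {0..1})"

definition self_intersections :: "(real \<Rightarrow> complex) \<Rightarrow> (real \<times> real) set" where
  "self_intersections \<gamma> = {(t, s). 0 < t \<and> t < s \<and> s < 1 \<and> \<gamma> t = \<gamma> s}"

definition transverse :: "complex \<Rightarrow> complex \<Rightarrow> bool" where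
  "transverse u v \<longleftrightarrow> (\<forall>a b :: real. a *\<^sub>R u + b *\<^sub>R v = 0 \<longrightarrow> a = 0 \<and> b = 0)"

definition affine_near :: "(real \<Rightarrow> complex) \<Rightarrow> real \<Rightarrow> bool" where
  "affine_near \<gamma> t \<longleftrightarrow> (\<exists>c. \<forall>\<^sub>F s in nhds t. \<gamma> s = \<gamma> t + of_real (s - t) * c)"

definition ray :: "real \<times> real \<Rightarrow> real \<times> real \<Rightarrow> (real \<times> real) set" where
  "ray p q = {p + r *\<^sub>R (q - p) | r. 0 \<le> r}"

definition admissible_path ::
    "('n \<Rightarrow> complex) \<Rightarrow> 'n \<Rightarrow> complex \<Rightarrow> 'n \<Rightarrow> complex \<Rightarrow> (real \<Rightarrow> complex) \<Rightarrow> bool" where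
  "admissible_path pt i vi j vj \<gamma> \<longleftrightarrow>
     vi \<noteq> 0 \<and> vj \<noteq> 0 \<and>
     smooth_on_unit_interval \<gamma> \<and>
     (\<forall>t\<in>{0..1}. velocity \<gamma> t \<noteq> 0) \<and>
     (\<forall>t\<in>{0<..<1}. \<gamma> t \<notin> range pt) \<and>
     (\<exists>\<epsilon>>0. \<forall>t\<in>{0..\<epsilon>}. \<gamma> t = pt i + vi * of_real t) \<and>
     (\<exists>\<epsilon>>0. \<forall>t\<in>{1 - \<epsilon>..1}. \<gamma> t = pt j + vj * of_real (1 - t)) \<and>
     finite (self_intersections \<gamma>) \<and>
     (\<forall>(t, s)\<in>self_intersections \<gamma>.
        transverse (velocity \<gamma> t) (velocity \<gamma> s) \<and> affine_near \<gamma> t \<and> affine_near \<gamma> s) \<and>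
     inj_on (ray (0, 1)) (self_intersections \<gamma>)"


section \<open>Regularized holonomies from a tangential base point to a regular point\<close>

text \<open>The value at the point \<open>p\<close>, on the tangent vector \<open>v\<close>, of the connection
  \<open>1/(2\<pi>i) \<Sum>\<^sub>k x\<^sub>k dlog(z - z\<^sub>k)\<close>.\<close>

definition log_form :: "('n::finite \<Rightarrow> complex) \<Rightarrow> ('n \<Rightarrow> 'a::complex_algebra_topology) \<Rightarrow>
    complex \<Rightarrow> complex \<Rightarrow> 'a" where
  "log_form pt x p v =
     (1 / (2 * of_real pi * \<i>)) *\<^sub>C (\<Sum>k\<in>UNIV. (v / (p - pt k)) *\<^sub>C x k)"

definition tangential_solution :: "('n::finite \<Rightarrow> complex) \<Rightarrow> ('n \<Rightarrow> 'a::complex_algebra_topology) \<Rightarrow>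
    'n \<Rightarrow> complex \<Rightarrow> (real \<Rightarrow> complex) \<Rightarrow> real \<Rightarrow> (real \<Rightarrow> 'a) \<Rightarrow> bool" where
  "tangential_solution pt x r v \<delta> T \<Psi> \<longleftrightarrow>
     (\<forall>t\<in>{0<..T}. has_real_deriv \<Psi>
        (log_form pt x (\<delta> t) (vector_derivative \<delta> (at t within {0..T})) * \<Psi> t) t {0<..T}) \<and>
     (\<exists>f \<rho>. 0 < \<rho> \<and> analytic_disc \<rho> f \<and> f 0 = 1 \<and>
        (\<forall>\<^sub>F t in at_right 0.
           \<Psi> t = f ((\<delta> t - pt r) / v) * monodromy_power ((\<delta> t - pt r) / v) (x r)))"

text \<open>The holonomy along \<open>\<delta>\<close>, defined on \<open>{0..T}\<close>, of the connection with coefficients \<open>x\<close>, from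
  the tangential base point \<open>(pt r, v)\<close> to the regular point \<open>\<delta> T\<close>.\<close>

definition Hol_reg :: "('n::finite \<Rightarrow> complex) \<Rightarrow> ('n \<Rightarrow> 'a::complex_algebra_topology) \<Rightarrow>
    'n \<Rightarrow> complex \<Rightarrow> (real \<Rightarrow> complex) \<Rightarrow> real \<Rightarrow> 'a" where
  "Hol_reg pt x r v \<delta> T = (THE H. \<exists>\<Psi>. tangential_solution pt x r v \<delta> T \<Psi> \<and> H = \<Psi> T)"

definition coeff_z :: "'n \<Rightarrow> 'n dk" where "coeff_z k = tt (Pt k) Zs"

definition coeff_w :: "'n \<Rightarrow> 'n dk" where "coeff_w k = tt (Pt k) Ws"


section \<open>The elements \<open>C\<^sub>l\<close>\<close>

text \<open>The value of the connection \<open>A\<^bsub>z,w\<^esub>\<close> at \<open>(z, w)\<close> on the tangent vector \<open>(dz, dw)\<close>.\<close>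

definition A_zw :: "('n::finite \<Rightarrow> complex) \<Rightarrow> complex \<Rightarrow> complex \<Rightarrow> complex \<Rightarrow> complex \<Rightarrow> 'n dk" where
  "A_zw pt z w dz dw = (1 / (2 * of_real pi * \<i>)) *\<^sub>C
     ((\<Sum>k\<in>UNIV. (dz / (z - pt k)) *\<^sub>C tt (Pt k) Zs + (dw / (w - pt k)) *\<^sub>C tt (Pt k) Ws)
      + ((dz - dw) / (z - w)) *\<^sub>C tt Zs Ws)"

text \<open>The equation \<open>d\<Psi> = A\<^bsub>z,w\<^esub> \<Psi>\<close> at \<open>(z, w)\<close>, evaluated on all tangent vectors.\<close>

definition solves_at ::
    "('n::finite \<Rightarrow> complex) \<Rightarrow> (complex \<Rightarrow> complex \<Rightarrow> 'n dk) \<Rightarrow> complex \<Rightarrow> complex \<Rightarrow> bool" where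
  "solves_at pt F z w \<longleftrightarrow> (\<forall>dz dw.
     has_complex_deriv (\<lambda>h. F (z + h * dz) (w + h * dw)) (A_zw pt z w dz dw * F z w) 0)"

text \<open>The function \<open>s(t)\<close> parametrizing the segment from \<open>(0, 1)\<close> to \<open>(t0, s0)\<close>.\<close>

definition seg :: "real \<Rightarrow> real \<Rightarrow> real \<Rightarrow> real" where
  "seg t0 s0 t = (s0 - 1) / t0 * t + 1"

definition segment_solution :: "('n::finite \<Rightarrow> complex) \<Rightarrow> (real \<Rightarrow> complex) \<Rightarrow> real \<Rightarrow> real \<Rightarrow>
    (real \<Rightarrow> 'n dk) \<Rightarrow> bool" where
  "segment_solution pt \<gamma> t0 s0 \<Psi> \<longleftrightarrow>
     (\<forall>t\<in>{0<..<t0}. has_real_deriv \<Psi>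
        (A_zw pt (\<gamma> t) (\<gamma> (seg t0 s0 t)) (vector_derivative \<gamma> (at t))
           (vector_derivative (\<lambda>t. \<gamma> (seg t0 s0 t)) (at t)) * \<Psi> t) t {0<..<t0})"

text \<open>The normalizations of \<open>\<Psi>\<^sub>5\<close> near \<open>t = 0\<close> and of \<open>\<Psi>\<close> at \<open>a\<^sub>l\<close> near \<open>t = t\<^sub>l\<close>. The local solutions
  \<open>F\<close> in two variables are single-valued where the bases of the powers avoid the nonpositive real
  axis.\<close>

definition starts_normalized :: "('n::finite \<Rightarrow> complex) \<Rightarrow> 'n \<Rightarrow> complex \<Rightarrow> 'n \<Rightarrow> complex \<Rightarrow>
    (real \<Rightarrow> complex) \<Rightarrow> real \<Rightarrow> real \<Rightarrow> (real \<Rightarrow> 'n dk) \<Rightarrow> bool" where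
  "starts_normalized pt i vi j vj \<gamma> t0 s0 \<Psi> \<longleftrightarrow>
     (\<exists>f \<rho> F. 0 < \<rho> \<and> analytic_bidisc \<rho> f \<and> f 0 0 = 1 \<and>
        F = (\<lambda>z w. f (z - pt i) (w - pt j) *
               monodromy_power ((z - pt i) / vi) (tt (Pt i) Zs) *
               monodromy_power ((w - pt j) / vj) (tt (Pt j) Ws)) \<and>
        (\<forall>z w. norm (z - pt i) < \<rho> \<and> norm (w - pt j) < \<rho> \<and>
           (z - pt i) / vi \<notin> \<real>\<^sub>\<le>\<^sub>0 \<and> (w - pt j) / vj \<notin> \<real>\<^sub>\<le>\<^sub>0 \<longrightarrow> solves_at pt F z w) \<and>
        (\<forall>\<^sub>F t in at_right 0. \<Psi> t = F (\<gamma> t) (\<gamma> (seg t0 s0 t))))"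

definition ends_normalized :: "('n::finite \<Rightarrow> complex) \<Rightarrow> (real \<Rightarrow> complex) \<Rightarrow> real \<Rightarrow> real \<Rightarrow>
    (real \<Rightarrow> 'n dk) \<Rightarrow> bool" where
  "ends_normalized pt \<gamma> t0 s0 \<Psi> \<longleftrightarrow>
     (let a = \<gamma> t0; u = vector_derivative (\<lambda>t. \<gamma> (seg t0 s0 t) - \<gamma> t) (at t0) in
      \<exists>h \<rho> F. 0 < \<rho> \<and> analytic_bidisc \<rho> h \<and> h 0 0 = 1 \<and>
        F = (\<lambda>z w. h (z - a) (w - z) * monodromy_power ((w - z) / (- u)) (tt Zs Ws)) \<and>
        (\<forall>z w. norm (z - a) < \<rho> \<and> norm (w - z) < \<rho> \<and>
           (w - z) / (- u) \<notin> \<real>\<^sub>\<le>\<^sub>0 \<longrightarrow> solves_at pt F z w) \<and>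
        (\<forall>\<^sub>F t in at_left t0. \<Psi> t = F (\<gamma> t) (\<gamma> (seg t0 s0 t))))"

definition C_hol :: "('n::finite \<Rightarrow> complex) \<Rightarrow> 'n \<Rightarrow> complex \<Rightarrow> 'n \<Rightarrow> complex \<Rightarrow>
    (real \<Rightarrow> complex) \<Rightarrow> real \<Rightarrow> real \<Rightarrow> 'n dk" where
  "C_hol pt i vi j vj \<gamma> t0 s0 = (THE C. \<exists>\<Psi>5 \<Psi>a.
     segment_solution pt \<gamma> t0 s0 \<Psi>5 \<and> starts_normalized pt i vi j vj \<gamma> t0 s0 \<Psi>5 \<and>
     segment_solution pt \<gamma> t0 s0 \<Psi>a \<and> ends_normalized pt \<gamma> t0 s0 \<Psi>a \<and>
     (\<forall>t\<in>{0<..<t0}. C = alg_inverse (\<Psi>a t) * \<Psi>5 t))"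

end

theory Submission
  imports Defs
begin

text \<open>Every equation is solved coefficientwise in noncommutative power series and pushed forward
  to the quotient algebras. A continuous functional on such a quotient sees only words of bounded
  length, and multiplication by a linear form lowers this bound. Tested against functionals, a
  linear equation is therefore triangular, and a solution that tends weakly to \<open>0\<close> at one point,
  possibly singular, vanishes; this yields the uniqueness of all normalized solutions.

  For the local solutions in two variables, the contraction of the system with the Euler field
  \<open>x \<partial>\<^sub>x + y \<partial>\<^sub>y\<close> is solved in the free algebra as a double power series, recursively in the length
  of the words, and flatness upgrades it modulo the relators to a solution of the whole system.

  Modulo \<open>t_zw\<close> the coefficients of \<open>A\<^sub>z\<close> commute with those of \<open>A\<^sub>w\<close>. Hence the product of the
  tangential solutions along the two branches solves the equation along \<open>L\<^sub>l\<close> with the same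
  asymptotics at \<open>t = 0\<close> as \<open>\<Psi>\<^sub>5\<close>, and so equals it, while \<open>\<Psi>\<close> at \<open>a\<^sub>l\<close> tends to \<open>1\<close>; the limit
  \<open>t \<rightarrow> t\<^sub>l\<close> gives the formula.\<close>

section \<open>Quotients of the algebra of noncommutative series\<close>

text \<open>The definite descriptions in the definitions range over arbitrary solutions with values
  in a quotient algebra. Nothing supplies such a solution with a differentiable lift, so
  coefficients are available only for solutions constructed upstairs; on the quotients continuous
  functionals take their place. That enough of them exist to separate points follows from closedness
  of the ideals, and this also supplies uniqueness of limits. Multiplication in a quotient is shown
  continuous only in each factor, hence product rules are applied to lifts. At a tangential base
  point two normalized solutions differ by a factor vanishing there, times common multivalued
  powers. For a functional of bounded degree these powers are polynomials in the logarithm, and O(t)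
  beats any power of ln t: this is how a normalization at a singular point acts as an initial value.
  In the free algebra the connection is not flat, so the full system in two variables has no
  solution there in general, whereas the single Euler equation is solved by dividing coefficients by
  the total degree.\<close>

lemma coeff_simps [simp]:
  "ncs_coeff 0 w = 0" "ncs_coeff (f + g) w = ncs_coeff f w + ncs_coeff g w"
  "ncs_coeff (f - g) w = ncs_coeff f w - ncs_coeff g w" "ncs_coeff (- f) w = - ncs_coeff f w"
  "ncs_coeff (c *\<^sub>C f) w = c * ncs_coeff f w"
  "ncs_coeff 1 w = (if w = [] then 1 else 0)"
  by (simp_all add: zero_ncs.rep_eq plus_ncs.rep_eq minus_ncs.rep_eq uminus_ncs.rep_eq
      scaleC_ncs.rep_eq one_ncs.rep_eq)

lemma coeff_sum [simp]: "ncs_coeff (\<Sum>x\<in>A. f x) w = (\<Sum>x\<in>A. ncs_coeff (f x) w)"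
  by (induction A rule: infinite_finite_induct) auto

lemma coeff_Abs [simp]: "ncs_coeff (Abs_ncs f) = f"
  by (simp add: Abs_ncs_inverse)

text \<open>Open sets of series are pulled back along the bijection \<open>Abs_ncs\<close> from a
  function space with the product topology, where convergence is componentwise.\<close>

lemma tendsto_ncs_iff:
  "(f \<longlongrightarrow> l) F \<longleftrightarrow> (\<forall>w. ((\<lambda>x. ncs_coeff (f x) w) \<longlongrightarrow> ncs_coeff l w) F)"
proof -
  have "(f \<longlongrightarrow> l) F \<longleftrightarrow> ((\<lambda>x. ncs_coeff (f x)) \<longlongrightarrow> ncs_coeff l) F"
  proof
    assume f: "(f \<longlongrightarrow> l) F"
    show "((\<lambda>x. ncs_coeff (f x)) \<longlongrightarrow> ncs_coeff l) F"
    proof (rule topological_tendstoI)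
      fix S assume S: "open S" "ncs_coeff l \<in> S"
      have "Abs_ncs -` (ncs_coeff -` S) = S" by auto
      then have "open (ncs_coeff -` S)" using S by (simp add: open_ncs_def)
      from topological_tendstoD[OF f this] S show "\<forall>\<^sub>F x in F. ncs_coeff (f x) \<in> S" by simp
    qed
  next
    assume f: "((\<lambda>x. ncs_coeff (f x)) \<longlongrightarrow> ncs_coeff l) F"
    show "(f \<longlongrightarrow> l) F"
    proof (rule topological_tendstoI)
      fix S assume S: "open S" "l \<in> S"
      then have "open (Abs_ncs -` S)" by (simp add: open_ncs_def)
      from topological_tendstoD[OF f this] S show "\<forall>\<^sub>F x in F. f x \<in> S"
        by (simp add: ncs_coeff_inverse)
    qed
  qed
  also have "\<dots> \<longleftrightarrow> (\<forall>w. ((\<lambda>x. ncs_coeff (f x) w) \<longlongrightarrow> ncs_coeff l w) F)"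
    using limitin_componentwise[of "\<lambda>_. euclidean" UNIV "\<lambda>x. ncs_coeff (f x)" "ncs_coeff l" F]
    by (simp add: euclidean_product_topology)
  finally show ?thesis .
qed

lemma tendsto_coeff: "(f \<longlongrightarrow> l) F \<Longrightarrow> ((\<lambda>x. ncs_coeff (f x) w) \<longlongrightarrow> ncs_coeff l w) F"
  by (simp add: tendsto_ncs_iff)

lemma coeff_mult: "ncs_coeff (f * g) w = (\<Sum>k\<le>length w. ncs_coeff f (take k w) * ncs_coeff g (drop k w))"
  by (simp add: times_ncs.rep_eq)

lemma tendsto_mult_ncs:
  fixes f g :: "'b \<Rightarrow> 'g ncs"
  assumes "(f \<longlongrightarrow> a) F" "(g \<longlongrightarrow> b) F"
  shows "((\<lambda>x. f x * g x) \<longlongrightarrow> a * b) F"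
  using assms by (auto simp: tendsto_ncs_iff coeff_mult intro!: tendsto_intros)

lemma continuous_on_ncsI:
  fixes m :: "'g ncs \<Rightarrow> 'b::topological_space"
  assumes "\<And>F f (l :: 'g ncs). (f \<longlongrightarrow> l) F \<Longrightarrow> ((\<lambda>x. m (f x)) \<longlongrightarrow> m l) (F :: 'g ncs filter)"
  shows "continuous_on UNIV m"
  unfolding continuous_on_def using assms[OF tendsto_ident_at] by simp

lemma sums_ncs_iff: "f sums (s :: 'g ncs) \<longleftrightarrow> (\<forall>w. (\<lambda>k. ncs_coeff (f k) w) sums ncs_coeff s w)"
  by (simp add: sums_def tendsto_ncs_iff)

lemma has_sum_ncs_iff:
  "(f has_sum (s :: 'g ncs)) A \<longleftrightarrow> (\<forall>w. ((\<lambda>k. ncs_coeff (f k) w) has_sum ncs_coeff s w) A)"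
  by (simp add: has_sum_def tendsto_ncs_iff)

section \<open>Scalar multiplication and difference quotients\<close>

lemma scaleC_zero_right [simp]: "c *\<^sub>C (0::'a::complex_algebra_topology) = 0"
  using scaleC_add_right[of c "0::'a" 0] by simp

lemma scaleC_zero_left [simp]: "0 *\<^sub>C (x::'a::complex_algebra_topology) = 0"
  using scaleC_add_left[of 0 0 x] by simp

lemma scaleC_minus_left: "(- c) *\<^sub>C (x::'a::complex_algebra_topology) = - (c *\<^sub>C x)"
  using scaleC_add_left[of "-c" c x] by (simp add: eq_neg_iff_add_eq_0)

lemma scaleC_minus_right: "c *\<^sub>C (- (x::'a::complex_algebra_topology)) = - (c *\<^sub>C x)"
  using scaleC_add_right[of c "-x" x] by (simp add: eq_neg_iff_add_eq_0)

lemma scaleC_diff_right: "c *\<^sub>C (x - y) = c *\<^sub>C x - c *\<^sub>C (y::'a::complex_algebra_topology)"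
  using scaleC_add_right[of c x "-y"] by (simp add: scaleC_minus_right)

lemma scaleC_sum_right:
  "c *\<^sub>C (\<Sum>x\<in>A. f x) = (\<Sum>x\<in>A. c *\<^sub>C (f x :: 'a::complex_algebra_topology))"
  by (induction A rule: infinite_finite_induct) (auto simp: scaleC_add_right)

lemma vector_space_scaleC: "vector_space (scaleC :: complex \<Rightarrow> 'a \<Rightarrow> 'a::complex_algebra_topology)"
  by unfold_locales (auto simp: scaleC_add_right scaleC_add_left scaleC_scaleC scaleC_one)

text \<open>Bridge between the difference quotients of \<open>has_real_deriv\<close>, which make
  sense without a norm, and the derivative of normed spaces that governs coefficients and
  functionals.\<close>

lemma has_vector_derivative_iff_quotient:
  fixes f :: "real \<Rightarrow> 'b::real_normed_vector"
  shows "(f has_vector_derivative D) (at t within S) \<longleftrightarrow>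
    ((\<lambda>s. (1 / (s - t)) *\<^sub>R (f s - f t)) \<longlongrightarrow> D) (at t within S)"
proof -
  have "\<forall>\<^sub>F s in at t within S. norm ((f s - (f t + (s - t) *\<^sub>R D)) /\<^sub>R norm (s - t)) =
      norm ((1 / (s - t)) *\<^sub>R (f s - f t) - D)"
    unfolding eventually_at_filter
  proof (rule always_eventually, intro allI impI)
    fix s assume "s \<noteq> t"
    then have "f s - (f t + (s - t) *\<^sub>R D) = (s - t) *\<^sub>R ((1 / (s - t)) *\<^sub>R (f s - f t) - D)"
      by (simp add: scaleR_diff_right)
    with \<open>s \<noteq> t\<close> show "norm ((f s - (f t + (s - t) *\<^sub>R D)) /\<^sub>R norm (s - t)) =
        norm ((1 / (s - t)) *\<^sub>R (f s - f t) - D)"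
      by (simp add: abs_mult)
  qed
  from tendsto_cong[OF this, of 0]
  have "((\<lambda>s. (f s - (f t + (s - t) *\<^sub>R D)) /\<^sub>R norm (s - t)) \<longlongrightarrow> 0) (at t within S) \<longleftrightarrow>
      ((\<lambda>s. (1 / (s - t)) *\<^sub>R (f s - f t) - D) \<longlongrightarrow> 0) (at t within S)"
    by (simp only: tendsto_norm_zero_iff)
  then show ?thesis
    by (simp add: has_vector_derivative_def has_derivative_within bounded_linear_scaleR_left
        inverse_eq_divide LIM_zero_iff)
qed

section \<open>Linear forms and the filtration by word length\<close>

definition linear_form :: "'g ncs \<Rightarrow> bool" where
  "linear_form l \<longleftrightarrow> (\<forall>w. length w \<noteq> 1 \<longrightarrow> ncs_coeff l w = 0)"

text \<open>The N-th step of the degree filtration; a product with a linear form moves one step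
  up.\<close>

definition vanishes_below :: "nat \<Rightarrow> 'g ncs \<Rightarrow> bool" where
  "vanishes_below N f \<longleftrightarrow> (\<forall>w. length w < N \<longrightarrow> ncs_coeff f w = 0)"

lemma linear_form_simps:
  "linear_form 0"
  "linear_form l \<Longrightarrow> linear_form (c *\<^sub>C l)"
  "linear_form l \<Longrightarrow> linear_form m \<Longrightarrow> linear_form (l + m)"
  "linear_form l \<Longrightarrow> linear_form m \<Longrightarrow> linear_form (l - m)"
  "(\<And>x. x \<in> A \<Longrightarrow> linear_form (f x)) \<Longrightarrow> linear_form (\<Sum>x\<in>A. f x)"
  by (auto simp: linear_form_def)

lemma linear_form_free_t: "linear_form (free_t a b)"
  by (auto simp: linear_form_def free_t.rep_eq)

text \<open>In the convolution only the splitting after the first letter survives. Hence in an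
  equation with linear coefficients the coefficient at a word is driven by the coefficient at its
  tail, and everything can be solved by recursion on length.\<close>

lemma coeff_linear_mult:
  assumes "linear_form l"
  shows "ncs_coeff (l * f) w = (if w = [] then 0 else ncs_coeff l [hd w] * ncs_coeff f (tl w))"
proof (cases w)
  case Nil
  then show ?thesis using assms by (simp add: coeff_mult linear_form_def)
next
  case (Cons a v)
  have "ncs_coeff (l * f) w = (\<Sum>k\<le>length w. if k = 1 then ncs_coeff l [a] * ncs_coeff f v else 0)"
    unfolding coeff_mult
  proof (rule sum.cong[OF refl])
    fix k assume "k \<in> {..length w}"
    then show "ncs_coeff l (take k w) * ncs_coeff f (drop k w) =
        (if k = 1 then ncs_coeff l [a] * ncs_coeff f v else 0)"
      using assms Cons by (cases "k = 1") (auto simp: linear_form_def)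
  qed
  also have "\<dots> = ncs_coeff l [a] * ncs_coeff f v"
    using Cons by (subst sum.delta) auto
  finally show ?thesis using Cons by simp
qed

lemma coeff_mult_linear:
  assumes "linear_form l"
  shows "ncs_coeff (f * l) w = (if w = [] then 0 else ncs_coeff f (butlast w) * ncs_coeff l [last w])"
proof (cases w rule: rev_cases)
  case Nil
  then show ?thesis using assms by (simp add: coeff_mult linear_form_def)
next
  case (snoc v a)
  have "ncs_coeff (f * l) w = (\<Sum>k\<le>length w. if k =
      length v then ncs_coeff f v * ncs_coeff l [a] else 0)"
    unfolding coeff_mult
  proof (rule sum.cong[OF refl])
    fix k assume "k \<in> {..length w}"
    then have "k = length v \<or> length (drop k w) \<noteq> 1"
      using snoc by auto
    then show "ncs_coeff f (take k w) * ncs_coeff l (drop k w) =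
        (if k = length v then ncs_coeff f v * ncs_coeff l [a] else 0)"
      using assms snoc by (auto simp: linear_form_def)
  qed
  then show ?thesis using snoc by simp
qed

lemma vanishes_below_mult:
  assumes "vanishes_below N f"
  shows "vanishes_below N (g * f)" "vanishes_below N (f * g)"
  using assms by (auto simp: vanishes_below_def coeff_mult)

lemma vanishes_below_linear:
  assumes "vanishes_below N f" "linear_form l"
  shows "vanishes_below (Suc N) (l * f)" "vanishes_below (Suc N) (f * l)"
proof -
  have "length (tl w) < N" "length (butlast w) < N" if "w \<noteq> []" "length w < Suc N" for w :: "'a list"
    using that by (cases w; simp)+
  then show "vanishes_below (Suc N) (l * f)" "vanishes_below (Suc N) (f * l)"
    using assms by (auto simp: vanishes_below_def coeff_linear_mult coeff_mult_linear)
qed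

text \<open>Common interface for \<open>abs_dk\<close>, \<open>abs_dkq\<close> and the identity. Of
  the topology it records only that \<open>q\<close> is a quotient map with closed kernel;
  separation of points is derived from these two facts.\<close>

locale ncs_quotient =
  fixes q :: "'g ncs \<Rightarrow> 'a::complex_algebra_topology"
  assumes q_add: "q (f + g) = q f + q g"
    and q_mult: "q (f * g) = q f * q g"
    and q_one: "q 1 = 1"
    and q_scaleC: "q (c *\<^sub>C f) = c *\<^sub>C q f"
    and q_surj: "surj q"
    and open_q: "open U \<longleftrightarrow> open (q -` U)"
    and closed_kernel: "closed {f. q f = 0}"
begin

lemma q_zero: "q 0 = 0"
  using q_add[of 0 0] by simp

lemma q_minus: "q (- f) = - q f"
  using q_add[of f "-f"] q_zero by (simp add: eq_neg_iff_add_eq_0 add.commute)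

lemma q_diff: "q (f - g) = q f - q g"
  using q_add[of f "-g"] by (simp add: q_minus)

lemma q_sum: "q (\<Sum>x\<in>A. f x) = (\<Sum>x\<in>A. q (f x))"
  by (induction A rule: infinite_finite_induct) (auto simp: q_zero q_add)

lemma q_power: "q (f ^ k) = q f ^ k"
  by (induction k) (auto simp: q_one q_mult)

lemmas q_simps = q_zero q_add q_minus q_diff q_sum q_mult q_one q_scaleC q_power

lemma obtain_lift: obtains f where "x = q f"
  using q_surj by (metis surjD)

lemma continuous_q: "continuous_on UNIV q"
  unfolding continuous_on_open_vimage[OF open_UNIV] using open_q by auto

lemma tendsto_q: "(f \<longlongrightarrow> l) F \<Longrightarrow> ((\<lambda>x. q (f x)) \<longlongrightarrow> q l) F"
  using continuous_on_tendsto_compose[OF continuous_q, of f l F] by simp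

lemma continuous_factor:
  fixes m :: "'a \<Rightarrow> 'b::topological_space"
  assumes "continuous_on UNIV (m \<circ> q)"
  shows "continuous_on UNIV m"
  using assms unfolding continuous_on_open_vimage[OF open_UNIV] by (auto simp: open_q vimage_comp)

text \<open>The universal property of the quotient topology handles one variable at a time, so
  continuity is transferred from series with the other factor fixed.\<close>

lemma continuous_mult_left: "continuous_on UNIV (\<lambda>y. (x::'a) * y)"
proof -
  obtain f where f: "x = q f" by (rule obtain_lift)
  have "continuous_on UNIV (\<lambda>g. f * g)"
    by (rule continuous_on_ncsI) (intro tendsto_mult_ncs tendsto_const)
  then have "continuous_on UNIV (q \<circ> (\<lambda>g. f * g))"
    using continuous_q by (meson continuous_on_compose continuous_on_subset subset_UNIV)
  then show ?thesis
    by (intro continuous_factor) (simp add: o_def f q_mult)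
qed

lemma continuous_mult_right: "continuous_on UNIV (\<lambda>y. y * (x::'a))"
proof -
  obtain f where f: "x = q f" by (rule obtain_lift)
  have "continuous_on UNIV (\<lambda>g. g * f)"
    by (rule continuous_on_ncsI) (intro tendsto_mult_ncs tendsto_const)
  then have "continuous_on UNIV (q \<circ> (\<lambda>g. g * f))"
    using continuous_q by (meson continuous_on_compose continuous_on_subset subset_UNIV)
  then show ?thesis
    by (intro continuous_factor) (simp add: o_def f q_mult)
qed

text \<open>Continuous functionals together with a degree bound: they depend only on words shorter
  than \<open>N\<close>. The bound is the induction parameter of the uniqueness proofs.\<close>

definition dual :: "nat \<Rightarrow> ('a \<Rightarrow> complex) \<Rightarrow> bool" where
  "dual N \<phi> \<longleftrightarrow> (\<forall>x y. \<phi> (x + y) = \<phi> x + \<phi> y) \<and> (\<forall>c x. \<phi> (c *\<^sub>C x) = c * \<phi> x) \<and>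
     continuous_on UNIV \<phi> \<and> (\<forall>f. vanishes_below N f \<longrightarrow> \<phi> (q f) = 0)"

lemma dual_add: "dual N \<phi> \<Longrightarrow> \<phi> (x + y) = \<phi> x + \<phi> y"
  and dual_scaleC: "dual N \<phi> \<Longrightarrow> \<phi> (c *\<^sub>C x) = c * \<phi> x"
  and dual_continuous: "dual N \<phi> \<Longrightarrow> continuous_on UNIV \<phi>"
  and dual_vanish: "dual N \<phi> \<Longrightarrow> vanishes_below N f \<Longrightarrow> \<phi> (q f) = 0"
  by (auto simp: dual_def)

lemma dual_zero: "dual N \<phi> \<Longrightarrow> \<phi> 0 = 0"
  using dual_add[of N \<phi> 0 0] by simp

lemma dual_minus: "dual N \<phi> \<Longrightarrow> \<phi> (- x) = - \<phi> x"
  using dual_add[of N \<phi> x "-x"] dual_zero[of N \<phi>] by (simp add: eq_neg_iff_add_eq_0 add.commute)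

lemma dual_diff: "dual N \<phi> \<Longrightarrow> \<phi> (x - y) = \<phi> x - \<phi> y"
  using dual_add[of N \<phi> x "-y"] by (simp add: dual_minus)

lemma dual_sum: "dual N \<phi> \<Longrightarrow> \<phi> (\<Sum>x\<in>A. f x) = (\<Sum>x\<in>A. \<phi> (f x))"
  by (induction A rule: infinite_finite_induct) (auto simp: dual_zero dual_add)

lemma dual_0: "dual 0 \<phi> \<Longrightarrow> \<phi> x = 0"
  using obtain_lift[of x] by (auto simp: dual_def vanishes_below_def)

lemma dual_tendsto: "dual N \<phi> \<Longrightarrow> (f \<longlongrightarrow> l) F \<Longrightarrow> ((\<lambda>x. \<phi> (f x)) \<longlongrightarrow> \<phi> l) F"
  using continuous_on_tendsto_compose[OF dual_continuous, of N \<phi> f l F] by simp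

lemma dual_comp_mult:
  assumes "dual N \<phi>"
  shows "dual N (\<lambda>y. \<phi> (x * y))" "dual N (\<lambda>y. \<phi> (y * x))"
proof -
  obtain f where f: "x = q f" by (rule obtain_lift)
  have "continuous_on UNIV (\<phi> \<circ> (\<lambda>y. x * y))" "continuous_on UNIV (\<phi> \<circ> (\<lambda>y. y * x))"
    by (rule continuous_on_compose continuous_mult_left continuous_mult_right
        continuous_on_subset[OF dual_continuous[OF assms]] subset_UNIV)+
  then show "dual N (\<lambda>y. \<phi> (x * y))" "dual N (\<lambda>y. \<phi> (y * x))"
    using assms unfolding dual_def
    by (auto simp: o_def algebra_simps mult_scaleC_right mult_scaleC_left f q_mult[symmetric]
        vanishes_below_mult)
qed

lemma dual_comp_linear:
  assumes "dual (Suc N) \<phi>" "linear_form l"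
  shows "dual N (\<lambda>y. \<phi> (q l * y))" "dual N (\<lambda>y. \<phi> (y * q l))"
  using dual_comp_mult[OF assms(1)] assms vanishes_below_linear[OF _ assms(2)]
  unfolding dual_def by (auto simp: q_mult[symmetric])

text \<open>Since the kernel is closed, a basic neighbourhood of a lift of \<open>x\<close> misses
  it, and such a neighbourhood constrains finitely many coefficients only. Restricting to these
  words reduces the separation of a point from a closed subspace to linear algebra in finitely many
  coordinates.\<close>

lemma dual_separates:
  assumes "x \<noteq> 0"
  obtains N \<phi> where "dual N \<phi>" "\<phi> x \<noteq> 0"
proof -
  obtain f where f: "x = q f" by (rule obtain_lift)
  define K where "K = {f. q f = 0}"
  have "f \<notin> K" using assms f by (simp add: K_def)
  have "open (ncs_coeff ` (- K))"
  proof -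
    have "ncs_coeff ` (- K) = Abs_ncs -` (- K)"
      by (auto simp: ncs_coeff_inverse intro!: image_eqI[of _ ncs_coeff "Abs_ncs _"])
    moreover have "open (- K)" using closed_kernel by (simp add: K_def open_Compl)
    ultimately show ?thesis by (simp add: open_ncs_def)
  qed
  then have "openin (product_topology (\<lambda>_. euclidean) UNIV) (ncs_coeff ` (- K))"
    by (simp add: open_fun_def)
  moreover have "ncs_coeff f \<in> ncs_coeff ` (- K)" using \<open>f \<notin> K\<close> by simp
  ultimately obtain X where X: "ncs_coeff f \<in> (\<Pi>\<^sub>E i\<in>UNIV. X i)"
      "finite {i. X i \<noteq> UNIV}" "(\<Pi>\<^sub>E i\<in>UNIV. X i) \<subseteq> ncs_coeff ` (- K)"
    by (rule product_topology_open_contains_basis[elim_format]) auto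
  \<comment> \<open>The finitely many words constrained by the neighbourhood; \<open>R\<close>
    forgets all other coefficients.\<close>
  define W where "W = {i. X i \<noteq> UNIV}"
  define R where "R = (\<lambda>g :: 'g ncs. Abs_ncs (\<lambda>w. if w \<in> W then ncs_coeff g w else 0))"
  have cR: "ncs_coeff (R g) w = (if w \<in> W then ncs_coeff g w else 0)" for g w
    by (simp add: R_def)
  \<comment> \<open>An element of the kernel that agrees with \<open>f\<close> on \<open>W\<close>
    would lie in the neighbourhood, which misses the kernel.\<close>
  have notR: "R f \<noteq> R g" if "g \<in> K" for g
  proof
    assume eq: "R f = R g"
    have "ncs_coeff g w \<in> X w" for w
    proof (cases "w \<in> W")
      case True
      then have "ncs_coeff g w = ncs_coeff f w" using eq cR by metis
      then show ?thesis using X(1) by auto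
    qed (auto simp: W_def)
    then have "ncs_coeff g \<in> ncs_coeff ` (- K)" using X(3) by (auto simp: PiE_iff)
    then show False using that by (auto simp: ncs_coeff_inject)
  qed
  interpret V: vector_space "scaleC :: complex \<Rightarrow> 'g ncs \<Rightarrow> 'g ncs" by (rule vector_space_scaleC)
  interpret C: vector_space "(*) :: complex \<Rightarrow> complex \<Rightarrow> complex"
    by unfold_locales (auto simp: algebra_simps)
  interpret VC: vector_space_pair "scaleC :: complex \<Rightarrow> 'g ncs \<Rightarrow> 'g ncs"
      "(*) :: complex \<Rightarrow> complex \<Rightarrow> complex" ..
  have R_add: "R (g + h) = R g + R h" and R_scale: "R (c *\<^sub>C g) = c *\<^sub>C R g" for g h c
    by (auto intro!: ncs_eqI simp: cR)
  have subK: "V.subspace (R ` K)"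
  proof (rule V.subspaceI)
    show "0 \<in> R ` K" by (rule image_eqI[of _ _ 0]) (auto simp: K_def q_zero cR intro!: ncs_eqI)
    show "x + y \<in> R ` K" if "x \<in> R ` K" "y \<in> R ` K" for x y
      using that by (auto simp: K_def q_add R_add[symmetric])
    show "c *\<^sub>C x \<in> R ` K" if "x \<in> R ` K" for c x
      using that by (auto simp: K_def q_scaleC R_scale[symmetric])
  qed
  obtain B where B: "B \<subseteq> R ` K" "V.independent B" "R ` K \<subseteq> V.span B"
    using V.maximal_independent_subset by blast
  have "R f \<notin> V.span B"
  proof
    assume "R f \<in> V.span B"
    moreover have "V.span B \<subseteq> R ` K" by (rule V.span_minimal[OF B(1) subK])
    ultimately show False using notR by auto
  qed
  then have "V.independent (insert (R f) B)" and RB: "R f \<notin> B"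
    using B(2) V.independent_insert V.span_base by auto
  \<comment> \<open>\<open>B\<close> is a basis of the image of the kernel, so \<open>\<psi>\<close>
    vanishes on that image and equals 1 at \<open>R f\<close>. Its composite with \<open>R\<close>
    is continuous because it reads finitely many coefficients.\<close>
  then obtain \<psi> where \<psi>: "Vector_Spaces.linear scaleC (*) \<psi>"
      "\<forall>b\<in>insert (R f) B. \<psi> b = (if b = R f then 1 else 0)"
    using VC.linear_independent_extend[of "insert (R f) B" "\<lambda>b. if b = R f then 1 else 0"] by auto
  interpret L: Vector_Spaces.linear "scaleC :: complex \<Rightarrow> 'g ncs \<Rightarrow> 'g ncs" "(*)" \<psi> by (rule \<psi>(1))
  have \<psi>K: "\<psi> (R g) = 0" if "g \<in> K" for g
    by (rule L.eq_0_on_span[of B]) (use \<psi>(2) RB B that in auto)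
  have \<psi>R: "\<psi> (R g) = \<psi> (R h)" if "q g = q h" for g h
  proof -
    have "g - h \<in> K" using that by (simp add: K_def q_diff)
    moreover have "R g = R (g - h) + R h" by (simp flip: R_add)
    ultimately show ?thesis using \<psi>K L.add by simp
  qed
  define e where "e = (\<lambda>v :: 'g list. Abs_ncs (\<lambda>w. if w = v then 1 else 0 :: complex))"
  have "R g = (\<Sum>v\<in>W. ncs_coeff g v *\<^sub>C e v)" for g
    using X(2) by (intro ncs_eqI) (auto simp: cR e_def W_def[symmetric] if_distrib sum.delta cong:
        if_cong)
  then have \<psi>e: "\<psi> (R g) = (\<Sum>v\<in>W. ncs_coeff g v * \<psi> (e v))" for g
    by (simp add: L.sum L.scale)
  \<comment> \<open>The arbitrary choice of a preimage is harmless by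
    \<open>\<psi>R\<close>.\<close>
  define \<phi> where "\<phi> = (\<lambda>y. \<psi> (R (SOME g. q g = y)))"
  have \<phi>: "\<phi> (q g) = \<psi> (R g)" for g
    unfolding \<phi>_def by (rule \<psi>R, rule someI[of "\<lambda>h. q h = q g" g]) simp
  \<comment> \<open>One more than the longest word in \<open>W\<close>; the inserted 0 covers the
    case of empty \<open>W\<close>.\<close>
  define N where "N = Suc (Max (insert 0 (length ` W)))"
  have "dual N \<phi>"
    unfolding dual_def
  proof (intro conjI allI impI)
    fix x y :: 'a and c
    obtain g h where "x = q g" "y = q h" using obtain_lift by metis
    then show "\<phi> (x + y) = \<phi> x + \<phi> y" "\<phi> (c *\<^sub>C x) = c * \<phi> x"
      by (simp_all add: q_add[symmetric] q_scaleC[symmetric] \<phi> R_add R_scale L.add L.scale)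
  next
    have "continuous_on UNIV (\<lambda>g. \<psi> (R g))"
      unfolding \<psi>e by (rule continuous_on_ncsI) (intro tendsto_intros tendsto_coeff)
    then show "continuous_on UNIV \<phi>"
      by (intro continuous_factor) (simp add: o_def \<phi>)
  next
    fix g :: "'g ncs" assume "vanishes_below N g"
    moreover have "length w < N" if "w \<in> W" for w
      unfolding N_def less_Suc_eq_le using that X(2) by (intro Max_ge) (auto simp: W_def)
    ultimately show "\<phi> (q g) = 0" by (simp add: \<phi> \<psi>e vanishes_below_def)
  qed
  moreover have "\<phi> x \<noteq> 0" using \<psi>(2) by (simp add: f \<phi>)
  ultimately show ?thesis by (rule that)
qed

lemma dual_eqI: "(\<And>N \<phi>. dual N \<phi> \<Longrightarrow> \<phi> x = \<phi> y) \<Longrightarrow> x = y"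
  using dual_separates[of "x - y"] dual_diff by (metis eq_iff_diff_eq_0)

text \<open>The type class of the algebras provides no Hausdorff axiom; scalar limits of the
  separating functionals give uniqueness instead. Both \<open>suminf\<close> and the comparison of
  limits in the algebra rely on it.\<close>

lemma tendsto_unique_q:
  assumes "F \<noteq> bot" "(f \<longlongrightarrow> (x::'a)) F" "(f \<longlongrightarrow> y) F"
  shows "x = y"
  using assms dual_eqI[of x y] dual_tendsto tendsto_unique[OF assms(1)] by metis

lemma suminf_q: "f sums (s::'a) \<Longrightarrow> suminf f = s"
  unfolding suminf_def using tendsto_unique_q[OF sequentially_bot] by (auto simp: sums_def)

lemma dual_deriv:
  assumes "dual N \<phi>" "has_real_deriv \<Psi> D t S"
  shows "((\<lambda>s. \<phi> (\<Psi> s)) has_vector_derivative \<phi> D) (at t within S)"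
proof -
  have "((\<lambda>s. \<phi> (complex_of_real (1 / (s - t)) *\<^sub>C (\<Psi> s - \<Psi> t))) \<longlongrightarrow> \<phi> D) (at t within S)"
    using assms(2) unfolding has_real_deriv_def by (rule dual_tendsto[OF assms(1)])
  then have "((\<lambda>s. (1 / (s - t)) *\<^sub>R (\<phi> (\<Psi> s) - \<phi> (\<Psi> t))) \<longlongrightarrow> \<phi> D) (at t within S)"
    by (simp add: dual_scaleC[OF assms(1)] dual_diff[OF assms(1)] scaleR_conv_of_real)
  then show ?thesis
    by (simp only: has_vector_derivative_iff_quotient)
qed

text \<open>Multiplication by a linear form lowers the degree bound of a functional, so a linear
  equation is triangular for the functionals.\<close>

lemma triangular_vanish:
  fixes D :: "real \<Rightarrow> 'a"
  assumes S: "convex S" and F: "F \<noteq> bot" "\<forall>\<^sub>F t in F. t \<in> S"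
    and step: "\<And>N \<phi> t. \<lbrakk>dual (Suc N) \<phi>; \<And>\<psi> t. dual N \<psi> \<Longrightarrow> t \<in> S \<Longrightarrow> \<psi> (D t) = 0; t \<in> S\<rbrakk>
      \<Longrightarrow> ((\<lambda>t. \<phi> (D t)) has_vector_derivative 0) (at t within S)"
    and lim: "\<And>N \<phi>. dual N \<phi> \<Longrightarrow> ((\<lambda>t. \<phi> (D t)) \<longlongrightarrow> 0) F"
    and t: "t \<in> S"
  shows "D t = 0"
proof -
  have "\<phi> (D t) = 0" if "dual N \<phi>" "t \<in> S" for N \<phi> t
    using that
  proof (induction N arbitrary: \<phi> t)
    case 0
    then show ?case by (simp add: dual_0)
  next
    case (Suc N)
    \<comment> \<open>By the induction hypothesis the right-hand side vanishes, so
      \<open>\<phi>\<close> is constant along \<open>D\<close> on the convex set \<open>S\<close>;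
      the limit along \<open>F\<close>, which may sit at an end point outside \<open>S\<close>, then
      identifies the constant.\<close>
    have "((\<lambda>t. \<phi> (D t)) has_derivative (\<lambda>h. 0)) (at s within S)" if "s \<in> S" for s
      using step[of N \<phi> s] Suc.prems(1) Suc.IH that by (simp add: has_vector_derivative_def)
    from has_derivative_zero_constant[OF S this] obtain c where c: "\<And>s. s \<in> S \<Longrightarrow> \<phi> (D s) = c"
      by blast
    have "((\<lambda>t. \<phi> (D t)) \<longlongrightarrow> c) F"
      by (rule tendsto_eventually) (use F(2) in \<open>auto elim: eventually_mono simp: c\<close>)
    then have "c = 0" using tendsto_unique[OF F(1)] lim[OF Suc.prems(1)] by blast
    then show ?case using c Suc.prems by simp
  qed
  then show ?thesis using dual_eqI[of "D t" 0] dual_zero t by metis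
qed

end

section \<open>The two enveloping algebras as quotients of the series algebra\<close>

lemma ncs_quotient_dk: "ncs_quotient (abs_dk :: 'n gen ncs \<Rightarrow> 'n dk)"
proof
  fix f g :: "'n gen ncs" and c
  show "abs_dk (f + g) = abs_dk f + abs_dk g" "abs_dk (f * g) = abs_dk f * abs_dk g"
    "abs_dk 1 = (1::'n dk)" "abs_dk (c *\<^sub>C f) = c *\<^sub>C abs_dk f"
    by (simp_all add: plus_dk.abs_eq times_dk.abs_eq one_dk_def scaleC_dk.abs_eq)
  show "surj (abs_dk :: 'n gen ncs \<Rightarrow> 'n dk)"
    by (metis Quotient_abs_rep Quotient_dk surjI)
  show "open U = open (abs_dk -` U)" for U :: "'n dk set" by (simp add: open_dk_def)
  have "{f. abs_dk f = (0::'n dk)} = closed_ideal dk_relators"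
    by (auto simp: zero_dk_def dk.abs_eq_iff)
  moreover have "closed (closed_ideal (dk_relators :: 'n gen ncs set))"
    unfolding closed_ideal_def by (rule closed_Inter) auto
  ultimately show "closed {f. abs_dk f = (0::'n dk)}" by simp
qed

lemma ncs_quotient_dkq: "ncs_quotient (abs_dkq :: 'n gen ncs \<Rightarrow> 'n dkq)"
proof
  fix f g :: "'n gen ncs" and c
  show "abs_dkq (f + g) = abs_dkq f + abs_dkq g" "abs_dkq (f * g) = abs_dkq f * abs_dkq g"
    "abs_dkq 1 = (1::'n dkq)" "abs_dkq (c *\<^sub>C f) = c *\<^sub>C abs_dkq f"
    by (simp_all add: plus_dkq.abs_eq times_dkq.abs_eq one_dkq_def scaleC_dkq.abs_eq)
  show "surj (abs_dkq :: 'n gen ncs \<Rightarrow> 'n dkq)"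
    by (metis Quotient_abs_rep Quotient_dkq surjI)
  show "open U = open (abs_dkq -` U)" for U :: "'n dkq set" by (simp add: open_dkq_def)
  have "{f. abs_dkq f = (0::'n dkq)} = closed_ideal (insert (free_t Zs Ws) dk_relators)"
    by (auto simp: zero_dkq_def dkq.abs_eq_iff)
  moreover have "closed (closed_ideal (insert (free_t Zs Ws) dk_relators :: 'n gen ncs set))"
    unfolding closed_ideal_def by (rule closed_Inter) auto
  ultimately show "closed {f. abs_dkq f = (0::'n dkq)}" by simp
qed

section \<open>Double power series\<close>

text \<open>Scalar counterpart of \<open>analytic_bidisc\<close> with the coefficients exposed.
  Summation over pairs is unconditional, hence absolute for complex terms, and this licenses all
  later rearrangements.\<close>

definition bipower :: "real \<Rightarrow> (nat \<Rightarrow> nat \<Rightarrow> complex) \<Rightarrow> (complex \<Rightarrow> complex \<Rightarrow> complex) \<Rightarrow> bool" where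
  "bipower r a g \<longleftrightarrow> (\<forall>x y. norm x < r \<and> norm y < r \<longrightarrow>
     ((\<lambda>(p, q). x ^ p * y ^ q * a p q) has_sum g x y) UNIV)"

lemma bipower_sum: "bipower r a g \<Longrightarrow> norm x < r \<Longrightarrow> norm y < r \<Longrightarrow>
    ((\<lambda>(p, q). x ^ p * y ^ q * a p q) has_sum g x y) UNIV"
  by (simp add: bipower_def)

lemma bipower_abs_summable:
  assumes "bipower r a g" "norm x < r" "norm y < r"
  shows "(\<lambda>z. norm (case z of (p, q) \<Rightarrow> x ^ p * y ^ q * a p q)) summable_on UNIV"
  using bipower_sum[OF assms] has_sum_imp_summable summable_on_iff_abs_summable_on_complex by blast

lemma bipower_unique_value:
  "bipower r a g \<Longrightarrow> bipower r a h \<Longrightarrow> norm x < r \<Longrightarrow> norm y < r \<Longrightarrow> g x y = h x y"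
  using bipower_sum has_sum_unique by blast

lemma bipower_value_0:
  assumes "bipower r a g" "0 < r"
  shows "g 0 0 = a 0 0"
proof -
  have "((\<lambda>(p, q). 0 ^ p * 0 ^ q * a p q) has_sum g 0 0) UNIV"
    using bipower_sum[OF assms(1)] assms(2) by simp
  moreover have "((\<lambda>(p, q). 0 ^ p * 0 ^ q * a p q) has_sum a 0 0) UNIV"
    by (rule has_sum_finite_neutralI[of "{(0, 0)}"]) (auto simp: power_0_left split: if_splits)
  ultimately show ?thesis by (rule has_sum_unique)
qed

lemma bipower_const: "bipower r (\<lambda>p q. if p = 0 \<and> q = 0 then c else 0) (\<lambda>x y. c)"
  unfolding bipower_def
  by (intro allI impI has_sum_finite_neutralI[of "{(0, 0)}"]) (auto split: if_splits)

lemma bipower_fst: "bipower r (\<lambda>p q. if p = 1 \<and> q = 0 then 1 else 0) (\<lambda>x y. x)"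
  unfolding bipower_def
  by (intro allI impI has_sum_finite_neutralI[of "{(1, 0)}"]) (auto split: if_splits)

lemma bipower_snd: "bipower r (\<lambda>p q. if p = 0 \<and> q = 1 then 1 else 0) (\<lambda>x y. y)"
  unfolding bipower_def
  by (intro allI impI has_sum_finite_neutralI[of "{(0, 1)}"]) (auto split: if_splits)

lemma bipower_add:
  "bipower r a g \<Longrightarrow> bipower r b h \<Longrightarrow> bipower r (\<lambda>p q. a p q + b p q) (\<lambda>x y. g x y + h x y)"
  unfolding bipower_def
proof (intro allI impI)
  fix x y :: complex assume "norm x < r \<and> norm y < r"
    and "\<forall>x y. norm x < r \<and> norm y < r \<longrightarrow> ((\<lambda>(p, q). x ^ p * y ^ q * a p q) has_sum g x y) UNIV"
      "\<forall>x y. norm x < r \<and> norm y < r \<longrightarrow> ((\<lambda>(p, q). x ^ p * y ^ q * b p q) has_sum h x y) UNIV"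
  then have "((\<lambda>z. (case z of (p, q) \<Rightarrow> x ^ p * y ^ q * a p q) + (case z of (p,
      q) \<Rightarrow> x ^ p * y ^ q * b p q))
      has_sum g x y + h x y) UNIV"
    by (intro has_sum_add) auto
  then show "((\<lambda>(p, q). x ^ p * y ^ q * (a p q + b p q)) has_sum g x y + h x y) UNIV"
    by (simp add: case_prod_unfold distrib_left)
qed

text \<open>Fubini from iterated to double sums: absolute summability yields some value of the
  double sum, and summing it iteratively shows that this value is \<open>S\<close>.\<close>

lemma has_sum_Sigma_abs:
  fixes f :: "'b \<times> 'c \<Rightarrow> complex"
  assumes "(\<lambda>z. norm (f z)) summable_on Sigma A B"
    and "\<And>x. x \<in> A \<Longrightarrow> ((\<lambda>y. f (x, y)) has_sum g x) (B x)"
    and "(g has_sum S) A"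
  shows "(f has_sum S) (Sigma A B)"
proof -
  obtain S' where S': "(f has_sum S') (Sigma A B)"
    using Infinite_Sum.abs_summable_summable[OF assms(1)] by (auto simp: summable_on_def)
  from has_sum_SigmaD[OF this assms(2)] have "(g has_sum S') A" by simp
  with assms(3) have "S' = S" by (rule has_sum_unique[rotated])
  with S' show ?thesis by simp
qed

text \<open>Cauchy product in two variables: the family of all products of terms is absolutely
  summable and is regrouped by the total exponents.\<close>

lemma bipower_mult:
  assumes "bipower r a g" "bipower r b h"
  shows "bipower r (\<lambda>p q. \<Sum>(i, j)\<in>{..p} \<times> {..q}. a i j * b (p - i) (q - j)) (\<lambda>x y. g x y * h x y)"
  unfolding bipower_def
proof (intro allI impI)
  fix x y :: complex assume xy: "norm x < r \<and> norm y < r"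
  define u where "u = (\<lambda>(p, q). x ^ p * y ^ q * a p q)"
  define v where "v = (\<lambda>(p, q). x ^ p * y ^ q * b p q)"
  have u: "(u has_sum g x y) UNIV" and v: "(v has_sum h x y) UNIV"
    using bipower_sum[OF assms(1)] bipower_sum[OF assms(2)] xy by (auto simp: u_def v_def)
  have au: "(\<lambda>z. norm (u z)) summable_on UNIV" and av: "(\<lambda>z. norm (v z)) summable_on UNIV"
    using u v has_sum_imp_summable summable_on_iff_abs_summable_on_complex by blast+
  have "((\<lambda>(m, n). u m * v n) has_sum g x y * h x y) (UNIV \<times> UNIV)"
  proof (rule has_sum_Sigma_abs)
    show "(\<lambda>z. norm (case z of (m, n) \<Rightarrow> u m * v n)) summable_on UNIV \<times> UNIV"
      using au av by (subst Infinite_Sum.abs_summable_on_Sigma_iff)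
        (auto simp: norm_mult infsum_cmult_right' abs_mult infsum_nonneg intro!:
            summable_on_cmult_right summable_on_cmult_left)
    show "((\<lambda>n. case (m, n) of (m, n) \<Rightarrow> u m * v n) has_sum u m * h x y) UNIV" for m
      using has_sum_cmult_right[OF v] by simp
    show "((\<lambda>m. u m * h x y) has_sum g x y * h x y) UNIV"
      by (rule has_sum_cmult_left[OF u])
  qed
  then have S: "((\<lambda>(m, n). u m * v n) has_sum g x y * h x y) (UNIV \<times> UNIV)" .
  \<comment> \<open>Pairs of a total exponent and the exponent of the first factor; the inner index
    sets are finite, so regrouping leaves finite inner sums.\<close>
  define T where "T = ((SIGMA pq:UNIV. {..fst pq} \<times> {..snd pq}) :: ((nat \<times> nat) \<times> (nat \<times> nat)) set)"
  have "((\<lambda>(pq, ij). u ij * v (fst pq - fst ij, snd pq - snd ij)) has_sum g x y * h x y) T"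
  proof -
    have "?thesis \<longleftrightarrow> ((\<lambda>(m, n). u m * v n) has_sum g x y * h x y) (UNIV \<times> UNIV)"
      by (rule has_sum_reindex_bij_witness[where
          j = "\<lambda>(pq, ij). (ij, (fst pq - fst ij, snd pq - snd ij))" and
          i = "\<lambda>(m, n). ((fst m + fst n, snd m + snd n), m)"]) (auto simp: T_def)
    then show ?thesis using S by simp
  qed
  from has_sum_SigmaD[OF this[unfolded T_def] has_sum_finite, simplified]
  have "((\<lambda>pq. \<Sum>ij\<in>{..fst pq} \<times> {..snd pq}. u ij * v (fst pq - fst ij, snd pq - snd ij))
      has_sum g x y * h x y) UNIV"
    by simp
  moreover have "(\<Sum>ij\<in>{..fst pq} \<times> {..snd pq}. u ij * v (fst pq - fst ij, snd pq - snd ij)) =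
      (case pq of (p, q) \<Rightarrow> x ^ p * y ^ q * (\<Sum>(i, j)\<in>{..p} \<times> {..q}. a i j * b (p - i) (q - j)))" for pq
    unfolding case_prod_unfold sum_distrib_left
  proof (rule sum.cong[OF refl])
    fix ij assume "ij \<in> {..fst pq} \<times> {..snd pq}"
    then have "x ^ fst pq = x ^ fst ij * x ^ (fst pq - fst ij)"
        "y ^ snd pq = y ^ snd ij * y ^ (snd pq - snd ij)"
      by (auto simp flip: power_add)
    then show "u ij * v (fst pq - fst ij, snd pq - snd ij) =
        x ^ fst pq * y ^ snd pq * (a (fst ij) (snd ij) * b (fst pq - fst ij) (snd pq - snd ij))"
      by (simp add: u_def v_def case_prod_unfold)
  qed
  ultimately show "((\<lambda>(p, q). x ^ p * y ^ q * (\<Sum>(i, j)\<in>{..p} \<times> {..q}. a i j * b (p - i) (q - j)))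
      has_sum g x y * h x y) UNIV"
    by simp
qed

text \<open>The inverse of the Euler operator \<open>x \<partial>\<^sub>x + y \<partial>\<^sub>y\<close> on series without constant term;
  the constant term is killed by \<open>_ / 0 = 0\<close>.\<close>

lemma bipower_euler_inverse:
  assumes "bipower r a g"
  obtains h where "bipower r (\<lambda>p q. a p q / of_nat (p + q)) h"
proof -
  have "(\<lambda>(p, q). x ^ p * y ^ q * (a p q / of_nat (p + q))) summable_on UNIV"
    if "norm x < r" "norm y < r" for x y
  proof (rule Infinite_Sum.abs_summable_summable,
      rule Infinite_Sum.abs_summable_on_comparison_test[OF bipower_abs_summable[OF assms that]])
    fix pq :: "nat \<times> nat"
    have "norm (a p q / of_nat (p + q)) \<le> norm (a p q)" for p q
    proof (cases "p + q = 0")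
      case False
      then have "norm (a p q) * 1 \<le> norm (a p q) * real (p + q)"
        by (intro mult_left_mono) auto
      moreover have "0 < real (p + q)" using False unfolding of_nat_0_less_iff by simp
      ultimately show ?thesis unfolding norm_divide norm_of_nat
          by (simp only: pos_divide_le_eq mult_1_right)
    qed simp
    then have "norm (x ^ p * y ^ q) * norm (a p q / of_nat (p + q)) \<le> norm (x ^ p * y ^ q) * norm
        (a p q)" for p q
      by (rule mult_left_mono) simp
    then show "norm (case pq of (p, q) \<Rightarrow> x ^ p * y ^ q * (a p q / of_nat (p + q)))
        \<le> norm (case pq of (p, q) \<Rightarrow> x ^ p * y ^ q * a p q)"
      by (cases pq) (simp only: case_prod_conv norm_mult[of "_ * _"])
  qed
  then show ?thesis
    by (intro that[of "\<lambda>x y. \<Sum>\<^sub>\<infinity>(p, q)\<in>UNIV. x ^ p * y ^ q * (a p q / of_nat (p + q))"])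
       (auto simp: bipower_def)
qed

text \<open>Geometric series in \<open>- (\<alpha> * x + \<beta> * y) / c\<close>, each power
  expanded binomially. The condition on \<open>r\<close> keeps the modulus of the ratio below 1 on
  the bidisc, even after replacing all terms by their norms. All coefficients of the connections
  arise from such functions.\<close>

lemma bipower_geometric:
  assumes "c \<noteq> 0" "2 * r \<le> norm c" "norm \<alpha> \<le> 1" "norm \<beta> \<le> 1"
  shows "bipower r (\<lambda>p q. of_nat ((p + q) choose p) * (- \<alpha>) ^ p * (- \<beta>) ^ q / c ^ (p + q + 1))
     (\<lambda>x y. 1 / (c + \<alpha> * x + \<beta> * y))"
  unfolding bipower_def
proof (intro allI impI)
  fix x y :: complex assume xy: "norm x < r \<and> norm y < r"
  define X Y where "X = - \<alpha> * x" and "Y = - \<beta> * y"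
  have XY_power: "X ^ n = (- \<alpha>) ^ n * x ^ n" "Y ^ n = (- \<beta>) ^ n * y ^ n" for n
    unfolding X_def Y_def by (rule power_mult_distrib)+
  \<comment> \<open>Indexed by the total degree \<open>n\<close> and the exponent \<open>p\<close>
    of x, as the binomial theorem delivers the terms; the last step passes to the exponents
    \<open>(p, n - p)\<close>.\<close>
  define f where "f = (\<lambda>(n, p). of_nat (n choose p) * X ^ p * Y ^ (n - p) / c ^ (n + 1))"
  have "norm X \<le> norm x" "norm Y \<le> norm y"
    using assms(3,4) by (auto simp: X_def Y_def norm_mult intro: mult_left_le_one_le)
  then have XY: "norm X + norm Y < norm c" using xy assms(2) by linarith
  have fin: "(\<Sum>p\<le>n. f (n, p)) = (1 / c) * ((X + Y) / c) ^ n" for n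
    by (simp add: f_def binomial_ring sum_divide_distrib[symmetric] power_divide)
  have "(f has_sum 1 / (c - (X + Y))) (SIGMA n:UNIV. {..n})"
  proof (rule has_sum_Sigma_abs)
    have "(\<Sum>p\<le>n. norm (f (n, p))) = (1 / norm c) * ((norm X + norm Y) / norm c) ^ n" for n
      by (simp add: f_def binomial_ring sum_divide_distrib[symmetric] power_divide norm_mult
          norm_divide norm_power)
    moreover have "(\<lambda>n. (1 / norm c) * ((norm X + norm Y) / norm c) ^ n) summable_on UNIV"
    proof (intro summable_on_cmult_right norm_summable_imp_summable_on)
      show "summable (\<lambda>n. norm (((norm X + norm Y) / norm c) ^ n))"
        using XY assms(1) by (simp add: norm_power summable_geometric)
    qed
    ultimately show "(\<lambda>z. norm (f z)) summable_on (SIGMA n:UNIV. {..n})"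
      by (subst Infinite_Sum.abs_summable_on_Sigma_iff) (simp add: sum_nonneg)
    show "((\<lambda>p. f (n, p)) has_sum (1 / c) * ((X + Y) / c) ^ n) {..n}" for n
      using has_sum_finite[of "{..n}" "\<lambda>p. f (n, p)"] fin by simp
    have n: "norm ((X + Y) / c) < 1"
      using XY assms(1) norm_triangle_ineq[of X Y] by (simp add: norm_divide)
    have "((\<lambda>n. ((X + Y) / c) ^ n) has_sum 1 / (1 - (X + Y) / c)) UNIV"
      using n geometric_sums[OF n] summable_geometric[of "norm ((X + Y) / c)"]
      by (intro norm_summable_imp_has_sum) (simp_all add: norm_power)
    from has_sum_cmult_right[OF this, of "1 / c"]
    show "((\<lambda>n. (1 / c) * ((X + Y) / c) ^ n) has_sum 1 / (c - (X + Y))) UNIV"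
      using assms(1) by (simp add: field_simps)
  qed
  moreover have "(f has_sum 1 / (c - (X + Y))) (SIGMA n:UNIV. {..n}) \<longleftrightarrow>
      ((\<lambda>(p, q). x ^ p * y ^ q * (of_nat ((p + q) choose p) * (- \<alpha>) ^ p * (- \<beta>) ^ q / c ^ (p + q + 1)))
        has_sum 1 / (c - (X + Y))) UNIV"
    by (rule has_sum_reindex_bij_witness[where j = "\<lambda>(n, p). (p, n - p)" and i = "\<lambda>(p, q). (p + q, p)"])
      (auto simp: f_def XY_power mult_ac power_add[symmetric])
  ultimately show "((\<lambda>(p, q). x ^ p * y ^ q * (of_nat ((p + q) choose p) * (- \<alpha>) ^ p * (- \<beta>) ^ q /
      c ^ (p + q + 1)))
        has_sum 1 / (c + \<alpha> * x + \<beta> * y)) UNIV"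
    by (simp add: X_def Y_def algebra_simps)
qed

lemma has_sum_swap: "((\<lambda>(p, q). h q p) has_sum S) UNIV \<longleftrightarrow> ((\<lambda>(p, q). h p q) has_sum S) UNIV"
  by (rule has_sum_reindex_bij_witness[where i = prod.swap and j = prod.swap]) auto

lemma bipower_swap:
  assumes "bipower r a g"
  shows "bipower r (\<lambda>p q. a q p) (\<lambda>x y. g y x)"
  unfolding bipower_def
proof (intro allI impI)
  fix x y :: complex assume "norm x < r \<and> norm y < r"
  then have "((\<lambda>(p, q). y ^ p * x ^ q * a p q) has_sum g y x) UNIV"
    using bipower_sum[OF assms] by blast
  then show "((\<lambda>(p, q). x ^ p * y ^ q * a q p) has_sum g y x) UNIV"
    by (subst (asm) has_sum_swap[symmetric]) (simp add: mult.commute)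
qed

text \<open>At the intermediate radius \<open>S\<close> the original series still converges
  absolutely, and p (R/S)^p is bounded, so the factor p produced by differentiation costs only a
  constant.\<close>

lemma bipower_deriv_abs_summable:
  assumes g: "bipower r a g" and R: "0 < R" "R < r"
  shows "(\<lambda>(p, q). real p * R ^ (p - 1) * R ^ q * norm (a p q)) summable_on UNIV"
proof -
  define S where "S = (R + r) / 2"
  have S: "R < S" "S < r" "0 < S" using R by (auto simp: S_def)
  have "norm (R / S) < 1" using S R by simp
  from powser_times_n_limit_0[OF this] have "Bseq (\<lambda>n. of_nat n * (R / S) ^ n)"
    by (intro convergent_imp_Bseq convergentI)
  then obtain K where K: "K > 0" "\<And>n. norm (of_nat n * (R / S) ^ n) \<le> K"
    by (auto simp: Bseq_def)
  have K1: "real p * R ^ (p - 1) \<le> K / R * S ^ p" for p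
  proof (cases p)
    case (Suc n)
    have "real p * (R / S) ^ p \<le> K" using K(2)[of p] by (simp add: abs_le_iff)
    then have "real p * R ^ p \<le> K * S ^ p" using S by (simp add: power_divide pos_divide_le_eq)
    then show ?thesis using R(1) Suc by (simp add: field_simps)
  qed (use K R in simp)
  have P: "R ^ p \<le> S ^ p" for p using R S by (intro power_mono) auto
  have "(\<lambda>z. norm (case z of (p, q) \<Rightarrow> complex_of_real S ^ p * of_real S ^ q * a p q)) summable_on UNIV"
    using S by (intro bipower_abs_summable[OF g]) auto
  then have "(\<lambda>(p, q). S ^ p * S ^ q * norm (a p q)) summable_on UNIV"
    using S by (simp add: case_prod_unfold norm_mult norm_power)
  from summable_on_cmult_right[OF this, of "K / R"]
  have *: "(\<lambda>(p, q). K / R * (S ^ p * S ^ q * norm (a p q))) summable_on UNIV"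
    by (simp add: case_prod_unfold)
  show "(\<lambda>(p, q). real p * R ^ (p - 1) * R ^ q * norm (a p q)) summable_on UNIV"
  proof (rule summable_on_comparison_test[OF *], goal_cases)
    case (1 pq)
    have "real p * R ^ (p - 1) * R ^ q * norm (a p q) \<le> (K / R * S ^ p) * S ^ q * norm (a p q)" for p q
      by (rule mult_mono[OF mult_mono[OF K1 P] order_refl]) (use R S K in auto)
    then show ?case by (auto simp: case_prod_unfold mult.assoc)
  qed (use R in auto)
qed

text \<open>The same derived series in two shapes: unshifted, as termwise differentiation produces
  it, and shifted to a genuine double power series. The factor p removes the terms where
  \<open>p - 1\<close> is truncated.\<close>

lemma bipower_partial_sums:
  assumes g: "bipower r a g"
  obtains gx where "bipower r (\<lambda>p q. of_nat (Suc p) * a (Suc p) q) gx"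
    "\<And>x y. norm x < r \<Longrightarrow> norm y < r \<Longrightarrow>
      ((\<lambda>(p, q). of_nat p * x ^ (p - 1) * y ^ q * a p q) has_sum gx x y) UNIV"
proof -
  define gx where "gx = (\<lambda>x y. \<Sum>\<^sub>\<infinity>(p, q)\<in>UNIV. of_nat p * x ^ (p - 1) * y ^ q * a p q)"
  have *: "((\<lambda>(p, q). of_nat p * x ^ (p - 1) * y ^ q * a p q) has_sum gx x y) UNIV"
    if "norm x < r" "norm y < r" for x y
  proof -
    have "max (norm x) (norm y) < r" using that by simp
    from dense[OF this] obtain R where "max (norm x) (norm y) < R" and Rr: "R < r" by blast
    then have R: "norm x \<le> R" "norm y \<le> R" "R < r" "0 < R"
      using le_less_trans[OF norm_ge_zero, of x R] by simp_all
    have pw: "norm x ^ n \<le> R ^ n" "norm y ^ n \<le> R ^ n" for n using R by (auto intro: power_mono)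
    have "(\<lambda>(p, q). of_nat p * x ^ (p - 1) * y ^ q * a p q) summable_on UNIV"
    proof (rule Infinite_Sum.abs_summable_summable,
        rule summable_on_comparison_test[OF bipower_deriv_abs_summable[OF g R(4,3)]], goal_cases)
      case (1 pq)
      have "real p * norm x ^ (p - 1) * norm y ^ q * norm (a p q) \<le>
          real p * R ^ (p - 1) * R ^ q * norm (a p q)" for p q
        using R pw by (intro mult_mono mult_nonneg_nonneg) auto
      then show ?case by (auto simp: case_prod_unfold norm_mult norm_power)
    qed auto
    then show ?thesis by (simp add: gx_def)
  qed
  have "bipower r (\<lambda>p q. of_nat (Suc p) * a (Suc p) q) gx"
    unfolding bipower_def
  proof (intro allI impI)
    fix x y :: complex assume xy: "norm x < r \<and> norm y < r"
    let ?f = "\<lambda>(p, q). of_nat p * x ^ (p - 1) * y ^ q * a p q"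
    have "(?f has_sum gx x y) UNIV \<longleftrightarrow> (?f has_sum gx x y) (range (\<lambda>(p, q). (Suc p, q)))"
    proof (rule has_sum_cong_neutral)
      show "?f z = 0" if z: "z \<in> UNIV - range (\<lambda>(p, q). (Suc p, q))" for z
      proof (cases z)
        case (Pair p q)
        have "p = 0" using z Pair by (cases p) (auto simp: image_iff)
        then show ?thesis using Pair by simp
      qed
    qed auto
    also have "\<dots> \<longleftrightarrow> ((?f \<circ> (\<lambda>(p, q). (Suc p, q))) has_sum gx x y) UNIV"
      by (rule has_sum_reindex) (auto simp: inj_on_def)
    finally have "((?f \<circ> (\<lambda>(p, q). (Suc p, q))) has_sum gx x y) UNIV"
      using * xy by simp
    then show "((\<lambda>(p, q). x ^ p * y ^ q * (of_nat (Suc p) * a (Suc p) q)) has_sum gx x y) UNIV"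
      by (rule has_sum_cong[THEN iffD1, rotated]) (auto simp: mult_ac)
  qed
  with * show ?thesis using that by blast
qed

text \<open>Termwise differentiation along a complex line through \<open>(x, y)\<close>. Enumerating
  the pairs by \<open>prod_decode\<close> makes the theorem for series with one index applicable,
  with the derived series at radius \<open>R\<close> as majorant.\<close>

lemma bipower_deriv:
  assumes g: "bipower r a g" and xy: "norm x < r" "norm y < r"
    and gx: "((\<lambda>(p, q). of_nat p * x ^ (p - 1) * y ^ q * a p q) has_sum gx) UNIV"
    and gy: "((\<lambda>(p, q). of_nat q * x ^ p * y ^ (q - 1) * a p q) has_sum gy) UNIV"
  shows "((\<lambda>h. g (x + h * dx) (y + h * dy)) has_field_derivative dx * gx + dy * gy) (at 0)"
proof -
  have "max (norm x) (norm y) < r" using xy by simp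
  from dense[OF this] obtain R where "max (norm x) (norm y) < R" and Rr: "R < r" by blast
  then have R': "norm x < R" "norm y < R" "R < r"
    by simp_all
  have R: "norm x < R" "norm y < R" "R < r" "0 < R"
    using R' le_less_trans[OF norm_ge_zero R'(1)] by simp_all
  \<comment> \<open>The parameters for which the line stays in the smaller bidisc, where the
    majorant is valid.\<close>
  define S where "S = {h. norm (x + h * dx) < R} \<inter> {h. norm (y + h * dy) < R}"
  have "open S"
    unfolding S_def by (intro open_Int open_Collect_less continuous_intros)
  have "0 \<in> S" using R by (simp add: S_def)
  then obtain e where e: "e > 0" "ball 0 e \<subseteq> S" using \<open>open S\<close> open_contains_ball by blast
  let ?P = "\<lambda>n. fst (prod_decode n)" and ?Q = "\<lambda>n. snd (prod_decode n)"
  let ?X = "\<lambda>h. x + h * dx" and ?Y = "\<lambda>h. y + h * dy"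
  define f where "f = (\<lambda>n h. ?X h ^ ?P n * ?Y h ^ ?Q n * a (?P n) (?Q n))"
  define f' where "f' = (\<lambda>n h. dx * (of_nat (?P n) * ?X h ^ (?P n - 1) * ?Y h ^ ?Q n * a (?P n)
      (?Q n)) +
      dy * (of_nat (?Q n) * ?X h ^ ?P n * ?Y h ^ (?Q n - 1) * a (?P n) (?Q n)))"
  define M where "M = (\<lambda>n. norm dx * (real (?P n) * R ^ (?P n - 1) * R ^ ?Q n * norm
      (a (?P n) (?Q n))) +
      norm dy * (real (?Q n) * R ^ ?P n * R ^ (?Q n - 1) * norm (a (?P n) (?Q n))))"
  have sums: "(\<lambda>n. u (?P n) (?Q n)) sums s" if "((\<lambda>(p, q). u p q) has_sum s) UNIV"
    for u :: "nat \<Rightarrow> nat \<Rightarrow> 'b::{real_normed_vector}" and s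
  proof -
    have "((\<lambda>n. (\<lambda>(p, q). u p q) (prod_decode n)) has_sum s) UNIV"
      using that by (subst has_sum_reindex_bij_betw[OF bij_prod_decode])
    then show ?thesis by (auto simp: case_prod_unfold dest: has_sum_imp_sums)
  qed
  have fs: "(\<lambda>n. f n h) sums g (?X h) (?Y h)" if "h \<in> ball 0 e" for h
  proof -
    have "norm (?X h) < r" "norm (?Y h) < r" using that e R by (auto simp: S_def)
    from sums[OF bipower_sum[OF g this]] show ?thesis by (simp add: f_def)
  qed
  have fd: "(f n has_field_derivative f' n h) (at h within ball 0 e)" for n h
    unfolding f_def f'_def by (rule derivative_eq_intros refl | simp add: algebra_simps)+
  have Ms: "summable M"
    unfolding M_def
  proof (intro summable_add summable_mult; rule sums_summable[OF sums], rule has_sum_infsum)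
    show "(\<lambda>(p, q). real p * R ^ (p - 1) * R ^ q * norm (a p q)) summable_on UNIV"
      by (rule bipower_deriv_abs_summable[OF g R(4,3)])
    have "(\<lambda>(q, p). real q * R ^ (q - 1) * R ^ p * norm (a p q)) summable_on UNIV"
      by (rule bipower_deriv_abs_summable[OF bipower_swap[OF g] R(4,3)])
    then show "(\<lambda>(p, q). real q * R ^ p * R ^ (q - 1) * norm (a p q)) summable_on UNIV"
      unfolding summable_on_def by (subst (asm) has_sum_swap) (simp add: mult_ac)
  qed
  have bound: "norm (f' n h) \<le> M n" if "h \<in> ball 0 e" for n h
  proof -
    have XY: "norm (?X h) \<le> R" "norm (?Y h) \<le> R" using that e by (auto simp: S_def)
    have pw: "norm (?X h) ^ m \<le> R ^ m" "norm (?Y h) ^ m \<le> R ^ m" for m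
      using XY by (auto intro: power_mono)
    have "norm (f' n h) \<le> norm dx * (real (?P n) * norm (?X h) ^ (?P n - 1) * norm (?Y h) ^ ?Q n *
        norm (a (?P n) (?Q n))) +
      norm dy * (real (?Q n) * norm (?X h) ^ ?P n * norm (?Y h) ^ (?Q n - 1) * norm (a (?P n) (?Q n)))"
      unfolding f'_def by (rule order_trans[OF norm_triangle_ineq])
          (simp only: norm_mult norm_power norm_of_nat order_refl)
    also have "\<dots> \<le> M n"
      unfolding M_def using pw R by (intro add_mono mult_mono mult_nonneg_nonneg) auto
    finally show ?thesis .
  qed
  have uc: "uniformly_convergent_on (ball 0 e) (\<lambda>n h. \<Sum>i<n. f' i h)"
    by (rule Weierstrass_m_test'[OF _ Ms]) (rule bound)
  have "((\<lambda>h. \<Sum>n. f n h) has_field_derivative (\<Sum>n. f' n 0)) (at 0)"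
    by (rule has_field_derivative_series'(2)[where S = "ball 0 e" and ?x0.0 = 0, OF _ fd uc])
      (use e fs[of 0] in \<open>auto simp: sums_iff\<close>)
  moreover have "(\<Sum>n. f' n 0) = dx * gx + dy * gy"
    using sums_add[OF sums_mult[OF sums[OF gx]] sums_mult[OF sums[OF gy]], of dx dy]
    by (simp add: f'_def sums_iff)
  ultimately have "((\<lambda>h. \<Sum>n. f n h) has_field_derivative dx * gx + dy * gy) (at 0)"
    by simp
  then show ?thesis
    by (rule has_field_derivative_transform_within_open[where S = "ball 0 e"])
      (use fs e in \<open>auto simp: sums_iff\<close>)
qed

section \<open>Partial derivatives and closure properties\<close>

definition partial1 :: "(complex \<Rightarrow> complex \<Rightarrow> complex) \<Rightarrow> complex \<Rightarrow> complex \<Rightarrow> complex" where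
  "partial1 g x y = deriv (\<lambda>s. g s y) x"

definition partial2 :: "(complex \<Rightarrow> complex \<Rightarrow> complex) \<Rightarrow> complex \<Rightarrow> complex \<Rightarrow> complex" where
  "partial2 g x y = deriv (\<lambda>s. g x s) y"

lemma
  assumes g: "bipower r a g"
  shows bipower_partial1: "bipower r (\<lambda>p q. of_nat (Suc p) * a (Suc p) q) (partial1 g)"
    and bipower_partial2: "bipower r (\<lambda>p q. of_nat (Suc q) * a p (Suc q)) (partial2 g)"
    and bipower_euler: "bipower r (\<lambda>p q. of_nat (p + q) * a p q)
        (\<lambda>x y. x * partial1 g x y + y * partial2 g x y)"
    and bipower_has_deriv: "\<And>x y dx dy. norm x < r \<Longrightarrow> norm y < r \<Longrightarrow>
      ((\<lambda>h. g (x + h * dx) (y + h * dy)) has_field_derivative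
        dx * partial1 g x y + dy * partial2 g x y) (at 0)"
proof -
  obtain gx where bx: "bipower r (\<lambda>p q. of_nat (Suc p) * a (Suc p) q) gx"
    and sx: "\<And>x y. norm x < r \<Longrightarrow> norm y < r \<Longrightarrow>
        ((\<lambda>(p, q). of_nat p * x ^ (p - 1) * y ^ q * a p q) has_sum gx x y) UNIV"
    by (rule bipower_partial_sums[OF g]) (rule that)
  \<comment> \<open>The second variable is handled by exchanging the roles of the two
    exponents.\<close>
  obtain gy' where by': "bipower r (\<lambda>q p. of_nat (Suc q) * a p (Suc q)) gy'"
    and sy': "\<And>y x. norm y < r \<Longrightarrow> norm x < r \<Longrightarrow>
        ((\<lambda>(q, p). of_nat q * y ^ (q - 1) * x ^ p * a p q) has_sum gy' y x) UNIV"
    by (rule bipower_partial_sums[OF bipower_swap[OF g]]) (rule that)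
  define gy where "gy = (\<lambda>x y. gy' y x)"
  note b = bx bipower_swap[OF by', folded gy_def]
  have sy: "((\<lambda>(p, q). of_nat q * x ^ p * y ^ (q - 1) * a p q) has_sum gy x y) UNIV"
    if "norm x < r" "norm y < r" for x y
    using sy'[OF that(2,1)] by (subst (asm) has_sum_swap) (simp add: gy_def mult_ac)
  note d = bipower_deriv[OF g _ _ sx sy]
  have 1: "partial1 g x y = gx x y" if "norm x < r" "norm y < r" for x y
  proof -
    have "((\<lambda>h. g (h + x) y) has_field_derivative gx x y) (at 0)"
      using d[OF that that that, of 1 0] by (simp add: add.commute)
    then show ?thesis
      using DERIV_shift[of "\<lambda>s. g s y" "gx x y" 0 x] by (simp add: partial1_def DERIV_imp_deriv)
  qed
  have 2: "partial2 g x y = gy x y" if "norm x < r" "norm y < r" for x y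
  proof -
    have "((\<lambda>h. g x (h + y)) has_field_derivative gy x y) (at 0)"
      using d[OF that that that, of 0 1] by (simp add: add.commute)
    then show ?thesis
      using DERIV_shift[of "\<lambda>s. g x s" "gy x y" 0 y] by (simp add: partial2_def DERIV_imp_deriv)
  qed
  show "bipower r (\<lambda>p q. of_nat (Suc p) * a (Suc p) q) (partial1 g)"
    "bipower r (\<lambda>p q. of_nat (Suc q) * a p (Suc q)) (partial2 g)"
    using b 1 2 by (simp_all add: bipower_def)
  show "((\<lambda>h. g (x + h * dx) (y + h * dy)) has_field_derivative
        dx * partial1 g x y + dy * partial2 g x y) (at 0)" if "norm x < r" "norm y < r" for x y dx dy
    using d[OF that that that] 1 2 that by simp
  show "bipower r (\<lambda>p q. of_nat (p + q) * a p q) (\<lambda>x y. x * partial1 g x y + y * partial2 g x y)"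
    unfolding bipower_def
  proof (intro allI impI)
    fix x y :: complex assume xy: "norm x < r \<and> norm y < r"
    have "((\<lambda>z. x * (case z of (p, q) \<Rightarrow> of_nat p * x ^ (p - 1) * y ^ q * a p q) +
        y * (case z of (p, q) \<Rightarrow> of_nat q * x ^ p * y ^ (q - 1) * a p q))
        has_sum x * partial1 g x y + y * partial2 g x y) UNIV"
      using xy 1 2 sx[of x y] sy[of x y] by (intro has_sum_add has_sum_cmult_right) auto
    moreover have "x * (case z of (p, q) \<Rightarrow> of_nat p * x ^ (p - 1) * y ^ q * a p q) +
        y * (case z of (p, q) \<Rightarrow> of_nat q * x ^ p * y ^ (q - 1) * a p q) =
        (case z of (p, q) \<Rightarrow> x ^ p * y ^ q * (of_nat (p + q) * a p q))" for z
    proof (cases z)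
      case (Pair p q)
      have "x * (of_nat p * x ^ (p - 1)) = of_nat p * x ^ p"
          "y * (of_nat q * y ^ (q - 1)) = of_nat q * y ^ q"
        by (cases p; cases q; simp)+
      moreover have "x * (of_nat p * x ^ (p - 1) * y ^ q * a p q) =
          x * (of_nat p * x ^ (p - 1)) * (y ^ q * a p q)"
          "y * (of_nat q * x ^ p * y ^ (q - 1) * a p q) =
              y * (of_nat q * y ^ (q - 1)) * (x ^ p * a p q)"
        by (simp_all only: mult_ac)
      ultimately show ?thesis by (simp only: Pair case_prod_conv) (simp add: algebra_simps)
    qed
    ultimately show "((\<lambda>(p, q). x ^ p * y ^ q * (of_nat (p + q) * a p q)) has_sum
        x * partial1 g x y + y * partial2 g x y) UNIV"
      by simp
  qed
qed

definition bianalytic :: "real \<Rightarrow> (complex \<Rightarrow> complex \<Rightarrow> complex) \<Rightarrow> bool" where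
  "bianalytic r g \<longleftrightarrow> (\<exists>a. bipower r a g)"

lemma bianalytic_simps:
  "bianalytic r (\<lambda>x y. c)" "bianalytic r (\<lambda>x y. x)" "bianalytic r (\<lambda>x y. y)"
  "bianalytic r g \<Longrightarrow> bianalytic r h \<Longrightarrow> bianalytic r (\<lambda>x y. g x y + h x y)"
  "bianalytic r g \<Longrightarrow> bianalytic r h \<Longrightarrow> bianalytic r (\<lambda>x y. g x y * h x y)"
  "bianalytic r g \<Longrightarrow> bianalytic r (partial1 g)"
  "bianalytic r g \<Longrightarrow> bianalytic r (partial2 g)"
  unfolding bianalytic_def
  using bipower_const bipower_fst bipower_snd
  by (blast dest: bipower_add bipower_mult bipower_partial1 bipower_partial2)+

lemma bianalytic_diff:
  assumes "bianalytic r g" "bianalytic r h"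
  shows "bianalytic r (\<lambda>x y. g x y - h x y)"
proof -
  have "bianalytic r (\<lambda>x y. g x y + (- 1) * h x y)"
    by (intro bianalytic_simps assms)
  then show ?thesis by simp
qed

lemma bianalytic_sum:
  "(\<And>k. k \<in> A \<Longrightarrow> bianalytic r (g k)) \<Longrightarrow> bianalytic r (\<lambda>x y. \<Sum>k\<in>A. g k x y)"
  by (induction A rule: infinite_finite_induct) (auto intro: bianalytic_simps)

lemma bianalytic_inverse_affine:
  "c \<noteq> 0 \<Longrightarrow> 2 * r \<le> norm c \<Longrightarrow> norm \<alpha> \<le> 1 \<Longrightarrow> norm \<beta> \<le> 1 \<Longrightarrow> bianalytic r (\<lambda>x y. 1 / (c + \<alpha> * x + \<beta> * y))"
  unfolding bianalytic_def using bipower_geometric by blast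

lemma bianalytic_has_deriv:
  "bianalytic r g \<Longrightarrow> norm x < r \<Longrightarrow> norm y < r \<Longrightarrow>
     ((\<lambda>h. g (x + h * dx) (y + h * dy)) has_field_derivative
        dx * partial1 g x y + dy * partial2 g x y) (at 0)"
  unfolding bianalytic_def using bipower_has_deriv by blast

lemma partial_eqI:
  assumes "norm x < r" "norm y < r"
    and "\<And>dx dy. ((\<lambda>h. g (x + h * dx) (y + h * dy)) has_field_derivative dx * gx + dy * gy) (at 0)"
  shows "partial1 g x y = gx" "partial2 g x y = gy"
proof -
  have "((\<lambda>h. g (h + x) y) has_field_derivative gx) (at 0)"
      "((\<lambda>h. g x (h + y)) has_field_derivative gy) (at 0)"
    using assms(3)[of 1 0] assms(3)[of 0 1] by (simp_all add: add.commute)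
  then show "partial1 g x y = gx" "partial2 g x y = gy"
    using DERIV_shift[of "\<lambda>s. g s y" gx 0 x] DERIV_shift[of "\<lambda>s. g x s" gy 0 y]
    by (simp_all add: partial1_def partial2_def DERIV_imp_deriv)
qed

lemma partial_mult:
  assumes "bianalytic r g" "bianalytic r h" "norm x < r" "norm y < r"
  shows "partial1 (\<lambda>x y. g x y * h x y) x y = partial1 g x y * h x y + g x y * partial1 h x y"
    "partial2 (\<lambda>x y. g x y * h x y) x y = partial2 g x y * h x y + g x y * partial2 h x y"
proof -
  have "((\<lambda>t. g (x + t * dx) (y + t * dy) * h (x + t * dx) (y + t * dy)) has_field_derivative
      dx * (partial1 g x y * h x y + g x y * partial1 h x y) +
      dy * (partial2 g x y * h x y + g x y * partial2 h x y)) (at 0)" for dx dy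
    using DERIV_mult[OF bianalytic_has_deriv[OF assms(1,3,4),
        of dx dy] bianalytic_has_deriv[OF assms(2,3,4), of dx dy]]
    by (simp add: algebra_simps)
  from partial_eqI[OF assms(3,4) this]
  show "partial1 (\<lambda>x y. g x y * h x y) x y = partial1 g x y * h x y + g x y * partial1 h x y"
    "partial2 (\<lambda>x y. g x y * h x y) x y = partial2 g x y * h x y + g x y * partial2 h x y" .
qed

lemma partial_add:
  assumes "bianalytic r g" "bianalytic r h" "norm x < r" "norm y < r"
  shows "partial1 (\<lambda>x y. g x y + h x y) x y = partial1 g x y + partial1 h x y"
    "partial2 (\<lambda>x y. g x y + h x y) x y = partial2 g x y + partial2 h x y"
proof -
  have "((\<lambda>t. g (x + t * dx) (y + t * dy) + h (x + t * dx) (y + t * dy)) has_field_derivative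
      dx * (partial1 g x y + partial1 h x y) + dy * (partial2 g x y + partial2 h x y)) (at 0)" for dx dy
    using DERIV_add[OF bianalytic_has_deriv[OF assms(1,3,4),
        of dx dy] bianalytic_has_deriv[OF assms(2,3,4), of dx dy]]
    by (simp add: algebra_simps)
  from partial_eqI[OF assms(3,4) this]
  show "partial1 (\<lambda>x y. g x y + h x y) x y = partial1 g x y + partial1 h x y"
    "partial2 (\<lambda>x y. g x y + h x y) x y = partial2 g x y + partial2 h x y" .
qed

lemma partial_const: "partial1 (\<lambda>x y. c) x y = 0" "partial2 (\<lambda>x y. c) x y = 0"
  and partial_coords: "partial1 (\<lambda>x y. x) x y = 1" "partial2 (\<lambda>x y. x) x y = 0"
    "partial1 (\<lambda>x y. y) x y = 0" "partial2 (\<lambda>x y. y) x y = 1"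
  by (simp_all add: partial1_def partial2_def)

lemma partial_diff:
  assumes "bianalytic r g" "bianalytic r h" "norm x < r" "norm y < r"
  shows "partial1 (\<lambda>x y. g x y - h x y) x y = partial1 g x y - partial1 h x y"
    "partial2 (\<lambda>x y. g x y - h x y) x y = partial2 g x y - partial2 h x y"
proof -
  have "bianalytic r (\<lambda>x y. (- 1) * h x y)" by (intro bianalytic_simps assms)
  from partial_add[OF assms(1) this assms(3,4)] partial_mult[OF bianalytic_simps(1) assms(2,3,4),
      of "- 1"]
  show "partial1 (\<lambda>x y. g x y - h x y) x y = partial1 g x y - partial1 h x y"
    "partial2 (\<lambda>x y. g x y - h x y) x y = partial2 g x y - partial2 h x y"
    by (simp_all add: partial_const)
qed

text \<open>Both orders of differentiation lead to the same double power series, so the symmetry is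
  read off from the coefficients.\<close>

lemma partial_commute:
  assumes "bianalytic r g" "norm x < r" "norm y < r"
  shows "partial1 (partial2 g) x y = partial2 (partial1 g) x y"
proof -
  obtain a where a: "bipower r a g" using assms(1) by (auto simp: bianalytic_def)
  have "bipower r (\<lambda>p q. of_nat (Suc p) * (of_nat (Suc q) * a (Suc p) (Suc q))) (partial1 (partial2 g))"
    by (rule bipower_partial1[OF bipower_partial2[OF a]])
  moreover have "bipower r (\<lambda>p q. of_nat (Suc p) * (of_nat (Suc q) * a (Suc p) (Suc q)))
      (partial2 (partial1 g))"
    using bipower_partial2[OF bipower_partial1[OF a]] by (simp add: mult.left_commute)
  ultimately show ?thesis using assms(2,3) by (rule bipower_unique_value)
qed

text \<open>The Euler operator multiplies the coefficient at (p, q) by p + q, so a missing constant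
  term is the only compatibility condition. At p = q = 0 the division convention yields 0, which
  also normalizes \<open>h\<close> at the origin.\<close>

lemma bianalytic_euler_solution:
  assumes "bianalytic r g" "g 0 0 = 0" "0 < r"
  obtains h where "bianalytic r h" "h 0 0 = 0"
    "\<And>x y. norm x < r \<Longrightarrow> norm y < r \<Longrightarrow> x * partial1 h x y + y * partial2 h x y = g x y"
proof -
  obtain a where a: "bipower r a g" using assms(1) by (auto simp: bianalytic_def)
  have a00: "a 0 0 = 0" using bipower_value_0[OF a assms(3)] assms(2) by simp
  obtain h where h: "bipower r (\<lambda>p q. a p q / of_nat (p + q)) h"
    by (rule bipower_euler_inverse[OF a])
  have "(\<lambda>p q. of_nat (p + q) * (a p q / of_nat (p + q))) = a"
    using a00 by (auto simp: fun_eq_iff simp del: of_nat_add)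
  then have "bipower r a (\<lambda>x y. x * partial1 h x y + y * partial2 h x y)"
    using bipower_euler[OF h] by simp
  from bipower_unique_value[OF this a] show ?thesis
    using that[of h] h bipower_value_0[OF h assms(3)] by (auto simp: bianalytic_def)
qed

section \<open>Flat systems in two variables\<close>

lemma has_real_deriv_ncs_iff:
  "has_real_deriv \<Psi> D t S \<longleftrightarrow>
     (\<forall>w. ((\<lambda>s. ncs_coeff (\<Psi> s) w) has_vector_derivative ncs_coeff D w) (at t within S))"
  by (simp add: has_real_deriv_def tendsto_ncs_iff has_vector_derivative_iff_quotient
      scaleR_conv_of_real)

lemma has_real_deriv_ncs_tendsto:
  "has_real_deriv \<Psi> (D :: 'g ncs) t S \<Longrightarrow> (\<Psi> \<longlongrightarrow> \<Psi> t) (at t within S)"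
  unfolding has_real_deriv_ncs_iff tendsto_ncs_iff
  by (meson has_vector_derivative_continuous continuous_within)

lemma has_complex_deriv_ncs_iff:
  "has_complex_deriv \<Psi> D p \<longleftrightarrow>
     (\<forall>w. ((\<lambda>s. ncs_coeff (\<Psi> s) w) has_field_derivative ncs_coeff D w) (at p))"
  by (simp add: has_complex_deriv_def tendsto_ncs_iff has_field_derivative_iff)

context ncs_quotient
begin

lemma has_real_deriv_q: "has_real_deriv \<Psi> D t S \<Longrightarrow> has_real_deriv (\<lambda>s. q (\<Psi> s)) (q D) t S"
  unfolding has_real_deriv_def by (drule tendsto_q) (simp add: q_simps)

lemma has_complex_deriv_q: "has_complex_deriv \<Psi> D t \<Longrightarrow> has_complex_deriv (\<lambda>s. q (\<Psi> s)) (q D) t"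
  unfolding has_complex_deriv_def by (drule tendsto_q) (simp add: q_simps)

end

text \<open>One radius serves all words, while bounds may depend on the word, in accordance with
  coefficientwise convergence.\<close>

definition ncs_bianalytic :: "real \<Rightarrow> (complex \<Rightarrow> complex \<Rightarrow> 'g ncs) \<Rightarrow> bool" where
  "ncs_bianalytic r u \<longleftrightarrow> (\<forall>w. bianalytic r (\<lambda>x y. ncs_coeff (u x y) w))"

definition ncs_partial1 :: "(complex \<Rightarrow> complex \<Rightarrow> 'g ncs) \<Rightarrow> complex \<Rightarrow> complex \<Rightarrow> 'g ncs" where
  "ncs_partial1 u x y = Abs_ncs (\<lambda>w. partial1 (\<lambda>x y. ncs_coeff (u x y) w) x y)"

definition ncs_partial2 :: "(complex \<Rightarrow> complex \<Rightarrow> 'g ncs) \<Rightarrow> complex \<Rightarrow> complex \<Rightarrow> 'g ncs" where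
  "ncs_partial2 u x y = Abs_ncs (\<lambda>w. partial2 (\<lambda>x y. ncs_coeff (u x y) w) x y)"

lemma coeff_partial [simp]:
  "ncs_coeff (ncs_partial1 u x y) w = partial1 (\<lambda>x y. ncs_coeff (u x y) w) x y"
  "ncs_coeff (ncs_partial2 u x y) w = partial2 (\<lambda>x y. ncs_coeff (u x y) w) x y"
  by (simp_all add: ncs_partial1_def ncs_partial2_def)

lemma ncs_bianalytic_simps:
  "ncs_bianalytic r (\<lambda>x y. c)"
  "ncs_bianalytic r u \<Longrightarrow> ncs_bianalytic r v \<Longrightarrow> ncs_bianalytic r (\<lambda>x y. u x y + v x y)"
  "ncs_bianalytic r u \<Longrightarrow> ncs_bianalytic r v \<Longrightarrow> ncs_bianalytic r (\<lambda>x y. u x y - v x y)"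
  "ncs_bianalytic r u \<Longrightarrow> ncs_bianalytic r v \<Longrightarrow> ncs_bianalytic r (\<lambda>x y. u x y * v x y)"
  "bianalytic r g \<Longrightarrow> ncs_bianalytic r u \<Longrightarrow> ncs_bianalytic r (\<lambda>x y. g x y *\<^sub>C u x y)"
  "ncs_bianalytic r u \<Longrightarrow> ncs_bianalytic r (ncs_partial1 u)"
  "ncs_bianalytic r u \<Longrightarrow> ncs_bianalytic r (ncs_partial2 u)"
  unfolding ncs_bianalytic_def coeff_mult coeff_simps coeff_partial
  by (auto intro!: bianalytic_sum intro: bianalytic_simps bianalytic_diff)

lemma ncs_bianalytic_sum:
  "(\<And>k. k \<in> A \<Longrightarrow> ncs_bianalytic r (u k)) \<Longrightarrow> ncs_bianalytic r (\<lambda>x y. \<Sum>k\<in>A. u k x y)"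
  by (simp add: ncs_bianalytic_def bianalytic_sum)

lemma ncs_partial_add:
  assumes "ncs_bianalytic r u" "ncs_bianalytic r v" "norm x < r" "norm y < r"
  shows "ncs_partial1 (\<lambda>x y. u x y + v x y) x y = ncs_partial1 u x y + ncs_partial1 v x y"
    "ncs_partial2 (\<lambda>x y. u x y + v x y) x y = ncs_partial2 u x y + ncs_partial2 v x y"
  using assms by (auto intro!: ncs_eqI partial_add simp: ncs_bianalytic_def)

lemma ncs_partial_diff:
  assumes "ncs_bianalytic r u" "ncs_bianalytic r v" "norm x < r" "norm y < r"
  shows "ncs_partial1 (\<lambda>x y. u x y - v x y) x y = ncs_partial1 u x y - ncs_partial1 v x y"
    "ncs_partial2 (\<lambda>x y. u x y - v x y) x y = ncs_partial2 u x y - ncs_partial2 v x y"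
  using assms by (auto intro!: ncs_eqI partial_diff simp: ncs_bianalytic_def)

lemma ncs_partial_const: "ncs_partial1 (\<lambda>x y. c) x y = 0" "ncs_partial2 (\<lambda>x y. c) x y = 0"
  by (auto intro!: ncs_eqI simp: partial_const)

lemma ncs_partial_scaleC:
  assumes "bianalytic r g" "ncs_bianalytic r u" "norm x < r" "norm y < r"
  shows "ncs_partial1 (\<lambda>x y. g x y *\<^sub>C u x y) x y =
      partial1 g x y *\<^sub>C u x y + g x y *\<^sub>C ncs_partial1 u x y"
    "ncs_partial2 (\<lambda>x y. g x y *\<^sub>C u x y) x y = partial2 g x y *\<^sub>C u x y + g x y *\<^sub>C ncs_partial2 u x y"
  using assms by (auto intro!: ncs_eqI simp: ncs_bianalytic_def partial_mult)

lemma partial_sum: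
  assumes "\<And>k. k \<in> A \<Longrightarrow> bianalytic r (g k)" "norm x < r" "norm y < r"
  shows "partial1 (\<lambda>x y. \<Sum>k\<in>A. g k x y) x y = (\<Sum>k\<in>A. partial1 (g k) x y)"
    "partial2 (\<lambda>x y. \<Sum>k\<in>A. g k x y) x y = (\<Sum>k\<in>A. partial2 (g k) x y)"
proof -
  have "((\<lambda>t. \<Sum>k\<in>A. g k (x + t * dx) (y + t * dy)) has_field_derivative
      dx * (\<Sum>k\<in>A. partial1 (g k) x y) + dy * (\<Sum>k\<in>A. partial2 (g k) x y)) (at 0)" for dx dy
  proof -
    have "((\<lambda>t. \<Sum>k\<in>A. g k (x + t * dx) (y + t * dy)) has_field_derivative
        (\<Sum>k\<in>A. dx * partial1 (g k) x y + dy * partial2 (g k) x y)) (at 0)"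
      by (intro DERIV_sum bianalytic_has_deriv[OF assms(1) assms(2,3)])
    then show ?thesis by (simp add: sum.distrib sum_distrib_left)
  qed
  from partial_eqI[OF assms(2,3) this]
  show "partial1 (\<lambda>x y. \<Sum>k\<in>A. g k x y) x y = (\<Sum>k\<in>A. partial1 (g k) x y)"
    "partial2 (\<lambda>x y. \<Sum>k\<in>A. g k x y) x y = (\<Sum>k\<in>A. partial2 (g k) x y)" .
qed

lemma ncs_partial_mult:
  assumes "ncs_bianalytic r u" "ncs_bianalytic r v" "norm x < r" "norm y < r"
  shows "ncs_partial1 (\<lambda>x y. u x y * v x y) x y =
      ncs_partial1 u x y * v x y + u x y * ncs_partial1 v x y"
    "ncs_partial2 (\<lambda>x y. u x y * v x y) x y = ncs_partial2 u x y * v x y + u x y * ncs_partial2 v x y"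
proof -
  have b: "bianalytic r (\<lambda>x y. ncs_coeff (u x y) w)" "bianalytic r (\<lambda>x y. ncs_coeff (v x y) w)" for w
    using assms by (auto simp: ncs_bianalytic_def)
  show "ncs_partial1 (\<lambda>x y. u x y * v x y) x y =
      ncs_partial1 u x y * v x y + u x y * ncs_partial1 v x y"
    "ncs_partial2 (\<lambda>x y. u x y * v x y) x y = ncs_partial2 u x y * v x y + u x y * ncs_partial2 v x y"
    by (intro ncs_eqI; simp add: coeff_mult partial_sum[OF bianalytic_simps(5)[OF b] assms(3,4)]
        partial_mult[OF b assms(3,4)] sum.distrib)+
qed

lemma ncs_partial_commute:
  assumes "ncs_bianalytic r u" "norm x < r" "norm y < r"
  shows "ncs_partial1 (ncs_partial2 u) x y = ncs_partial2 (ncs_partial1 u) x y"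
  using assms partial_commute[OF _ assms(2,3)] by (auto intro!: ncs_eqI simp: ncs_bianalytic_def)

lemma ncs_bianalytic_has_deriv:
  assumes "ncs_bianalytic r u" "norm x < r" "norm y < r"
  shows "has_complex_deriv (\<lambda>h. u (x + h * dx) (y + h * dy))
      (dx *\<^sub>C ncs_partial1 u x y + dy *\<^sub>C ncs_partial2 u x y) 0"
  using assms bianalytic_has_deriv[OF _ assms(2,3)]
  by (auto simp: has_complex_deriv_ncs_iff ncs_bianalytic_def)

lemma ncs_bianalytic_has_real_deriv:
  assumes u: "ncs_bianalytic r u" and xy: "norm (of_real s * x) < r" "norm (of_real s * y) < r"
  shows "has_real_deriv (\<lambda>s. u (of_real s * x) (of_real s * y))
      (x *\<^sub>C ncs_partial1 u (of_real s * x) (of_real s * y) + y *\<^sub>C ncs_partial2 u (of_real s * x)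
          (of_real s * y)) s S"
  unfolding has_real_deriv_ncs_iff
proof
  fix w
  let ?D = "ncs_coeff (x *\<^sub>C ncs_partial1 u (of_real s * x) (of_real s * y) + y *\<^sub>C ncs_partial2 u
      (of_real s * x) (of_real s * y)) w"
  have "((\<lambda>h. ncs_coeff (u (of_real s * x + h * x) (of_real s * y + h * y)) w)
      has_field_derivative ?D) (at 0)"
    using ncs_bianalytic_has_deriv[OF u xy, of x y] by (simp add: has_complex_deriv_ncs_iff)
  then have "((\<lambda>h. ncs_coeff (u ((h + of_real s) * x) ((h + of_real s) * y)) w)
      has_field_derivative ?D) (at 0)"
    by (simp add: algebra_simps)
  then have "((\<lambda>h. ncs_coeff (u (h * x) (h * y)) w) has_field_derivative ?D) (at (of_real s))"
    using DERIV_shift[of "\<lambda>h. ncs_coeff (u (h * x) (h * y)) w" ?D 0 "of_real s"] by simp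
  then show "((\<lambda>s. ncs_coeff (u (of_real s * x) (of_real s * y)) w) has_vector_derivative
      ?D) (at s within S)"
    by (rule has_vector_derivative_real_field)
qed

lemma ncs_partial_cong:
  assumes "\<And>x y. norm x < r \<Longrightarrow> norm y < r \<Longrightarrow> u x y = v x y" "norm x < r" "norm y < r"
  shows "ncs_partial1 u x y = ncs_partial1 v x y" "ncs_partial2 u x y = ncs_partial2 v x y"
proof -
  have "\<forall>\<^sub>F s in nhds z. norm s < r" if "norm z < r" for z :: complex
    using eventually_nhds_in_open[of "ball 0 r" z] that by simp
  note ev = this[OF assms(2)] this[OF assms(3)]
  have "deriv (\<lambda>s. ncs_coeff (u s y) w) x = deriv (\<lambda>s. ncs_coeff (v s y) w) x"
    "deriv (\<lambda>s. ncs_coeff (u x s) w) y = deriv (\<lambda>s. ncs_coeff (v x s) w) y" for w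
    using assms by (auto intro!: deriv_cong_ev eventually_mono[OF ev(1)] eventually_mono[OF ev(2)])
  then show "ncs_partial1 u x y = ncs_partial1 v x y" "ncs_partial2 u x y = ncs_partial2 v x y"
    by (auto intro!: ncs_eqI simp: partial1_def partial2_def)
qed

text \<open>The equation is triangular with respect to word length; the right-hand side for the
  coefficient of a word vanishes at the origin because \<open>f\<close> commutes with \<open>e\<close> to first order.\<close>

lemma euler_equation_solution:
  fixes \<Omega> :: "complex \<Rightarrow> complex \<Rightarrow> 'g ncs"
  assumes r: "0 < r" and \<Omega>: "ncs_bianalytic r \<Omega>" "\<And>x y. linear_form (\<Omega> x y)"
  obtains f where "ncs_bianalytic r f" "f 0 0 = 1" "\<And>x y. ncs_coeff (f x y) [] = 1"
    "\<And>x y. norm x < r \<Longrightarrow> norm y < r \<Longrightarrow>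
       x *\<^sub>C ncs_partial1 f x y + y *\<^sub>C ncs_partial2 f x y = \<Omega> x y * f x y - f x y * \<Omega> 0 0"
proof -
  \<comment> \<open>The coefficient at \<open>w\<close> of \<Omega> f - f \<Omega>(0,0), expressed
    through the coefficients of f at the two words obtained by deleting an end letter.\<close>
  define rhs where "rhs = (\<lambda>(G :: 'g list \<Rightarrow> complex \<Rightarrow> complex \<Rightarrow> complex) w x y.
    ncs_coeff (\<Omega> x y) [hd w] * G (tl w) x y - G (butlast w) x y * ncs_coeff (\<Omega> 0 0) [last w])"
  define good where "good = (\<lambda>G w h. bianalytic r h \<and> h 0 0 = 0 \<and>
    (\<forall>x y. norm x < r \<longrightarrow> norm y < r \<longrightarrow> x * partial1 h x y + y * partial2 h x y = rhs G w x y))"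
  \<comment> \<open>The recursion runs over lengths because \<open>rhs\<close> needs both
    \<open>tl w\<close> and \<open>butlast w\<close>; \<open>A n\<close> is meaningful only on words
    of length \<open>n\<close>, and \<open>F\<close> picks out these values.\<close>
  define A where "A = rec_nat (\<lambda>w x y. 1) (\<lambda>_ G w. SOME h. good G w h)"
  define F where "F = (\<lambda>w. A (length w) w)"
  have A0: "A 0 = (\<lambda>w x y. 1)" and ASuc: "A (Suc n) w = (SOME h. good (A n) w h)" for n w
    by (simp_all add: A_def)
  have F: "(w = [] \<or> good F w (F w)) \<and> bianalytic r (F w) \<and> F w 0 0 = (if w = [] then 1 else 0)" for w
  proof (induction "length w" arbitrary: w rule: less_induct)
    case less
    show ?case
    proof (cases w)
      case Nil
      then show ?thesis by (simp add: F_def A0 bianalytic_simps)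
    next
      case (Cons a v)
      have rhs: "rhs (A (length v)) w = rhs F w"
        using Cons by (simp add: rhs_def F_def fun_eq_iff)
      have IH: "bianalytic r (F (tl w))" "bianalytic r (F (butlast w))"
          "F (tl w) 0 0 = (if tl w = [] then 1 else 0)"
              "F (butlast w) 0 0 = (if butlast w = [] then 1 else 0)"
        using less[of "tl w"] less[of "butlast w"] Cons by auto
      have "bianalytic r (rhs F w)"
        unfolding rhs_def using \<Omega>(1) IH
        by (intro bianalytic_diff bianalytic_simps) (auto simp: ncs_bianalytic_def)
      \<comment> \<open>For a single letter the two terms cancel; for longer words the shortened
        words are nonempty and their coefficients vanish at the origin.\<close>
      moreover have "rhs F w 0 0 = 0"
        using IH Cons by (cases v) (auto simp: rhs_def)
      ultimately obtain h where "good F w h"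
        using bianalytic_euler_solution[OF _ _ r] unfolding good_def by metis
      then have "good (A (length v)) w h" by (simp add: good_def rhs)
      then have "good (A (length v)) w (A (Suc (length v)) w)"
        unfolding ASuc by (rule someI[where P = "good (A (length v)) w"])
      moreover have "A (Suc (length v)) w = F w" by (simp add: F_def Cons)
      ultimately have "good F w (F w)" by (simp add: good_def rhs)
      then show ?thesis using Cons by (simp add: good_def)
    qed
  qed
  show ?thesis
  proof (rule that[of "\<lambda>x y. Abs_ncs (\<lambda>w. F w x y)"])
    show "ncs_bianalytic r (\<lambda>x y. Abs_ncs (\<lambda>w. F w x y))"
      using F by (simp add: ncs_bianalytic_def)
    show "Abs_ncs (\<lambda>w. F w 0 0) = 1"
      using F by (intro ncs_eqI) simp
    show "ncs_coeff (Abs_ncs (\<lambda>w. F w x y)) [] = 1" for x y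
      by (simp add: F_def A0)
    fix x y :: complex assume xy: "norm x < r" "norm y < r"
    show "x *\<^sub>C ncs_partial1 (\<lambda>x y. Abs_ncs (\<lambda>w. F w x y)) x y + y *\<^sub>C ncs_partial2
        (\<lambda>x y. Abs_ncs (\<lambda>w. F w x y)) x y
        = \<Omega> x y * Abs_ncs (\<lambda>w. F w x y) - Abs_ncs (\<lambda>w. F w x y) * \<Omega> 0 0"
    proof (rule ncs_eqI)
      fix w
      have "F [] = (\<lambda>x y. 1)" by (simp add: F_def A0)
      then show "ncs_coeff (x *\<^sub>C ncs_partial1 (\<lambda>x y. Abs_ncs (\<lambda>w. F w x y)) x y + y *\<^sub>C
          ncs_partial2 (\<lambda>x y. Abs_ncs (\<lambda>w. F w x y)) x y) w
        = ncs_coeff (\<Omega> x y * Abs_ncs (\<lambda>w. F w x y) - Abs_ncs (\<lambda>w. F w x y) * \<Omega> 0 0) w"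
        using F[of w] xy by (auto simp: coeff_linear_mult coeff_mult_linear \<Omega>(2) partial_const
            good_def rhs_def)
    qed
  qed
qed

text \<open>The defect \<open>G = x \<partial>\<^sub>x f - \<Omega>\<^sub>1 f + f e\<^sub>1\<close> again satisfies the Euler equation, by flatness,
    and vanishes
  at the origin; on rays through the origin this is a triangular system with zero initial value.\<close>

lemma (in ncs_quotient) flat_euler_solution:
  fixes f \<Omega>1 \<Omega>2 :: "complex \<Rightarrow> complex \<Rightarrow> 'g ncs"
  assumes r: "0 < r"
    and an: "ncs_bianalytic r f" "ncs_bianalytic r \<Omega>1" "ncs_bianalytic r \<Omega>2"
    and lin: "\<And>x y. linear_form (\<Omega>1 x y)" "\<And>x y. linear_form (\<Omega>2 x y)"
    and f0: "f 0 0 = 1"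
    and euler: "\<And>x y. norm x < r \<Longrightarrow> norm y < r \<Longrightarrow>
       x *\<^sub>C ncs_partial1 f x y + y *\<^sub>C ncs_partial2 f x y =
         (\<Omega>1 x y + \<Omega>2 x y) * f x y - f x y * (\<Omega>1 0 0 + \<Omega>2 0 0)"
    and closed: "\<And>x y. norm x < r \<Longrightarrow> norm y < r \<Longrightarrow>
       x *\<^sub>C ncs_partial1 \<Omega>2 x y = y *\<^sub>C ncs_partial2 \<Omega>1 x y"
    and commute: "\<And>x y. norm x < r \<Longrightarrow> norm y < r \<Longrightarrow> q (\<Omega>1 x y * \<Omega>2 x y) = q (\<Omega>2 x y * \<Omega>1 x y)"
    and xy: "norm x < r" "norm y < r"
  shows "q (x *\<^sub>C ncs_partial1 f x y) = q (\<Omega>1 x y * f x y - f x y * \<Omega>1 0 0)"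
    "q (y *\<^sub>C ncs_partial2 f x y) = q (\<Omega>2 x y * f x y - f x y * \<Omega>2 0 0)"
proof -
  define e1 e2 where "e1 = \<Omega>1 0 0" and "e2 = \<Omega>2 0 0"
  define G where "G = (\<lambda>x y. x *\<^sub>C ncs_partial1 f x y - \<Omega>1 x y * f x y + f x y * e1)"
  note cl = ncs_bianalytic_simps bianalytic_simps an
  have anG: "ncs_bianalytic r G"
    unfolding G_def by (intro cl)
  have \<theta>: "q (x *\<^sub>C ncs_partial1 G x y + y *\<^sub>C ncs_partial2 G x y) =
      q (\<Omega>1 x y + \<Omega>2 x y) * q (G x y) - q (G x y) * q (e1 + e2)" if xy: "norm x < r"
          "norm y < r" for x y
  proof -
    let ?f1 = "ncs_partial1 f x y" and ?f2 = "ncs_partial2 f x y"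
    let ?f11 = "ncs_partial1 (ncs_partial1 f) x y" and ?f12 = "ncs_partial2 (ncs_partial1 f) x y"
    have 1: "ncs_partial1 G x y = ?f1 + x *\<^sub>C ?f11 - (ncs_partial1 \<Omega>1 x y * f x y + \<Omega>1 x y * ?f1) +
        ?f1 * e1"
      unfolding G_def
      by (subst ncs_partial_add[OF _ _ xy] ncs_partial_diff[OF _ _ xy] ncs_partial_mult[OF _ _ xy]
          ncs_partial_scaleC[OF _ _ xy] | (intro cl; fail) |
          simp only: partial_coords ncs_partial_const scaleC_one scaleC_zero_left mult_zero_right
              add_0_left add_0_right)+
    have 2: "ncs_partial2 G x y = x *\<^sub>C ?f12 - (ncs_partial2 \<Omega>1 x y * f x y + \<Omega>1 x y * ?f2) + ?f2 * e1"
      unfolding G_def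
      by (subst ncs_partial_add[OF _ _ xy] ncs_partial_diff[OF _ _ xy] ncs_partial_mult[OF _ _ xy]
          ncs_partial_scaleC[OF _ _ xy] | (intro cl; fail) |
          simp only: partial_coords ncs_partial_const scaleC_one scaleC_zero_left mult_zero_right
              add_0_left add_0_right)+
    \<comment> \<open>The second derivatives of f in the Euler derivative of \<open>G\<close> are
      eliminated with the x-derivative of the Euler equation itself.\<close>
    have "ncs_partial1 (\<lambda>x y. x *\<^sub>C ncs_partial1 f x y + y *\<^sub>C ncs_partial2 f x y) x y =
        ncs_partial1 (\<lambda>x y. (\<Omega>1 x y + \<Omega>2 x y) * f x y - f x y * (e1 + e2)) x y"
      by (rule ncs_partial_cong[OF _ xy]) (simp add: euler e1_def e2_def)
    moreover have "ncs_partial1 (\<lambda>x y. x *\<^sub>C ncs_partial1 f x y + y *\<^sub>C ncs_partial2 f x y) x y =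
        ?f1 + x *\<^sub>C ?f11 + y *\<^sub>C ?f12"
      unfolding ncs_partial_commute[OF an(1) xy, symmetric]
      by (subst ncs_partial_add[OF _ _ xy] ncs_partial_diff[OF _ _ xy] ncs_partial_mult[OF _ _ xy]
          ncs_partial_scaleC[OF _ _ xy] | (intro cl; fail) |
          simp only: partial_coords ncs_partial_const scaleC_one scaleC_zero_left mult_zero_right
              add_0_left add_0_right)+
    moreover have "ncs_partial1 (\<lambda>x y. (\<Omega>1 x y + \<Omega>2 x y) * f x y - f x y * (e1 + e2)) x y =
        (ncs_partial1 \<Omega>1 x y + ncs_partial1 \<Omega>2 x y) * f x y + (\<Omega>1 x y + \<Omega>2 x y) * ?f1 - ?f1 * (e1 + e2)"
      by (subst ncs_partial_add[OF _ _ xy] ncs_partial_diff[OF _ _ xy] ncs_partial_mult[OF _ _ xy]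
          ncs_partial_scaleC[OF _ _ xy] | (intro cl; fail) |
          simp only: partial_coords ncs_partial_const scaleC_one scaleC_zero_left mult_zero_right
              add_0_left add_0_right)+
    ultimately have 3: "?f1 + x *\<^sub>C ?f11 + y *\<^sub>C ?f12 =
        (ncs_partial1 \<Omega>1 x y + ncs_partial1 \<Omega>2 x y) * f x y + (\<Omega>1 x y + \<Omega>2 x y) * ?f1 - ?f1 * (e1 + e2)"
      by simp
    define X where "X = x *\<^sub>C ?f1"
    define \<Omega> e where "\<Omega> = \<Omega>1 x y + \<Omega>2 x y" and "e = e1 + e2"
    define D11 where "D11 = x *\<^sub>C ncs_partial1 \<Omega>1 x y"
    define D12 where "D12 = y *\<^sub>C ncs_partial2 \<Omega>1 x y"
    have E: "X + y *\<^sub>C ?f2 = \<Omega> * f x y - f x y * e"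
      using euler[OF xy] by (simp add: X_def \<Omega>_def e_def e1_def e2_def)
    have S: "x *\<^sub>C (?f1 + x *\<^sub>C ?f11 + y *\<^sub>C ?f12) = D11 * f x y + D12 * f x y + \<Omega> * X - X * e"
      unfolding 3 D11_def D12_def closed[OF xy, symmetric] X_def \<Omega>_def e_def
      by (simp add: scaleC_add_right scaleC_diff_right mult_scaleC_left mult_scaleC_right distrib_right)
    have swap: "y *\<^sub>C (x *\<^sub>C ?f12) = x *\<^sub>C (y *\<^sub>C ?f12)"
      by (simp add: scaleC_scaleC mult.commute)
    have T: "x *\<^sub>C ncs_partial1 G x y + y *\<^sub>C ncs_partial2 G x y =
        x *\<^sub>C (?f1 + x *\<^sub>C ?f11 + y *\<^sub>C ?f12) - D11 * f x y - D12 * f x y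
          - \<Omega>1 x y * (X + y *\<^sub>C ?f2) + (X + y *\<^sub>C ?f2) * e1"
      unfolding 1 2 X_def D11_def D12_def
      by (simp add: scaleC_add_right scaleC_diff_right mult_scaleC_left mult_scaleC_right
          swap distrib_left distrib_right)
    have "x *\<^sub>C ncs_partial1 G x y + y *\<^sub>C ncs_partial2 G x y =
        \<Omega> * X - X * e - \<Omega>1 x y * (\<Omega> * f x y - f x y * e) + (\<Omega> * f x y - f x y * e) * e1"
      unfolding T S E by simp
    moreover have "X = G x y + \<Omega>1 x y * f x y - f x y * e1"
      by (simp add: G_def X_def)
    \<comment> \<open>Apart from the Euler equation for \<open>G\<close>, only commutators of the
      two components remain, at \<open>(x, y)\<close> and at the origin; \<open>q\<close> kills
      both.\<close>
    ultimately have "x *\<^sub>C ncs_partial1 G x y + y *\<^sub>C ncs_partial2 G x y =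
        \<Omega> * G x y - G x y * e + (\<Omega>2 x y * \<Omega>1 x y - \<Omega>1 x y * \<Omega>2 x y) * f x y + f x y *
            (e1 * e2 - e2 * e1)"
      by (simp add: \<Omega>_def e_def algebra_simps)
    then show ?thesis
      using commute[OF xy] commute[of 0 0] r by (simp add: q_simps \<Omega>_def e_def e1_def e2_def)
  qed
  have "q (G x y) = 0"
  proof -
    have in_disc: "norm (of_real s * x) < r" "norm (of_real s * y) < r" if "0 \<le> s" "s \<le> 1" for s
      using that xy mult_left_le_one_le[of "norm x" s] mult_left_le_one_le[of "norm y" s]
      by (auto simp: norm_mult)
    note dG = ncs_bianalytic_has_real_deriv[OF anG in_disc]
    \<comment> \<open>On the ray the Euler operator is t d/dt, which is singular at 0. The origin is
      therefore excluded from the interval and enters only as a limit.\<close>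
    have "q (G (of_real 1 * x) (of_real 1 * y)) = 0"
    proof (rule triangular_vanish[where S = "{0<..1}" and F = "at_right 0"])
      show "\<forall>\<^sub>F t in at_right 0. t \<in> {0<..1::real}"
        using eventually_at_right[of 0 "1::real"] by (auto intro!: exI[of _ 1])
      fix N \<phi> and t :: real
      assume \<phi>: "dual (Suc N) \<phi>" and t: "t \<in> {0<..1}"
        and IH: "\<And>\<psi> t :: real. dual N \<psi> \<Longrightarrow> t \<in> {0<..1} \<Longrightarrow> \<psi> (q (G (of_real t * x) (of_real t * y))) = 0"
      let ?tx = "of_real t * x" and ?ty = "of_real t * y"
      let ?\<Omega> = "\<Omega>1 ?tx ?ty + \<Omega>2 ?tx ?ty"
      have "linear_form ?\<Omega>" "linear_form (e1 + e2)"
        unfolding e1_def e2_def by (intro linear_form_simps lin)+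
      then have "\<phi> (q ?\<Omega> * q (G ?tx ?ty)) = 0" "\<phi> (q (G ?tx ?ty) * q (e1 + e2)) = 0"
        using IH[OF dual_comp_linear(1)[OF \<phi>] t] IH[OF dual_comp_linear(2)[OF \<phi>] t] by blast+
      \<comment> \<open>Multiplication by t turns the derivative along the ray into the Euler
        operator at the point reached; as t is positive it can be cancelled again.\<close>
      moreover have "complex_of_real t * \<phi>
          (q (x *\<^sub>C ncs_partial1 G ?tx ?ty + y *\<^sub>C ncs_partial2 G ?tx ?ty)) =
          \<phi> (q (?tx *\<^sub>C ncs_partial1 G ?tx ?ty + ?ty *\<^sub>C ncs_partial2 G ?tx ?ty))"
        by (simp add: dual_scaleC[OF \<phi>, symmetric] q_scaleC[symmetric] scaleC_add_right scaleC_scaleC)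
      ultimately have "complex_of_real t * \<phi>
          (q (x *\<^sub>C ncs_partial1 G ?tx ?ty + y *\<^sub>C ncs_partial2 G ?tx ?ty)) = 0"
        using \<theta>[OF in_disc[of t]] t by (simp add: dual_diff[OF \<phi>])
      then have "\<phi> (q (x *\<^sub>C ncs_partial1 G ?tx ?ty + y *\<^sub>C ncs_partial2 G ?tx ?ty)) = 0"
        using t by simp
      then show "((\<lambda>t. \<phi> (q (G (of_real t * x) (of_real t * y)))) has_vector_derivative
          0) (at t within {0<..1})"
        using dual_deriv[OF \<phi> has_real_deriv_q[OF dG[of t]]] t by simp
    next
      fix N \<phi> assume \<phi>: "dual N \<phi>"
      have "((\<lambda>s. G (of_real s * x) (of_real s * y)) \<longlongrightarrow>
          G (of_real 0 * x) (of_real 0 * y)) (at 0 within {0<..})"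
        using dG[of 0] by (intro has_real_deriv_ncs_tendsto) auto
      moreover have "G 0 0 = 0" by (simp add: G_def f0 e1_def)
      ultimately have "((\<lambda>s. G (of_real s * x) (of_real s * y)) \<longlongrightarrow> 0) (at_right 0)" by simp
      from dual_tendsto[OF \<phi> tendsto_q[OF this]]
      show "((\<lambda>s. \<phi> (q (G (of_real s * x) (of_real s * y)))) \<longlongrightarrow> 0) (at_right 0)"
        by (simp add: q_zero dual_zero[OF \<phi>])
    qed auto
    then show ?thesis by simp
  qed
  then show *: "q (x *\<^sub>C ncs_partial1 f x y) = q (\<Omega>1 x y * f x y - f x y * \<Omega>1 0 0)"
    by (simp add: G_def q_simps e1_def algebra_simps eq_neg_iff_add_eq_0)
  have "q (x *\<^sub>C ncs_partial1 f x y) + q (y *\<^sub>C ncs_partial2 f x y) =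
      q ((\<Omega>1 x y + \<Omega>2 x y) * f x y - f x y * (\<Omega>1 0 0 + \<Omega>2 0 0))"
    \<comment> \<open>The second equation is the Euler equation minus the first one.\<close>
    unfolding q_add[symmetric] euler[OF xy] ..
  then show "q (y *\<^sub>C ncs_partial2 f x y) = q (\<Omega>2 x y * f x y - f x y * \<Omega>2 0 0)"
    unfolding * by (simp add: q_simps algebra_simps)
qed

section \<open>Linear equations and logarithmic asymptotics\<close>

lemma has_real_deriv_ncs_mult:
  fixes f g :: "real \<Rightarrow> 'g ncs"
  assumes "has_real_deriv f f' t S" "has_real_deriv g g' t S"
  shows "has_real_deriv (\<lambda>s. f s * g s) (f' * g t + f t * g') t S"
  unfolding has_real_deriv_ncs_iff coeff_mult coeff_simps
proof
  fix w
  have "((\<lambda>s. \<Sum>k\<le>length w. ncs_coeff (f s) (take k w) * ncs_coeff (g s) (drop k w))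
      has_vector_derivative
      (\<Sum>k\<le>length w. ncs_coeff (f t) (take k w) * ncs_coeff g' (drop k w) + ncs_coeff f' (take k w)
          * ncs_coeff (g t) (drop k w)))
      (at t within S)"
    using assms unfolding has_real_deriv_ncs_iff
    by (intro has_vector_derivative_sum has_vector_derivative_mult) auto
  then show "((\<lambda>s. \<Sum>k\<le>length w. ncs_coeff (f s) (take k w) * ncs_coeff (g s) (drop k w))
      has_vector_derivative
      (\<Sum>k\<le>length w. ncs_coeff f' (take k w) * ncs_coeff (g t) (drop k w)) +
      (\<Sum>k\<le>length w. ncs_coeff (f t) (take k w) * ncs_coeff g' (drop k w))) (at t within S)"
    by (simp add: sum.distrib add.commute)
qed

lemma has_complex_deriv_ncs_mult:
  fixes f g :: "complex \<Rightarrow> 'g ncs"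
  assumes "has_complex_deriv f f' t" "has_complex_deriv g g' t"
  shows "has_complex_deriv (\<lambda>s. f s * g s) (f' * g t + f t * g') t"
  unfolding has_complex_deriv_ncs_iff coeff_mult coeff_simps
proof
  fix w
  have "((\<lambda>s. \<Sum>k\<le>length w. ncs_coeff (f s) (take k w) * ncs_coeff (g s) (drop k w)) has_field_derivative
      (\<Sum>k\<le>length w. ncs_coeff f' (take k w) * ncs_coeff (g t) (drop k w) + ncs_coeff g' (drop k w)
          * ncs_coeff (f t) (take k w))) (at t)"
    using assms unfolding has_complex_deriv_ncs_iff
    by (intro DERIV_sum DERIV_mult) auto
  then show "((\<lambda>s. \<Sum>k\<le>length w. ncs_coeff (f s) (take k w) * ncs_coeff (g s) (drop k w))
      has_field_derivative
      (\<Sum>k\<le>length w. ncs_coeff f' (take k w) * ncs_coeff (g t) (drop k w)) +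
      (\<Sum>k\<le>length w. ncs_coeff (f t) (take k w) * ncs_coeff g' (drop k w))) (at t)"
    by (simp add: sum.distrib mult.commute)
qed

section \<open>Exponentials of a letter\<close>

definition letter :: "'g \<Rightarrow> 'g ncs" where
  "letter a = Abs_ncs (\<lambda>w. if w = [a] then 1 else 0)"

lemma coeff_letter: "ncs_coeff (letter a) w = (if w = [a] then 1 else 0)"
  by (simp add: letter_def)

lemma linear_form_letter: "linear_form (letter a)"
  by (auto simp: linear_form_def coeff_letter)

lemma coeff_letter_power: "ncs_coeff (letter a ^ k) w = (if w = replicate k a then 1 else 0)"
proof (induction k arbitrary: w)
  case (Suc k)
  then show ?case by (cases w) (auto simp: coeff_linear_mult linear_form_letter coeff_letter)
qed simp

lemma scaleC_power: "(c *\<^sub>C x) ^ k = c ^ k *\<^sub>C (x ^ k :: 'a::complex_algebra_topology)"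
  by (induction k) (simp_all add: scaleC_one mult_scaleC_left mult_scaleC_right scaleC_scaleC
      power_commutes)

text \<open>The exponential of a multiple of a letter, given by its coefficients: only powers of the
  letter occur, so differentiating it is scalar calculus.\<close>

definition letter_exp :: "'g \<Rightarrow> complex \<Rightarrow> 'g ncs" where
  "letter_exp a c = Abs_ncs (\<lambda>w. if w =
      replicate (length w) a then c ^ length w / fact (length w) else 0)"

lemma coeff_letter_exp:
  "ncs_coeff (letter_exp a c) w =
      (if w = replicate (length w) a then c ^ length w / fact (length w) else 0)"
  by (simp add: letter_exp_def)

lemma letter_exp_sums: "(\<lambda>k. (1 / fact k) *\<^sub>C (c *\<^sub>C letter a) ^ k) sums letter_exp a c"
  unfolding sums_ncs_iff
proof
  fix w :: "'a list"
  have "(\<lambda>k. ncs_coeff ((1 / fact k) *\<^sub>C (c *\<^sub>C letter a) ^ k) w) sums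
      (\<Sum>k\<in>{length w}. ncs_coeff ((1 / fact k) *\<^sub>C (c *\<^sub>C letter a) ^ k) w)"
    by (rule sums_finite) (auto simp: scaleC_power coeff_letter_power)
  also have "(\<Sum>k\<in>{length w}. ncs_coeff ((1 / fact k) *\<^sub>C (c *\<^sub>C letter a) ^ k) w) =
      ncs_coeff (letter_exp a c) w"
    by (simp add: scaleC_power coeff_letter_power coeff_letter_exp)
  finally show "(\<lambda>k. ncs_coeff ((1 / fact k) *\<^sub>C (c *\<^sub>C letter a) ^ k) w) sums ncs_coeff
      (letter_exp a c) w" .
qed

text \<open>Kept in the unsimplified form in which the power rule differentiates
  \<open>c ^ n / fact n\<close>; at the empty word the factor \<open>of_nat 0\<close> makes the
  truncated exponent harmless.\<close>

lemma coeff_letter_mult_letter_exp: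
  "ncs_coeff (letter a * letter_exp a c) w =
    (if w = replicate (length w) a then of_nat (length w) * c ^ (length w - 1) / fact (length w)
        else 0)"
proof (cases w)
  case (Cons b v)
  have "of_nat (Suc n) / fact (Suc n) = (1 / fact n :: complex)" for n
    by (simp add: fact_Suc del: of_nat_Suc)
  then have "c ^ n / fact n = of_nat (Suc n) * c ^ n / fact (Suc n)" for n
    by (metis (no_types, opaque_lifting) mult.commute times_divide_eq_right mult_1_right)
  then show ?thesis using Cons by (auto simp: coeff_linear_mult linear_form_letter coeff_letter
      coeff_letter_exp)
qed (simp add: coeff_linear_mult linear_form_letter)

lemma letter_exp_has_complex_deriv:
  assumes "(c has_field_derivative c') (at p)"
  shows "has_complex_deriv (\<lambda>h. letter_exp a (c h)) (c' *\<^sub>C (letter a * letter_exp a (c p))) p"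
  unfolding has_complex_deriv_ncs_iff
proof
  fix w
  have "((\<lambda>h. c h ^ n / fact n) has_field_derivative
      c' * (of_nat n * c p ^ (n - 1) / fact n)) (at p)" for n
    using DERIV_cdivide[OF DERIV_power[OF assms, of n], of "fact n"] by (simp add: mult_ac)
  then show "((\<lambda>h. ncs_coeff (letter_exp a (c h)) w) has_field_derivative
      ncs_coeff (c' *\<^sub>C (letter a * letter_exp a (c p))) w) (at p)"
    by (auto simp: coeff_letter_exp coeff_letter_mult_letter_exp)
qed

lemma letter_exp_has_real_deriv:
  assumes "(c has_vector_derivative c') (at t within S)"
  shows "has_real_deriv (\<lambda>h. letter_exp a (c h)) (c' *\<^sub>C (letter a * letter_exp a (c t))) t S"
  unfolding has_real_deriv_ncs_iff
proof
  fix w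
  have "((\<lambda>z. z ^ n / fact n) has_field_derivative of_nat n * c t ^ (n - 1) / fact n) (at (c t))" for n
    using DERIV_cdivide[OF DERIV_power[OF DERIV_ident, of n], of "fact n"] by (simp add: mult_ac)
  then have "((\<lambda>h. c h ^ n / fact n) has_vector_derivative
      c' * (of_nat n * c t ^ (n - 1) / fact n)) (at t within S)" for n
    using field_vector_diff_chain_within[OF assms DERIV_subset] by (fastforce simp: o_def)
  then show "((\<lambda>h. ncs_coeff (letter_exp a (c h)) w) has_vector_derivative
      ncs_coeff (c' *\<^sub>C (letter a * letter_exp a (c t))) w) (at t within S)"
    by (auto simp: coeff_letter_exp coeff_letter_mult_letter_exp)
qed

lemma letter_exp_zero: "letter_exp a 0 = 1"
  by (intro ncs_eqI) (auto simp: coeff_letter_exp power_0_left)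

text \<open>A functional with bound \<open>N\<close> thus sees a polynomial of degree below
  \<open>N\<close> in \<open>c\<close>, where \<open>c\<close> will be a multiple of a
  logarithm.\<close>

lemma vanishes_below_letter_exp:
  "vanishes_below N (letter_exp a c - (\<Sum>k<N. (c ^ k / fact k) *\<^sub>C letter a ^ k))"
proof -
  have "(\<Sum>k<N. c ^ k / fact k * (if w = replicate k a then 1 else 0)) =
      (if w = replicate (length w) a then c ^ length w / fact (length w) else 0)" if
          "length w < N" for w
  proof -
    have "(\<Sum>k<N. c ^ k / fact k * (if w = replicate k a then 1 else 0)) =
        (\<Sum>k<N. if k = length w then (if w =
            replicate (length w) a then c ^ length w / fact (length w) else 0) else 0)"
      by (rule sum.cong) auto
    then show ?thesis using that by simp
  qed
  then show ?thesis
    by (simp add: vanishes_below_def coeff_letter_exp coeff_letter_power)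
qed

text \<open>With s = - ln t this is the decay of s^k / exp s at infinity.\<close>

lemma tendsto_mult_ln_power: "((\<lambda>t. t * ln t ^ k) \<longlongrightarrow> 0) (at_right (0::real))"
proof -
  have "((\<lambda>s. s ^ k / exp s) \<longlongrightarrow> 0) (at_top :: real filter)"
    by (rule tendsto_power_div_exp_0)
  moreover have "filterlim (\<lambda>t. - ln t) at_top (at_right (0::real))"
    using ln_at_0 by (simp add: filterlim_uminus_at_top)
  ultimately have "((\<lambda>t. (- ln t) ^ k / exp (- ln t)) \<longlongrightarrow> 0) (at_right (0::real))"
    by (rule filterlim_compose)
  then have "((\<lambda>t. (- 1) ^ k * ((- ln t) ^ k / exp (- ln t))) \<longlongrightarrow> (- 1) ^ k * 0) (at_right (0::real))"
    by (intro tendsto_mult tendsto_const)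
  moreover have "\<forall>\<^sub>F t in at_right (0::real). (- 1) ^ k * ((- ln t) ^ k / exp (- ln t)) = t * ln t ^ k"
    using eventually_at_right_less[of "0::real"]
  proof eventually_elim
    case (elim t)
    have "(- 1) ^ k * (- ln t) ^ k = ln t ^ k" by (simp flip: power_mult_distrib)
    then show ?case using elim by (simp add: exp_minus field_simps)
  qed
  ultimately show ?thesis by (simp add: tendsto_cong)
qed

context ncs_quotient
begin

lemma alg_exp_letter: "alg_exp (c *\<^sub>C q (letter a)) = q (letter_exp a c)"
proof -
  have "(\<lambda>k. q ((1 / fact k) *\<^sub>C (c *\<^sub>C letter a) ^ k)) sums q (letter_exp a c)"
    using tendsto_q[OF letter_exp_sums[unfolded sums_def]] by (simp add: sums_def q_sum)
  then have "(\<lambda>k. (1 / fact k) *\<^sub>C (c *\<^sub>C q (letter a)) ^ k) sums q (letter_exp a c)"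
    by (simp add: q_simps)
  then show ?thesis unfolding alg_exp_def by (rule suminf_q)
qed

lemma monodromy_power_letter:
  "monodromy_power b (q (letter a)) = q (letter_exp a (Ln b / (2 * of_real pi * \<i>)))"
  by (simp add: monodromy_power_def alg_exp_letter)

text \<open>Commutation passes to the partial sums of the exponential series and then to the limit,
  multiplication being continuous in each factor.\<close>

lemma commute_letter_exp:
  assumes "x * q (letter a) = q (letter a) * x"
  shows "x * q (letter_exp a c) = q (letter_exp a c) * x"
proof -
  define s where "s = (\<lambda>n. \<Sum>k<n. q ((1 / fact k) *\<^sub>C (c *\<^sub>C letter a) ^ k))"
  have s: "s \<longlonglongrightarrow> q (letter_exp a c)"
    using tendsto_q[OF letter_exp_sums[unfolded sums_def]] by (simp add: s_def q_sum)
  have "x * q (letter a) ^ k = q (letter a) ^ k * x" for k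
    by (induction k) (auto simp: assms mult.assoc[symmetric], simp add: mult.assoc)
  then have comm: "(\<lambda>n. x * s n) = (\<lambda>n. s n * x)"
    by (simp add: fun_eq_iff s_def q_simps scaleC_power sum_distrib_left sum_distrib_right
        mult_scaleC_left mult_scaleC_right)
  have "(\<lambda>n. x * s n) \<longlonglongrightarrow> x * q (letter_exp a c)"
    using continuous_on_tendsto_compose[OF continuous_mult_left s] by simp
  moreover have "(\<lambda>n. x * s n) \<longlonglongrightarrow> q (letter_exp a c) * x"
    using continuous_on_tendsto_compose[OF continuous_mult_right s] unfolding comm by simp
  ultimately show ?thesis by (rule tendsto_unique_q[OF sequentially_bot])
qed

text \<open>Weakly negligible at \<open>0\<close>, even against powers of the logarithm: this survives
  multiplication by the multivalued factors \<open>t\<^bsup>x\<^esup>\<close>.\<close>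

definition log_negligible :: "(real \<Rightarrow> 'a) \<Rightarrow> bool" where
  "log_negligible y \<longleftrightarrow> (\<forall>N \<phi> k. dual N \<phi> \<longrightarrow> ((\<lambda>t. of_real (ln t ^ k) * \<phi> (y t)) \<longlongrightarrow> 0) (at_right 0))"

lemma log_negligible_tendsto: "log_negligible y \<Longrightarrow> dual N \<phi> \<Longrightarrow> ((\<lambda>t. \<phi> (y t)) \<longlongrightarrow> 0) (at_right 0)"
  unfolding log_negligible_def by (drule spec[of _ N], drule spec[of _ \<phi>], drule spec[of _ 0]) simp

text \<open>A one-sided derivative at 0 of a function vanishing there gives O(t), which absorbs
  every power of ln t.\<close>

lemma log_negligibleI:
  assumes "\<And>N \<phi>. dual N \<phi> \<Longrightarrow> \<exists>D. ((\<lambda>t. \<phi> (y t)) has_vector_derivative D) (at 0 within {0<..})" "y 0 = 0"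
  shows "log_negligible y"
  unfolding log_negligible_def
proof (intro allI impI)
  fix N \<phi> k assume \<phi>: "dual N \<phi>"
  then obtain D where "((\<lambda>t. \<phi> (y t)) has_vector_derivative D) (at 0 within {0<..})"
    using assms(1) by blast
  then have "((\<lambda>t. (1 / t) *\<^sub>R \<phi> (y t)) \<longlongrightarrow> D) (at_right 0)"
    using assms(2) by (simp add: has_vector_derivative_iff_quotient dual_zero[OF \<phi>])
  from tendsto_scaleR[OF tendsto_mult_ln_power[of k] this]
  have "((\<lambda>t. (t * ln t ^ k) *\<^sub>R (1 / t) *\<^sub>R \<phi> (y t)) \<longlongrightarrow> 0) (at_right 0)"
    by simp
  moreover have "\<forall>\<^sub>F t in at_right (0::real). (t * ln t ^ k) *\<^sub>R (1 / t) *\<^sub>R \<phi> (y t) =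
      of_real (ln t ^ k) * \<phi> (y t)"
    using eventually_at_right_less[of "0::real"] by eventually_elim (simp add: scaleR_conv_of_real)
  ultimately show "((\<lambda>t. of_real (ln t ^ k) * \<phi> (y t)) \<longlongrightarrow> 0) (at_right 0)"
    by (rule Lim_transform_eventually)
qed

lemma log_negligible_cong:
  assumes "log_negligible y" "\<forall>\<^sub>F t in at_right 0. y t = z t"
  shows "log_negligible z"
  unfolding log_negligible_def
proof (intro allI impI)
  fix N \<phi> k assume "dual N \<phi>"
  with assms(1) have "((\<lambda>t. of_real (ln t ^ k) * \<phi> (y t)) \<longlongrightarrow> 0) (at_right 0)"
    by (simp add: log_negligible_def)
  then show "((\<lambda>t. of_real (ln t ^ k) * \<phi> (z t)) \<longlongrightarrow> 0) (at_right 0)"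
    by (rule Lim_transform_eventually) (use assms(2) in \<open>auto elim: eventually_mono\<close>)
qed

lemma log_negligible_mult_const:
  assumes "log_negligible y"
  shows "log_negligible (\<lambda>t. y t * x)" "log_negligible (\<lambda>t. x * y t)"
  using assms dual_comp_mult[of _ _ x] unfolding log_negligible_def by blast+

text \<open>Tested by a functional of bounded degree, the power is a polynomial in ln t + ln c with
  coefficients in the algebra. Right multiplication by these coefficients only changes the
  functional, and the powers of ln t are absorbed by the hypothesis.\<close>

lemma log_negligible_mult_power:
  assumes y: "log_negligible y" and c: "0 < c"
  shows "log_negligible (\<lambda>t. y t * monodromy_power (of_real (c * t)) (q (letter a)))"
  unfolding log_negligible_def
proof (intro allI impI)
  fix N \<phi> m assume \<phi>: "dual N \<phi>"
  define L where "L = (\<lambda>t. Ln (of_real c * of_real t) / (2 * of_real pi * \<i>))"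
  have Lt: "Ln (of_real c * of_real t) / (2 * of_real pi * \<i>) = L t" for t
    by (simp add: L_def)
  define d where "d = 2 * of_real pi * \<i>"
  have exp: "\<phi> (y t * monodromy_power (of_real (c * t)) (q (letter a))) =
      (\<Sum>k<N. L t ^ k / fact k * \<phi> (y t * q (letter a) ^ k))" for t
  proof -
    \<comment> \<open>The lift is chosen separately for each \<open>t\<close>, as the identity is
      pointwise.\<close>
    obtain u where u: "y t = q u" by (rule obtain_lift)
    have "\<phi> (q (u * (letter_exp a (L t) - (\<Sum>k<N. (L t ^ k / fact k) *\<^sub>C letter a ^ k)))) = 0"
      by (rule dual_vanish[OF \<phi> vanishes_below_mult(1)[OF vanishes_below_letter_exp]])
    then show ?thesis
      by (simp add: monodromy_power_letter Lt u q_simps right_diff_distrib dual_diff[OF \<phi>]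
          sum_distrib_left dual_sum[OF \<phi>] dual_scaleC[OF \<phi>] mult_scaleC_right)
  qed
  have summand: "((\<lambda>t. of_real (ln t ^ m) * (L t ^ k / fact k * \<phi> (y t * q (letter a) ^ k))) \<longlongrightarrow>
      0) (at_right 0)" for k
  proof -
    \<comment> \<open>The binomial expansion of (ln t + ln c)^k, multiplied by the extra power of ln
      t from the definition of negligibility.\<close>
    have "((\<lambda>t. \<Sum>i\<le>k. (of_nat (k choose i) * of_real (ln c) ^ (k - i) / d ^ k / fact k) *
        (of_real (ln t ^ (m + i)) * \<phi> (y t * q (letter a) ^ k))) \<longlongrightarrow>
        (\<Sum>i\<le>k. (of_nat (k choose i) * of_real (ln c) ^ (k - i) / d ^ k / fact k) * 0)) (at_right 0)"
      using log_negligible_mult_const(1)[OF y, of "q (letter a) ^ k"] \<phi>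
      by (intro tendsto_sum tendsto_mult tendsto_const) (auto simp: log_negligible_def)
    moreover have "\<forall>\<^sub>F t in at_right 0.
        (\<Sum>i\<le>k. (of_nat (k choose i) * of_real (ln c) ^ (k - i) / d ^ k / fact k) *
        (of_real (ln t ^ (m + i)) * \<phi> (y t * q (letter a) ^ k))) =
        of_real (ln t ^ m) * (L t ^ k / fact k * \<phi> (y t * q (letter a) ^ k))"
      using eventually_at_right_less[of "0::real"]
    proof eventually_elim
      case (elim t)
      have "Ln (of_real c * of_real t) = of_real (ln t) + of_real (ln c)"
        using elim c Ln_of_real[of "c * t"] by (simp add: ln_mult)
      then have "L t ^ k = (\<Sum>i\<le>k. of_nat (k choose i) * of_real (ln t) ^ i * of_real (ln c) ^
          (k - i)) / d ^ k"
        by (simp add: L_def d_def power_divide binomial_ring)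
      then show ?case
        by (simp add: sum_distrib_left sum_distrib_right sum_divide_distrib power_add mult_ac)
    qed
    ultimately show ?thesis by (simp add: Lim_transform_eventually)
  qed
  have "((\<lambda>t. \<Sum>k<N. of_real (ln t ^ m) * (L t ^ k / fact k * \<phi> (y t * q (letter a) ^ k))) \<longlongrightarrow>
      (\<Sum>k<N. 0)) (at_right 0)"
    by (intro tendsto_sum summand)
  then show "((\<lambda>t. of_real (ln t ^ m) * \<phi> (y t * monodromy_power (of_real (c * t))
      (q (letter a)))) \<longlongrightarrow> 0) (at_right 0)"
    unfolding exp sum_distrib_left by simp
qed

text \<open>Only scalar derivatives occur, so the notion passes to differences, to products with
  constants and along \<open>proj\<close> by changing the functional alone.\<close>

definition weak_solution :: "(real \<Rightarrow> 'g ncs) \<Rightarrow> real set \<Rightarrow> (real \<Rightarrow> 'a) \<Rightarrow> bool" where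
  "weak_solution \<Omega> S \<Psi> \<longleftrightarrow> (\<forall>N \<phi>. dual N \<phi> \<longrightarrow> (\<forall>t\<in>S.
     ((\<lambda>t. \<phi> (\<Psi> t)) has_vector_derivative \<phi> (q (\<Omega> t) * \<Psi> t)) (at t within S)))"

lemma weak_solutionI:
  "(\<And>t. t \<in> S \<Longrightarrow> has_real_deriv \<Psi> (q (\<Omega> t) * \<Psi> t) t S) \<Longrightarrow> weak_solution \<Omega> S \<Psi>"
  unfolding weak_solution_def by (auto intro: dual_deriv)

lemma weak_solution_diff:
  "weak_solution \<Omega> S \<Psi> \<Longrightarrow> weak_solution \<Omega> S \<Phi> \<Longrightarrow> weak_solution \<Omega> S (\<lambda>t. \<Psi> t - \<Phi> t)"
  unfolding weak_solution_def
  by (auto simp: right_diff_distrib dual_diff intro!: has_vector_derivative_diff)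

lemma weak_solution_mult_const: "weak_solution \<Omega> S \<Psi> \<Longrightarrow> weak_solution \<Omega> S (\<lambda>t. \<Psi> t * x)"
  unfolding weak_solution_def using dual_comp_mult(2)[of _ _ x] by (auto simp: mult.assoc[symmetric])

lemma weak_solution_const_mult:
  assumes "weak_solution \<Omega> S \<Psi>" "\<And>t. t \<in> S \<Longrightarrow> x * q (\<Omega> t) = q (\<Omega> t) * x"
  shows "weak_solution \<Omega> S (\<lambda>t. x * \<Psi> t)"
  unfolding weak_solution_def
proof (intro allI impI ballI)
  fix N \<phi> t assume \<phi>: "dual N \<phi>" and t: "t \<in> S"
  have "((\<lambda>t. \<phi> (x * \<Psi> t)) has_vector_derivative \<phi> (x * (q (\<Omega> t) * \<Psi> t))) (at t within S)"
    by (rule assms(1)[unfolded weak_solution_def, rule_format, OF dual_comp_mult(1)[OF \<phi>, of x] t])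
  then show "((\<lambda>t. \<phi> (x * \<Psi> t)) has_vector_derivative \<phi> (q (\<Omega> t) * (x * \<Psi> t))) (at t within S)"
    using assms(2)[OF t] by (simp add: mult.assoc[symmetric])
qed

lemma weak_solution_vanish:
  assumes "weak_solution \<Omega> S D" "convex S" "F \<noteq> bot" "\<forall>\<^sub>F t in F. t \<in> S"
    and "\<And>t. t \<in> S \<Longrightarrow> linear_form (\<Omega> t)"
    and "\<And>N \<phi>. dual N \<phi> \<Longrightarrow> ((\<lambda>t. \<phi> (D t)) \<longlongrightarrow> 0) F"
    and "t \<in> S"
  shows "D t = 0"
proof (rule triangular_vanish[OF assms(2-4) _ assms(6,7)])
  fix N \<phi> t assume *: "dual (Suc N) \<phi>" "\<And>\<psi> t. dual N \<psi> \<Longrightarrow> t \<in> S \<Longrightarrow> \<psi> (D t) = 0" "t \<in> S"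
  have "\<phi> (q (\<Omega> t) * D t) = 0"
    by (rule *(2)[OF dual_comp_linear(1)[OF *(1) assms(5)]]) (use * in auto)
  then show "((\<lambda>t. \<phi> (D t)) has_vector_derivative 0) (at t within S)"
    using assms(1) * unfolding weak_solution_def by metis
qed

lemma weak_solution_unique:
  assumes "weak_solution \<Omega> S \<Psi>" "weak_solution \<Omega> S \<Phi>" "convex S"
    and "\<And>t. t \<in> S \<Longrightarrow> linear_form (\<Omega> t)" "t1 \<in> S" "\<Psi> t1 = \<Phi> t1" "t \<in> S"
  shows "\<Psi> t = \<Phi> t"
proof -
  have "\<Psi> t - \<Phi> t = 0"
  proof (rule weak_solution_vanish[OF weak_solution_diff[OF assms(1,2)] assms(3)])
    \<comment> \<open>An ordinary initial value is a limit along a principal filter, so regular and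
      singular initial points are covered by one lemma.\<close>
    show "principal {t1} \<noteq> bot" by (simp add: principal_eq_bot_iff)
    show "\<forall>\<^sub>F t in principal {t1}. t \<in> S" using assms(5) by (simp add: eventually_principal)
    show "((\<lambda>t. \<phi> (\<Psi> t - \<Phi> t)) \<longlongrightarrow> 0) (principal {t1})" if "dual N \<phi>" for N \<phi>
      by (rule tendsto_eventually) (simp add: eventually_principal assms(6) dual_zero[OF that])
  qed (use assms in auto)
  then show ?thesis by simp
qed

end

text \<open>Makes the results on quotients available in the series algebra itself.\<close>

lemma ncs_quotient_id: "ncs_quotient (\<lambda>f :: 'g ncs. f)"
proof
  have "closed {f :: 'g ncs. ncs_coeff f w = 0}" for w
  proof -
    have "continuous_on UNIV (\<lambda>f :: 'g ncs. ncs_coeff f w)"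
      by (rule continuous_on_ncsI) (rule tendsto_coeff)
    then show ?thesis by (intro closed_Collect_eq continuous_on_const)
  qed
  then have "closed (\<Inter>w. {f :: 'g ncs. ncs_coeff f w = 0})" by blast
  moreover have "(\<Inter>w. {f :: 'g ncs. ncs_coeff f w = 0}) = {f. f = 0}"
    by (auto intro: ncs_eqI)
  ultimately show "closed {f :: 'g ncs. f = 0}" by simp
qed auto

text \<open>Each coefficient is an antiderivative of a known function, obtained from the coefficient
  at the tail of the word, so no fixed point argument is involved. The coefficient at the empty word
  is constant. Extended real end points cover both a bounded interval and a half line.\<close>

lemma linear_equation_solution:
  fixes \<Omega> :: "real \<Rightarrow> 'g ncs"
  assumes \<Omega>: "\<And>t w. a < ereal t \<Longrightarrow> ereal t < b \<Longrightarrow> isCont (\<lambda>t. ncs_coeff (\<Omega> t) w) t"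
    and lin: "\<And>t. a < ereal t \<Longrightarrow> ereal t < b \<Longrightarrow> linear_form (\<Omega> t)"
    and t1: "a < ereal t1" "ereal t1 < b"
  obtains \<Psi> where "\<Psi> t1 = \<Psi>1" "\<And>t. ncs_coeff (\<Psi> t) [] = ncs_coeff \<Psi>1 []"
    "\<And>t S. a < ereal t \<Longrightarrow> ereal t < b \<Longrightarrow> has_real_deriv \<Psi> (\<Omega> t * \<Psi> t) t S"
proof -
  have ab: "a < b" using t1 by (rule less_trans)
  define good where "good = (\<lambda>(g :: real \<Rightarrow> complex) c w h. h t1 = ncs_coeff \<Psi>1 w \<and>
    (\<forall>t. a < ereal t \<longrightarrow> ereal t < b \<longrightarrow> (h has_vector_derivative ncs_coeff (\<Omega> t) [c] * g t) (at t)))"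
  define F where "F = rec_list (\<lambda>t. ncs_coeff \<Psi>1 []) (\<lambda>c v g. SOME h. good g c (c # v) h)"
  have FNil: "F [] = (\<lambda>t. ncs_coeff \<Psi>1 [])"
      and FCons: "F (c # v) = (SOME h. good (F v) c (c # v) h)" for c v
    by (simp_all add: F_def)
  have cont: "\<forall>t. a < ereal t \<longrightarrow> ereal t < b \<longrightarrow> isCont (F w) t"
      and good: "w = c # v \<Longrightarrow> good (F v) c w (F w)" for w c v
  proof -
    have "(\<forall>t. a < ereal t \<longrightarrow> ereal t < b \<longrightarrow> isCont (F w) t) \<and> (\<forall>c v. w = c # v \<longrightarrow> good (F v) c w (F w))"
    proof (induction w)
      case Nil
      then show ?case by (simp add: FNil)
    next
      case (Cons c v)
      then have "isCont (\<lambda>t. ncs_coeff (\<Omega> t) [c] * F v t) t" if "a < ereal t" "ereal t < b" for t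
        using \<Omega> that by (intro continuous_mult) auto
      from einterval_antiderivative[OF ab this] obtain H where
        H: "\<forall>t. a < ereal t \<longrightarrow> ereal t < b \<longrightarrow>
            (H has_vector_derivative ncs_coeff (\<Omega> t) [c] * F v t) (at t)"
        by blast
      then have "good (F v) c (c # v) (\<lambda>t. H t - H t1 + ncs_coeff \<Psi>1 (c # v))"
        unfolding good_def by (auto intro!: derivative_eq_intros)
      then have g: "good (F v) c (c # v) (F (c # v))"
        unfolding FCons by (rule someI[where P = "good (F v) c (c # v)"])
      then show ?case
        unfolding good_def by (auto intro: has_vector_derivative_continuous)
    qed
    then show "\<forall>t. a < ereal t \<longrightarrow> ereal t < b \<longrightarrow> isCont (F w) t" "w = c # v \<Longrightarrow> good (F v) c w (F w)"
        by blast+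
  qed
  show ?thesis
  proof (rule that[of "\<lambda>t. Abs_ncs (\<lambda>w. F w t)"])
    show "Abs_ncs (\<lambda>w. F w t1) = \<Psi>1"
    proof (rule ncs_eqI)
      show "ncs_coeff (Abs_ncs (\<lambda>w. F w t1)) w = ncs_coeff \<Psi>1 w" for w
        using good[of w] by (cases w) (auto simp: FNil good_def)
    qed
    show "ncs_coeff (Abs_ncs (\<lambda>w. F w t)) [] = ncs_coeff \<Psi>1 []" for t
      by (simp add: FNil)
    fix t S assume t: "a < ereal t" "ereal t < b"
    show "has_real_deriv (\<lambda>t. Abs_ncs (\<lambda>w. F w t)) (\<Omega> t * Abs_ncs (\<lambda>w. F w t)) t S"
      unfolding has_real_deriv_ncs_iff
    proof
      fix w
      show "((\<lambda>s. ncs_coeff (Abs_ncs (\<lambda>w. F w s)) w) has_vector_derivative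
          ncs_coeff (\<Omega> t * Abs_ncs (\<lambda>w. F w t)) w) (at t within S)"
      proof (cases w)
        case Nil
        then show ?thesis by (simp add: FNil coeff_linear_mult[OF lin[OF t]])
      next
        case (Cons c v)
        then show ?thesis using good[OF Cons] t
          by (auto simp: good_def coeff_linear_mult[OF lin[OF t]] intro:
              has_vector_derivative_at_within)
      qed
    qed
  qed
qed

section \<open>Tangential solutions in one variable\<close>

interpretation ncs_id: ncs_quotient "\<lambda>f :: 'g ncs. f"
  by (rule ncs_quotient_id)

lemma finite_lower_bound:
  fixes h :: "'b \<Rightarrow> real"
  assumes "finite A" "\<And>x. x \<in> A \<Longrightarrow> 0 < h x"
  obtains \<rho> where "0 < \<rho>" "\<And>x. x \<in> A \<Longrightarrow> \<rho> \<le> h x"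
  using that[of "Min (insert 1 (h ` A))"] assms by (simp add: Min_gr_iff)

lemma powser_deriv_0:
  fixes c :: "nat \<Rightarrow> complex"
  assumes "0 < \<rho>" "\<And>x. norm x < \<rho> \<Longrightarrow> (\<lambda>k. x ^ k * c k) sums F x"
  shows "\<exists>D. (F has_field_derivative D) (at 0)"
proof -
  have s: "(\<lambda>k. c k * x ^ k) sums F x" if "norm x < \<rho>" for x
    using assms(2)[OF that] by (simp add: mult.commute)
  have "summable (\<lambda>k. c k * of_real (\<rho> / 2) ^ k)"
    using s[of "of_real (\<rho> / 2)"] assms(1) by (simp add: sums_iff)
  from termdiffs_strong[OF this, of 0] assms(1)
  obtain D where "((\<lambda>x. \<Sum>k. c k * x ^ k) has_field_derivative D) (at 0)"
    by auto
  then have "(F has_field_derivative D) (at 0)"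
    by (rule has_field_derivative_transform_within_open[where S = "ball 0 \<rho>"])
      (use s assms(1) in \<open>auto simp: sums_iff\<close>)
  then show ?thesis ..
qed

lemma bipower_sums_0:
  assumes "bipower r a g" "norm x < r"
  shows "(\<lambda>k. x ^ k * a k 0) sums g x 0"
proof -
  let ?f = "\<lambda>(p, q). x ^ p * 0 ^ q * a p q"
  have "(?f has_sum g x 0) UNIV"
    using bipower_sum[OF assms(1), of x 0] assms(2) le_less_trans[OF norm_ge_zero assms(2)] by simp
  also have "?this \<longleftrightarrow> (?f has_sum g x 0) (range (\<lambda>p. (p, 0)))"
    by (rule has_sum_cong_neutral) (auto simp: image_iff power_0_left)
  also have "\<dots> \<longleftrightarrow> ((?f \<circ> (\<lambda>p. (p, 0))) has_sum g x 0) UNIV"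
    by (rule has_sum_reindex) (auto simp: inj_on_def)
  finally have "((\<lambda>p. x ^ p * a p 0) has_sum g x 0) UNIV"
    by (simp add: o_def)
  then show ?thesis by (rule has_sum_imp_sums)
qed

text \<open>The theory in one variable is obtained as the slice y = 0 of the one in two
  variables.\<close>

lemma ncs_bianalytic_analytic_disc:
  assumes "ncs_bianalytic r f"
  shows "analytic_disc r (\<lambda>x. f x 0)"
proof -
  have "\<forall>w. \<exists>a. bipower r a (\<lambda>x y. ncs_coeff (f x y) w)"
    using assms by (simp add: ncs_bianalytic_def bianalytic_def)
  then obtain a where a: "\<And>w. bipower r (a w) (\<lambda>x y. ncs_coeff (f x y) w)"
    by metis
  show ?thesis
    unfolding analytic_disc_def
    by (rule exI[of _ "\<lambda>k. Abs_ncs (\<lambda>w. a w k 0)"])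
        (auto simp: sums_ncs_iff intro!: bipower_sums_0[OF a])
qed

lemma ncs_bianalytic_analytic_bidisc:
  assumes "ncs_bianalytic r f"
  shows "analytic_bidisc r f"
proof -
  have "\<forall>w. \<exists>a. bipower r a (\<lambda>x y. ncs_coeff (f x y) w)"
    using assms by (simp add: ncs_bianalytic_def bianalytic_def)
  then obtain a where a: "\<And>w. bipower r (a w) (\<lambda>x y. ncs_coeff (f x y) w)"
    by metis
  show ?thesis
    unfolding analytic_bidisc_def
    using bipower_sum[OF a]
    by (intro exI[of _ "\<lambda>p q. Abs_ncs (\<lambda>w. a w p q)"]) (auto simp: has_sum_ncs_iff case_prod_unfold)
qed

lemma linear_form_log_form: "(\<And>k. linear_form (x k)) \<Longrightarrow> linear_form (log_form pt x p v)"
  unfolding log_form_def by (intro linear_form_simps)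

context ncs_quotient
begin

lemma log_form_q: "log_form pt (\<lambda>k. q (x k)) p v = q (log_form pt x p v)"
  by (simp add: log_form_def q_simps)

lemma analytic_disc_q: "analytic_disc r f \<Longrightarrow> analytic_disc r (\<lambda>x. q (f x))"
proof -
  assume "analytic_disc r f"
  then obtain c where c: "\<And>x. norm x < r \<Longrightarrow> (\<lambda>k. x ^ k *\<^sub>C c k) sums f x"
    by (auto simp: analytic_disc_def)
  have "(\<lambda>k. x ^ k *\<^sub>C q (c k)) sums q (f x)" if "norm x < r" for x
    using tendsto_q[OF c[OF that, unfolded sums_def]] by (simp add: sums_def q_simps)
  then show ?thesis unfolding analytic_disc_def by (intro exI[of _ "\<lambda>k. q (c k)"]) auto
qed

lemma analytic_bidisc_q: "analytic_bidisc r f \<Longrightarrow> analytic_bidisc r (\<lambda>x y. q (f x y))"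
proof -
  assume "analytic_bidisc r f"
  then obtain c where c: "\<And>x y. norm x < r \<and> norm y < r \<Longrightarrow>
      ((\<lambda>(i, j). (x ^ i * y ^ j) *\<^sub>C c i j) has_sum f x y) UNIV"
    by (auto simp: analytic_bidisc_def)
  have "((\<lambda>(i, j). (x ^ i * y ^ j) *\<^sub>C q (c i j)) has_sum q (f x y)) UNIV" if
      "norm x < r \<and> norm y < r" for x y
    using tendsto_q[OF c[OF that, unfolded has_sum_def]]
    by (simp add: has_sum_def q_simps case_prod_unfold)
  then show ?thesis unfolding analytic_bidisc_def by (intro exI[of _ "\<lambda>i j. q (c i j)"]) auto
qed

text \<open>Applies to the unknown analytic factor of an arbitrary normalized solution: a functional
  turns its series into a scalar power series.\<close>

lemma analytic_disc_dual_deriv: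
  assumes "dual N \<phi>" "0 < r" "analytic_disc r f"
  shows "\<exists>D. ((\<lambda>t. \<phi> (f (of_real t))) has_vector_derivative D) (at 0 within S)"
proof -
  obtain c where c: "\<And>x. norm x < r \<Longrightarrow> (\<lambda>k. x ^ k *\<^sub>C c k) sums f x"
    using assms(3) by (auto simp: analytic_disc_def)
  have "(\<lambda>k. x ^ k * \<phi> (c k)) sums \<phi> (f x)" if "norm x < r" for x
    using dual_tendsto[OF assms(1) c[OF that, unfolded sums_def]]
    by (simp add: sums_def dual_sum[OF assms(1)] dual_scaleC[OF assms(1)])
  from powser_deriv_0[OF assms(2) this] obtain D where
      "((\<lambda>x. \<phi> (f x)) has_field_derivative D) (at (of_real 0))"
    by auto
  from has_vector_derivative_real_field[OF this] show ?thesis by blast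
qed

lemma analytic_bidisc_dual_deriv:
  assumes "dual N \<phi>" "0 < r" "analytic_bidisc r f"
  shows "\<exists>D. ((\<lambda>t. \<phi> (f (of_real t * x) (of_real t * y))) has_vector_derivative D) (at 0 within S)"
proof -
  obtain c where c: "\<And>x y. norm x < r \<and> norm y < r \<Longrightarrow>
      ((\<lambda>(i, j). (x ^ i * y ^ j) *\<^sub>C c i j) has_sum f x y) UNIV"
    using assms(3) by (auto simp: analytic_bidisc_def)
  have "bipower r (\<lambda>i j. \<phi> (c i j)) (\<lambda>x y. \<phi> (f x y))"
    unfolding bipower_def
  proof (intro allI impI)
    fix x y :: complex assume "norm x < r \<and> norm y < r"
    from dual_tendsto[OF assms(1) c[OF this, unfolded has_sum_def]]
    show "((\<lambda>(i, j). x ^ i * y ^ j * \<phi> (c i j)) has_sum \<phi> (f x y)) UNIV"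
      by (simp add: has_sum_def dual_sum[OF assms(1)] dual_scaleC[OF assms(1)] case_prod_unfold)
  qed
  from bipower_has_deriv[OF this, of 0 0 x y] assms(2)
  obtain D where "((\<lambda>h. \<phi> (f (h * x) (h * y))) has_field_derivative D) (at (of_real 0))"
    by auto
  from has_vector_derivative_real_field[OF this] show ?thesis by blast
qed

text \<open>As the residue at the base point is a letter, \<open>monodromy_power\<close> is explicit
  on both sides and \<open>q\<close> carries one to the other.\<close>

lemma tangential_solution_q:
  assumes "tangential_solution pt x r v \<delta> T \<Psi>" "x r = letter a"
  shows "tangential_solution pt (\<lambda>k. q (x k)) r v \<delta> T (\<lambda>t. q (\<Psi> t))"
proof -
  obtain f \<rho> where f: "0 < \<rho>" "analytic_disc \<rho> f" "f 0 = 1"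
      "\<forall>\<^sub>F t in at_right 0. \<Psi> t = f ((\<delta> t - pt r) / v) * monodromy_power ((\<delta> t - pt r) / v) (x r)"
    using assms(1) unfolding tangential_solution_def by blast
  show ?thesis
    unfolding tangential_solution_def
  proof (intro conjI ballI exI[of _ "\<lambda>x. q (f x)"] exI[of _ \<rho>])
    fix t assume "t \<in> {0<..T}"
    then have "has_real_deriv \<Psi> (log_form pt x (\<delta> t) (vector_derivative \<delta> (at t within {0..T})) *
        \<Psi> t) t {0<..T}"
      using assms(1) by (simp add: tangential_solution_def)
    from has_real_deriv_q[OF this]
    show "has_real_deriv (\<lambda>t. q (\<Psi> t))
        (log_form pt (\<lambda>k. q (x k)) (\<delta> t) (vector_derivative \<delta> (at t within {0..T})) * q (\<Psi> t)) t
        {0<..T}"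
      by (simp add: log_form_q q_mult)
  next
    show "\<forall>\<^sub>F t in at_right 0. q (\<Psi> t) =
        q (f ((\<delta> t - pt r) / v)) * monodromy_power ((\<delta> t - pt r) / v) (q (x r))"
      using f(4) by eventually_elim
        (simp add: assms(2) monodromy_power_letter ncs_id.monodromy_power_letter q_mult)
  qed (use f in \<open>auto simp: q_one analytic_disc_q\<close>)
qed

end

text \<open>The derivative is a separate argument, one-sided at both ends, so that the initial part
  of \<open>\<gamma>\<close> and the reversed final part are both instances.\<close>

definition tangential_path :: "('n::finite \<Rightarrow> complex) \<Rightarrow> 'n \<Rightarrow> complex \<Rightarrow> (real \<Rightarrow> complex) \<Rightarrow>
    (real \<Rightarrow> complex) \<Rightarrow> real \<Rightarrow> bool" where
  "tangential_path pt r v \<delta> \<delta>' T \<longleftrightarrow> inj pt \<and> 0 < T \<and> v \<noteq> 0 \<and>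
     (\<forall>t\<in>{0..T}. (\<delta> has_vector_derivative \<delta>' t) (at t within {0..T})) \<and>
     continuous_on {0..T} \<delta>' \<and> (\<forall>t\<in>{0<..T}. \<delta> t \<notin> range pt) \<and>
     (\<exists>\<epsilon>>0. \<forall>t\<in>{0..\<epsilon>}. \<delta> t = pt r + v * of_real t)"

lemma tangential_path_start:
  assumes "tangential_path pt r v \<delta> \<delta>' T"
  shows "\<forall>\<^sub>F t in at_right 0. (\<delta> t - pt r) / v = of_real t"
proof -
  obtain \<epsilon> where "0 < \<epsilon>" "\<forall>t\<in>{0..\<epsilon>}. \<delta> t = pt r + v * of_real t"
    using assms by (auto simp: tangential_path_def)
  then show ?thesis
    using assms by (auto simp: tangential_path_def eventually_at_right_field intro!: exI[of _ \<epsilon>])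
qed

context ncs_quotient
begin

lemma tangential_weak_solution:
  assumes "tangential_solution pt (\<lambda>k. q (x k)) r v \<delta> T \<Psi>"
  shows "weak_solution (\<lambda>t. log_form pt x (\<delta> t) (vector_derivative \<delta> (at t within {0..T}))) {0<..T} \<Psi>"
  using assms by (intro weak_solutionI) (simp add: tangential_solution_def log_form_q)

lemma eventually_at_right_interval: "0 < (T::real) \<Longrightarrow> \<forall>\<^sub>F t in at_right 0. t \<in> {0<..T}"
  by (auto simp: eventually_at_right_field intro!: exI[of _ T])

text \<open>The analytic factors agree at 0, so their difference is logarithmically negligible; it
  stays so after multiplication by the common power, and a solution with this behaviour at 0
  vanishes.\<close>

lemma tangential_solution_unique:
  assumes path: "tangential_path pt r v \<delta> \<delta>' T"
    and x: "\<And>k. linear_form (x k)" "x r = letter a"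
    and \<Psi>: "tangential_solution pt (\<lambda>k. q (x k)) r v \<delta> T \<Psi>"
    and \<Phi>: "tangential_solution pt (\<lambda>k. q (x k)) r v \<delta> T \<Phi>"
    and t: "t \<in> {0<..T}"
  shows "\<Psi> t = \<Phi> t"
proof -
  obtain f \<rho> where f: "0 < \<rho>" "analytic_disc \<rho> f" "f 0 = 1"
      "\<forall>\<^sub>F t in at_right 0. \<Psi> t = f ((\<delta> t - pt r) / v) * monodromy_power ((\<delta> t - pt r) / v) (q (x r))"
    using \<Psi> unfolding tangential_solution_def by blast
  obtain g \<rho>' where g: "0 < \<rho>'" "analytic_disc \<rho>' g" "g 0 = 1"
      "\<forall>\<^sub>F t in at_right 0. \<Phi> t = g ((\<delta> t - pt r) / v) * monodromy_power ((\<delta> t - pt r) / v) (q (x r))"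
    using \<Phi> unfolding tangential_solution_def by blast
  have "log_negligible (\<lambda>t. f (of_real t) - g (of_real t))"
  proof (rule log_negligibleI)
    fix N \<phi> assume \<phi>: "dual N \<phi>"
    obtain D E where "((\<lambda>t. \<phi> (f (of_real t))) has_vector_derivative D) (at 0 within {0<..})"
        "((\<lambda>t. \<phi> (g (of_real t))) has_vector_derivative E) (at 0 within {0<..})"
      using analytic_disc_dual_deriv[OF \<phi> f(1,2)] analytic_disc_dual_deriv[OF \<phi> g(1,2)] by metis
    then show "\<exists>D. ((\<lambda>t. \<phi> (f (of_real t) - g (of_real t))) has_vector_derivative
        D) (at 0 within {0<..})"
      by (auto simp: dual_diff[OF \<phi>] intro: has_vector_derivative_diff)
  qed (simp add: f g)
  from log_negligible_mult_power[OF this zero_less_one, of a]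
  have "log_negligible (\<lambda>t. \<Psi> t - \<Phi> t)"
  proof (rule log_negligible_cong)
    show "\<forall>\<^sub>F t in at_right 0. (f (of_real t) - g (of_real t)) * monodromy_power (of_real (1 * t))
        (q (letter a)) = \<Psi> t - \<Phi> t"
      using f(4) g(4) tangential_path_start[OF path]
      by eventually_elim (simp add: x(2) left_diff_distrib)
  qed
  then have "\<Psi> t - \<Phi> t = 0"
    using path t linear_form_log_form[OF x(1)]
    by (intro weak_solution_vanish[OF weak_solution_diff[OF tangential_weak_solution[OF \<Psi>]
        tangential_weak_solution[OF \<Phi>]]
          _ _ eventually_at_right_interval[of T] _ log_negligible_tendsto])
       (auto simp: tangential_path_def trivial_limit_at_right_real)
  then show ?thesis by simp
qed

text \<open>Evaluates the definite description. One solution in the free algebra thereby computes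
  the holonomies in both quotients.\<close>

lemma Hol_reg_q:
  assumes path: "tangential_path pt r v \<delta> \<delta>' T"
    and x: "\<And>k. linear_form (x k)" "x r = letter a"
    and \<Psi>: "tangential_solution pt x r v \<delta> T \<Psi>"
  shows "Hol_reg pt (\<lambda>k. q (x k)) r v \<delta> T = q (\<Psi> T)"
  unfolding Hol_reg_def
proof (rule the_equality)
  note \<Psi>q = tangential_solution_q[OF \<Psi> x(2)]
  then show "\<exists>\<Psi>'. tangential_solution pt (\<lambda>k. q (x k)) r v \<delta> T \<Psi>' \<and> q (\<Psi> T) = \<Psi>' T" by blast
  fix H assume "\<exists>\<Psi>. tangential_solution pt (\<lambda>k. q (x k)) r v \<delta> T \<Psi> \<and> H = \<Psi> T"
  then show "H = q (\<Psi> T)"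
    using tangential_solution_unique[OF path x _ \<Psi>q, of _ T] path by (auto simp: tangential_path_def)
qed

end

text \<open>Near its start the path is the real axis in the coordinate
  \<open>(\<delta> t - pt r) / v\<close>. There the Euler equation provides a local solution, which
  is then continued along the path as a solution of an ordinary linear equation.\<close>

lemma tangential_solution_exists:
  fixes pt :: "'n::finite \<Rightarrow> complex" and x :: "'n \<Rightarrow> 'g ncs"
  assumes path: "tangential_path pt r v \<delta> \<delta>' T"
    and x: "\<And>k. linear_form (x k)" "x r = letter a"
  obtains \<Psi> where "tangential_solution pt x r v \<delta> T \<Psi>"
proof -
  define d where "d = 2 * of_real pi * \<i>"
  have T: "0 < T" and v: "v \<noteq> 0" and inj: "inj pt"
    and \<delta>': "\<And>t. t \<in> {0..T} \<Longrightarrow> (\<delta> has_vector_derivative \<delta>' t) (at t within {0..T})"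
    and cont': "continuous_on {0..T} \<delta>'" and avoid: "\<And>t. t \<in> {0<..T} \<Longrightarrow> \<delta> t \<notin> range pt"
    using path by (auto simp: tangential_path_def)
  obtain \<epsilon> where \<epsilon>: "0 < \<epsilon>" "\<And>t. t \<in> {0..\<epsilon>} \<Longrightarrow> \<delta> t = pt r + v * of_real t"
    using path by (auto simp: tangential_path_def)
  have vd: "vector_derivative \<delta> (at t within {0..T}) = \<delta>' t" if "t \<in> {0..T}" for t
    using \<delta>'[OF that] T that vector_derivative_within_cbox[of 0 T t \<delta> "\<delta>' t"] by auto
  \<comment> \<open>In the rescaled coordinate z one has \<delta> - pt k = v (c k + z).\<close>
  define c where "c = (\<lambda>k. (pt r - pt k) / v)"
  have c: "c k \<noteq> 0" if "k \<noteq> r" for k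
    using that inj v by (auto simp: c_def inj_def)
  obtain \<rho>0 where \<rho>0: "0 < \<rho>0" "\<And>k. k \<in> UNIV - {r} \<Longrightarrow> \<rho>0 \<le> norm (c k)"
    using finite_lower_bound[of "UNIV - {r}" "\<lambda>k. norm (c k)"] c by auto
  \<comment> \<open>Halved to meet the radius condition of \<open>bipower_geometric\<close>.\<close>
  define \<rho> where "\<rho> = \<rho>0 / 2"
  have \<rho>: "0 < \<rho>" "\<And>k. k \<in> UNIV - {r} \<Longrightarrow> 2 * \<rho> \<le> norm (c k)"
    using \<rho>0 by (auto simp: \<rho>_def)
  \<comment> \<open>The connection in the rescaled coordinate, multiplied by z; its value at 0 is
    the residue. The dummy variable y adapts it to the lemma in two variables.\<close>
  define \<Omega> where "\<Omega> = (\<lambda>z y. (1 / d) *\<^sub>C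
      (x r + (\<Sum>k\<in>UNIV - {r}. (z * (1 / (c k + 1 * z + 0 * y))) *\<^sub>C x k)))"
  have lin\<Omega>: "linear_form (\<Omega> z y)" for z y
    unfolding \<Omega>_def by (intro linear_form_simps x)
  have an\<Omega>: "ncs_bianalytic \<rho> \<Omega>"
    unfolding \<Omega>_def using c \<rho>
    by (intro ncs_bianalytic_simps ncs_bianalytic_sum bianalytic_simps bianalytic_inverse_affine) auto
  obtain f where
    f: "ncs_bianalytic \<rho> f" "f 0 0 = 1" "\<And>z y. norm z < \<rho> \<Longrightarrow> norm y < \<rho> \<Longrightarrow>
       z *\<^sub>C ncs_partial1 f z y + y *\<^sub>C ncs_partial2 f z y = \<Omega> z y * f z y - f z y * \<Omega> 0 0"
    by (rule euler_equation_solution[OF \<rho>(1) an\<Omega> lin\<Omega>]) rule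
  define P where "P = (\<lambda>t. letter_exp a (of_real (ln t) / d))"
  define \<Psi>0 where "\<Psi>0 = (\<lambda>t. f (of_real t * 1) (of_real t * 0) * P t)"
  \<comment> \<open>Freezing the path at \<open>T\<close> extends the equation to the half line, so
    that \<open>T\<close> becomes an interior point and the equation can be solved up to and
    including \<open>T\<close>.\<close>
  define A where "A = (\<lambda>t. log_form pt x (\<delta> (min t T)) (\<delta>' (min t T)))"
  define b where "b = Min {\<epsilon>, \<rho>, T}"
  have b: "0 < b" "b \<le> \<epsilon>" "b \<le> \<rho>" "b \<le> T" using \<epsilon> \<rho> T by (auto simp: b_def)
  have \<Psi>0': "has_real_deriv \<Psi>0 (A t * \<Psi>0 t) t S" if t: "0 < t" "t < b" for t S
  proof -
    let ?t = "of_real t :: complex"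
    have n: "norm ?t < \<rho>" using t b by simp
    have 1: "has_real_deriv (\<lambda>s. f (of_real s * 1) (of_real s * 0)) (ncs_partial1 f ?t 0) t S"
      using ncs_bianalytic_has_real_deriv[OF f(1), of t 1 0 S] n \<rho> by (simp add: scaleC_one)
    have "(ln has_vector_derivative 1 / t) (at t within S)"
      using DERIV_ln_divide[OF t(1)]
          by (simp add: has_real_derivative_iff_has_vector_derivative has_vector_derivative_at_within)
    from bounded_linear.has_vector_derivative[OF bounded_linear_compose[OF bounded_linear_divide
        bounded_linear_of_real] this]
    have "((\<lambda>t. of_real (ln t) / d) has_vector_derivative (of_real (1 / t) / d)) (at t within S)" .
    from letter_exp_has_real_deriv[OF this, of a]
    have 2: "has_real_deriv P ((of_real (1 / t) / d) *\<^sub>C (letter a * P t)) t S"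
      by (simp add: P_def)
    have D: "has_real_deriv \<Psi>0 (ncs_partial1 f ?t 0 * P t + f ?t 0 *
        ((of_real (1 / t) / d) *\<^sub>C (letter a * P t))) t S"
      using has_real_deriv_ncs_mult[OF 1 2] by (simp add: \<Psi>0_def)
    \<comment> \<open>On the slice the Euler equation reads t f' = \<Omega> f - f \<Omega>(0,0); its
      last term cancels against the derivative of the power.\<close>
    have "ncs_partial1 f ?t 0 = (1 / ?t) *\<^sub>C (?t *\<^sub>C ncs_partial1 f ?t 0)"
      using t by (simp add: scaleC_scaleC scaleC_one)
    also have "\<dots> = (1 / ?t) *\<^sub>C (\<Omega> ?t 0 * f ?t 0 - f ?t 0 * \<Omega> 0 0)"
      using f(3)[OF n, of 0] \<rho> by simp
    also have "\<Omega> 0 0 = (1 / d) *\<^sub>C letter a"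
      by (simp add: \<Omega>_def x(2))
    finally have "ncs_partial1 f ?t 0 * P t + f ?t 0 * ((of_real (1 / t) / d) *\<^sub>C (letter a * P t)) =
        ((1 / ?t) *\<^sub>C \<Omega> ?t 0) * \<Psi>0 t"
      by (simp add: \<Psi>0_def scaleC_diff_right left_diff_distrib mult_scaleC_left mult_scaleC_right
          scaleC_scaleC mult.assoc)
    also have "(1 / ?t) *\<^sub>C \<Omega> ?t 0 = A t"
    proof -
      have \<delta>t: "\<delta> t = pt r + v * ?t" using \<epsilon> t b by simp
      have "(\<delta> has_vector_derivative v) (at t)"
      proof (rule has_vector_derivative_transform_within_open[where S = "{0<..<b}"])
        show "((\<lambda>s. pt r + v * of_real s) has_vector_derivative v) (at t)"
          by (auto intro!: derivative_eq_intros)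
      qed (use t b \<epsilon> in auto)
      moreover have "(\<delta> has_vector_derivative \<delta>' t) (at t)"
        using \<delta>'[of t] t b at_within_Icc_at[of 0 t T] by simp
      ultimately have \<delta>'t: "\<delta>' t = v" using vector_derivative_unique_at by blast
      have "(\<Sum>k\<in>UNIV. (v / (\<delta> t - pt k)) *\<^sub>C x k) =
          (v / (\<delta> t - pt r)) *\<^sub>C x r + (\<Sum>k\<in>UNIV - {r}. (v / (\<delta> t - pt k)) *\<^sub>C x k)"
        by (rule sum.remove) auto
      also have "v / (\<delta> t - pt r) = 1 / ?t" using v t by (simp add: \<delta>t)
      also have "(\<Sum>k\<in>UNIV - {r}. (v / (\<delta> t - pt k)) *\<^sub>C x k) =
          (\<Sum>k\<in>UNIV - {r}. (1 / ?t) *\<^sub>C ((?t * (1 / (c k + 1 * ?t + 0 * 0))) *\<^sub>C x k))"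
      proof (rule sum.cong[OF refl])
        fix k assume "k \<in> UNIV - {r}"
        have "\<delta> t - pt k = v * (c k + ?t)" using v by (simp add: \<delta>t c_def field_simps)
        then have "v / (\<delta> t - pt k) = 1 / (c k + ?t)" using v by simp
        then show "(v / (\<delta> t - pt k)) *\<^sub>C x k = (1 / ?t) *\<^sub>C ((?t * (1 / (c k + 1 * ?t + 0 * 0))) *\<^sub>C x k)"
          using t by (simp add: scaleC_scaleC)
      qed
      finally have "(\<Sum>k\<in>UNIV. (v / (\<delta> t - pt k)) *\<^sub>C x k) =
          (1 / ?t) *\<^sub>C (x r + (\<Sum>k\<in>UNIV - {r}. (?t * (1 / (c k + 1 * ?t + 0 * 0))) *\<^sub>C x k))"
        by (simp add: scaleC_add_right scaleC_sum_right)
      then show ?thesis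
        using t b by (simp add: A_def \<delta>'t log_form_def \<Omega>_def d_def scaleC_scaleC mult_ac)
    qed
    finally show ?thesis using D by simp
  qed
  have linA: "linear_form (A t)" for t
    unfolding A_def by (intro linear_form_log_form x)
  have contA: "isCont (\<lambda>t. ncs_coeff (A t) w) t" if "0 < t" for t w
  proof -
    have "continuous_on {0..T} \<delta>"
      unfolding continuous_on_eq_continuous_within
      by (intro ballI has_vector_derivative_continuous[OF \<delta>'])
    then have "continuous_on {0<..} (\<lambda>t. \<delta> (min t T))" "continuous_on {0<..} (\<lambda>t. \<delta>' (min t T))"
      using cont' T by (auto intro!: continuous_on_compose2[of "{0..T}"] continuous_intros)
    moreover have "\<delta> (min t T) - pt k \<noteq> 0" if "t \<in> {0<..}" for t k
      using avoid[of "min t T"] that T by (auto simp: image_iff)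
    ultimately have "continuous_on {0<..} (\<lambda>t. ncs_coeff (A t) w)"
      unfolding A_def log_form_def coeff_simps coeff_sum by (intro continuous_intros) auto
    then show ?thesis using that by (simp add: continuous_on_eq_continuous_at)
  qed
  have b2: "ereal 0 < ereal (b / 2)" "ereal (b / 2) < \<infinity>" using b by auto
  obtain \<Psi> where \<Psi>: "\<Psi> (b / 2) = \<Psi>0 (b / 2)"
      "\<And>t S. ereal 0 < ereal t \<Longrightarrow> ereal t < \<infinity> \<Longrightarrow> has_real_deriv \<Psi> (A t * \<Psi> t) t S"
  proof (rule linear_equation_solution[where a = "ereal 0" and b = \<infinity> and \<Omega> = A
      and ?\<Psi>1.0 = "\<Psi>0 (b / 2)", OF _ linA b2])
    show "isCont (\<lambda>t. ncs_coeff (A t) w) t" if "ereal 0 < ereal t" for t w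
      using contA that by simp
  qed (use that in auto)
  \<comment> \<open>The continued solution takes the value of the local one at \<open>b / 2\<close>,
    hence agrees with it on the whole overlap.\<close>
  have eq: "\<Psi> t = \<Psi>0 t" if "t \<in> {0<..<b}" for t
    by (rule ncs_id.weak_solution_unique[where \<Omega> = A and S = "{0<..<b}" and ?t1.0 = "b / 2"])
      (use \<Psi> \<Psi>0' b that linA in \<open>auto intro!: ncs_id.weak_solutionI\<close>)
  have "tangential_solution pt x r v \<delta> T \<Psi>"
    unfolding tangential_solution_def
  proof (intro conjI ballI exI[of _ "\<lambda>z. f z 0"] exI[of _ \<rho>])
    fix t assume t: "t \<in> {0<..T}"
    then have "has_real_deriv \<Psi> (A t * \<Psi> t) t {0<..T}" using \<Psi>(2)[of t] by simp
    then show "has_real_deriv \<Psi> (log_form pt x (\<delta> t) (vector_derivative \<delta> (at t within {0..T})) *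
        \<Psi> t) t {0<..T}"
      using vd t by (simp add: A_def)
  next
    have "\<forall>\<^sub>F t in at_right 0. t \<in> {0<..<b}"
      using b by (auto simp: eventually_at_right_field)
    then show "\<forall>\<^sub>F t in at_right 0. \<Psi> t =
        f ((\<delta> t - pt r) / v) 0 * monodromy_power ((\<delta> t - pt r) / v) (x r)"
      using tangential_path_start[OF path]
    proof eventually_elim
      case (elim t)
      then show ?case
        using eq[of t] by (simp add: \<Psi>0_def P_def x(2) ncs_id.monodromy_power_letter Ln_of_real d_def)
    qed
  qed (use f \<rho> in \<open>auto intro: ncs_bianalytic_analytic_disc\<close>)
  then show ?thesis by (rule that)
qed

section \<open>Local solutions of the Drinfeld--Kohno system\<close>

interpretation dk: ncs_quotient "abs_dk :: 'n gen ncs \<Rightarrow> 'n dk"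
  by (rule ncs_quotient_dk)

interpretation dkq: ncs_quotient "abs_dkq :: 'n gen ncs \<Rightarrow> 'n dkq"
  by (rule ncs_quotient_dkq)

section \<open>Generators and their commutation relations\<close>

lemma free_t_letter: "free_t a b = letter (Abs_gen {a, b})"
  by (intro ncs_eqI) (simp add: free_t.rep_eq coeff_letter)

lemma free_t_commute: "free_t a b = free_t b a"
  by (simp add: free_t_letter insert_commute)

lemma tt_abs: "tt a b = abs_dk (free_t a b)"
  by (simp add: tt.abs_eq)

lemma tt_commute: "tt a b = tt b a"
  by (simp add: tt_abs free_t_commute)

lemma closed_ideal_superset: "R \<subseteq> closed_ideal R"
  by (auto simp: closed_ideal_def)

lemma dk_relator_zero: "r \<in> dk_relators \<Longrightarrow> abs_dk r = 0"
  using closed_ideal_superset by (auto simp: zero_dk_def dk.abs_eq_iff)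

lemma tt_disjoint_commute:
  assumes "distinct [a, b, c, d]"
  shows "tt a b * tt c d = tt c d * tt a b"
proof -
  have "commutator (free_t a b) (free_t c d) \<in> dk_relators"
    using assms by (auto simp: dk_relators_def)
  from dk_relator_zero[OF this] show ?thesis
    by (simp add: commutator_def dk.q_simps tt_abs)
qed

lemma tt_triangle_commute:
  assumes "distinct [a, b, c]"
  shows "(tt a b + tt a c) * tt b c = tt b c * (tt a b + tt a c)"
proof -
  have "commutator (free_t a b + free_t a c) (free_t b c) \<in> dk_relators"
    unfolding dk_relators_def by (rule UnI2) (use assms in blast)
  from dk_relator_zero[OF this] show ?thesis
    by (simp add: commutator_def dk.q_simps tt_abs)
qed

text \<open>Two triangle relations on the strands k, z, w. Up to sign the three generators of the
  triangle have a single bracket, which is what lets a scalar identity imply flatness.\<close>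

lemma tt_brackets:
  fixes k :: 'n
  defines "B \<equiv> commutator (tt (Pt k) Zs) (tt (Pt k) Ws)"
  shows "commutator (tt (Pt k) Zs) (tt Zs Ws) = - B" "commutator (tt Zs Ws) (tt (Pt k) Ws) = - B"
proof -
  have "(tt Ws Zs + tt Ws (Pt k)) * tt Zs (Pt k) = tt Zs (Pt k) * (tt Ws Zs + tt Ws (Pt k))"
    "(tt Zs (Pt k) + tt Zs Ws) * tt (Pt k) Ws = tt (Pt k) Ws * (tt Zs (Pt k) + tt Zs Ws)"
    by (rule tt_triangle_commute, simp)+
  then show "commutator (tt (Pt k) Zs) (tt Zs Ws) = - B" "commutator (tt Zs Ws) (tt (Pt k) Ws) = - B"
    unfolding tt_commute[of Ws Zs] tt_commute[of Ws "Pt k"] tt_commute[of Zs "Pt k"]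
    by (simp_all add: B_def commutator_def algebra_simps eq_neg_iff_add_eq_0)
qed

lemma commutator_sum_left: "commutator (\<Sum>k\<in>A. f k) y = (\<Sum>k\<in>A. commutator (f k) y)"
  by (simp add: commutator_def sum_distrib_left sum_distrib_right sum_subtractf)

lemma commutator_sum_right: "commutator x (\<Sum>k\<in>A. f k) = (\<Sum>k\<in>A. commutator x (f k))"
  by (simp add: commutator_def sum_distrib_left sum_distrib_right sum_subtractf)

lemma commutator_scaleC:
  "commutator (c *\<^sub>C x) y = c *\<^sub>C commutator x (y :: 'a::complex_algebra_topology)"
  "commutator x (c *\<^sub>C y) = c *\<^sub>C commutator x (y :: 'a::complex_algebra_topology)"
  by (simp_all add: commutator_def mult_scaleC_left mult_scaleC_right scaleC_diff_right)

lemma commutator_add: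
  "commutator (x + x') y = commutator x y + commutator x' y"
  "commutator x (y + y') = commutator x y + commutator x y'"
  by (simp_all add: commutator_def algebra_simps)

text \<open>The Arnold relation between the coefficients, e.g. \<open>\<alpha>\<^sub>k = 1/(z - z\<^sub>k)\<close>,
  \<open>\<beta>\<^sub>k = 1/(w - z\<^sub>k)\<close>, \<open>\<gamma> = 1/(z - w) = - \<delta>\<close>.\<close>

lemma arnold_commute:
  fixes \<alpha> \<beta> :: "'n::finite \<Rightarrow> complex"
  assumes "\<And>k. \<alpha> k * \<beta> k = \<alpha> k * \<delta> + \<gamma> * \<beta> k"
  shows "commutator ((\<Sum>k\<in>UNIV. \<alpha> k *\<^sub>C tt (Pt k) Zs) + \<gamma> *\<^sub>C tt Zs Ws)
      ((\<Sum>k\<in>UNIV. \<beta> k *\<^sub>C tt (Pt k) Ws) + \<delta> *\<^sub>C tt Zs Ws) = 0"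
proof -
  define B where "B = (\<lambda>k :: 'n. commutator (tt (Pt k) Zs) (tt (Pt k) Ws))"
  \<comment> \<open>Disjoint pairs of strands commute, so the double sum collapses to its
    diagonal.\<close>
  have diag: "commutator (tt (Pt k) Zs) (tt (Pt l) Ws) = (if l = k then B k else 0)" for k l :: 'n
    using tt_disjoint_commute[of "Pt k" Zs "Pt l" Ws] by (auto simp: B_def commutator_def)
  have "commutator (\<Sum>k\<in>UNIV. \<alpha> k *\<^sub>C tt (Pt k) Zs) (\<Sum>k\<in>UNIV. \<beta> k *\<^sub>C tt (Pt k) Ws) =
      (\<Sum>k\<in>UNIV. \<alpha> k *\<^sub>C \<beta> k *\<^sub>C B k)"
    by (simp add: commutator_sum_left) (simp add: commutator_sum_right commutator_scaleC diag
        if_distrib[of "scaleC _"] sum.delta scaleC_scaleC mult.commute cong: if_cong)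
  also have "\<dots> = (\<Sum>k\<in>UNIV. (\<alpha> k * \<delta>) *\<^sub>C B k) + (\<Sum>k\<in>UNIV. (\<gamma> * \<beta> k) *\<^sub>C B k)"
    by (simp add: scaleC_scaleC assms scaleC_add_left sum.distrib)
  finally have 1: "commutator (\<Sum>k\<in>UNIV. \<alpha> k *\<^sub>C tt (Pt k) Zs) (\<Sum>k\<in>UNIV. \<beta> k *\<^sub>C tt (Pt k) Ws) =
      (\<Sum>k\<in>UNIV. (\<alpha> k * \<delta>) *\<^sub>C B k) + (\<Sum>k\<in>UNIV. (\<gamma> * \<beta> k) *\<^sub>C B k)" .
  have 2: "commutator (\<Sum>k\<in>UNIV. \<alpha> k *\<^sub>C tt (Pt k) Zs) (\<delta> *\<^sub>C tt Zs Ws) = - (\<Sum>k\<in>UNIV. (\<alpha> k * \<delta>) *\<^sub>C B k)"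
    by (simp only: commutator_sum_left commutator_scaleC tt_brackets scaleC_minus_right sum_negf
        scaleC_sum_right scaleC_scaleC B_def mult.commute)
  have 3: "commutator (\<gamma> *\<^sub>C tt Zs Ws) (\<Sum>k\<in>UNIV. \<beta> k *\<^sub>C tt (Pt k) Ws) = - (\<Sum>k\<in>UNIV. (\<gamma> * \<beta> k) *\<^sub>C B k)"
    by (simp only: commutator_sum_right commutator_scaleC tt_brackets scaleC_minus_right sum_negf
        scaleC_scaleC B_def mult.commute)
  have 4: "commutator (\<gamma> *\<^sub>C tt Zs Ws :: 'n dk) (\<delta> *\<^sub>C tt Zs Ws) = 0"
    by (simp add: commutator_scaleC) (simp add: commutator_def)
  show ?thesis by (simp add: commutator_add 1 2 3 4)
qed

section \<open>The lifted connection and its local solutions in two variables\<close>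

definition A_free :: "('n::finite \<Rightarrow> complex) \<Rightarrow> complex \<Rightarrow> complex \<Rightarrow> complex \<Rightarrow> complex \<Rightarrow> 'n gen ncs" where
  "A_free pt z w dz dw = (1 / (2 * of_real pi * \<i>)) *\<^sub>C
     ((\<Sum>k\<in>UNIV. (dz / (z - pt k)) *\<^sub>C free_t (Pt k) Zs + (dw / (w - pt k)) *\<^sub>C free_t (Pt k) Ws)
      + ((dz - dw) / (z - w)) *\<^sub>C free_t Zs Ws)"

lemma A_zw_abs: "A_zw pt z w dz dw = abs_dk (A_free pt z w dz dw)"
  by (simp add: A_zw_def A_free_def dk.q_simps tt_abs)

lemma linear_form_A_free: "linear_form (A_free pt z w dz dw)"
  unfolding A_free_def by (intro linear_form_simps linear_form_free_t)

lemma ncs_partial_sum: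
  assumes "\<And>k. k \<in> A \<Longrightarrow> ncs_bianalytic r (u k)" "norm x < r" "norm y < r"
  shows "ncs_partial1 (\<lambda>x y. \<Sum>k\<in>A. u k x y) x y = (\<Sum>k\<in>A. ncs_partial1 (u k) x y)"
    "ncs_partial2 (\<lambda>x y. \<Sum>k\<in>A. u k x y) x y = (\<Sum>k\<in>A. ncs_partial2 (u k) x y)"
  by (intro ncs_eqI; simp, subst partial_sum[OF _ assms(2,3)];
      use assms(1) in \<open>simp add: ncs_bianalytic_def\<close>)+

lemma ncs_partial_scaleC_const:
  assumes "bianalytic r g" "norm x < r" "norm y < r"
  shows "ncs_partial1 (\<lambda>x y. g x y *\<^sub>C c) x y = partial1 g x y *\<^sub>C c"
    "ncs_partial2 (\<lambda>x y. g x y *\<^sub>C c) x y = partial2 g x y *\<^sub>C c"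
  using ncs_partial_scaleC[OF assms(1) ncs_bianalytic_simps(1) assms(2,3)]
  by (simp_all add: ncs_partial_const)

lemma affine_nonzero:
  fixes c :: complex
  assumes "2 * r \<le> norm c" "norm \<alpha> \<le> 1" "norm \<beta> \<le> 1" "norm x < r" "norm y < r"
  shows "c + \<alpha> * x + \<beta> * y \<noteq> 0"
proof
  assume "c + \<alpha> * x + \<beta> * y = 0"
  then have "c = - (\<alpha> * x + \<beta> * y)" by (simp add: algebra_simps eq_neg_iff_add_eq_0)
  then have "norm c = norm (\<alpha> * x + \<beta> * y)" by (simp only: norm_minus_cancel)
  then have "norm c \<le> norm \<alpha> * norm x + norm \<beta> * norm y"
    using norm_triangle_ineq[of "\<alpha> * x" "\<beta> * y"] by (simp only: norm_mult)
  moreover have "norm \<alpha> * norm x \<le> norm x" "norm \<beta> * norm y \<le> norm y"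
    using assms(2,3) by (auto intro: mult_left_le_one_le)
  ultimately show False using assms by linarith
qed

lemma (in ncs_quotient) local_solution_deriv:
  fixes f :: "complex \<Rightarrow> complex \<Rightarrow> 'g ncs"
  assumes an: "ncs_bianalytic r f" "norm x < r" "norm y < r"
    and comm: "q (letter a1) * q (letter a2) = q (letter a2) * q (letter a1)"
    and d1: "q (ncs_partial1 f x y) = q (\<omega>1 * f x y - f x y * (\<mu>1 *\<^sub>C letter a1))"
    and d2: "q (ncs_partial2 f x y) = q (\<omega>2 * f x y - f x y * (\<mu>2 *\<^sub>C letter a2))"
    and L1: "(L1 has_field_derivative dx * \<mu>1) (at 0)"
    and L2: "(L2 has_field_derivative dy * \<mu>2) (at 0)"
  shows "has_complex_deriv (\<lambda>h. q (f (x + h * dx) (y + h * dy)) * q (letter_exp a1 (L1 h)) * q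
      (letter_exp a2 (L2 h)))
     (q (dx *\<^sub>C \<omega>1 + dy *\<^sub>C \<omega>2) * (q (f x y) * q (letter_exp a1 (L1 0)) * q (letter_exp a2 (L2 0)))) 0"
proof -
  let ?P1 = "letter_exp a1 (L1 0)" and ?P2 = "letter_exp a2 (L2 0)"
  let ?F = "f x y"
  define D where "D = ((dx *\<^sub>C ncs_partial1 f x y + dy *\<^sub>C ncs_partial2 f x y) * ?P1 +
      ?F * ((dx * \<mu>1) *\<^sub>C (letter a1 * ?P1))) * ?P2 + ?F * ?P1 * ((dy * \<mu>2) *\<^sub>C (letter a2 * ?P2))"
  have "has_complex_deriv (\<lambda>h. f (x + h * dx) (y + h * dy) * letter_exp a1 (L1 h) * letter_exp a2
      (L2 h)) D 0"
    using has_complex_deriv_ncs_mult[OF has_complex_deriv_ncs_mult[OF ncs_bianalytic_has_deriv[OF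
        an, of dx dy]
      letter_exp_has_complex_deriv[OF L1, of a1]] letter_exp_has_complex_deriv[OF L2, of a2]]
    by (simp add: D_def)
  from has_complex_deriv_q[OF this]
  have "has_complex_deriv (\<lambda>h. q (f (x + h * dx) (y + h * dy)) * q (letter_exp a1 (L1 h)) * q
      (letter_exp a2 (L2 h))) (q D) 0"
    by (simp add: q_mult)
  moreover have "q D = q (dx *\<^sub>C \<omega>1 + dy *\<^sub>C \<omega>2) * (q ?F * q ?P1 * q ?P2)"
  proof -
    have P1: "q ?P1 * (q (letter a2) * X) = q (letter a2) * (q ?P1 * X)" for X
      using commute_letter_exp[OF comm[symmetric], of "L1 0"] by (metis mult.assoc)
    show ?thesis
      by (simp add: D_def q_simps d1 d2 distrib_left distrib_right left_diff_distrib right_diff_distrib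
          mult_scaleC_left mult_scaleC_right scaleC_add_right scaleC_diff_right scaleC_scaleC
              mult.assoc P1)
  qed
  ultimately show ?thesis by simp
qed

abbreviation (input) two_pi_i :: complex where "two_pi_i \<equiv> 2 * of_real pi * \<i>"

lemma partial_inverse_affine:
  assumes "c + \<alpha> * x + \<beta> * y \<noteq> 0"
  shows "partial1 (\<lambda>x y. 1 / (c + \<alpha> * x + \<beta> * y)) x y = - \<alpha> / (c + \<alpha> * x + \<beta> * y) ^ 2"
    "partial2 (\<lambda>x y. 1 / (c + \<alpha> * x + \<beta> * y)) x y = - \<beta> / (c + \<alpha> * x + \<beta> * y) ^ 2"
  unfolding partial1_def partial2_def
  using assms by (auto intro!: DERIV_imp_deriv derivative_eq_intros simp: power2_eq_square)

text \<open>In the coordinates x = z - pt i, y = w - pt j the singular divisors through the origin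
  are the two axes. As i and j differ, z - w stays away from 0, so x and y times the respective
  components of the connection are analytic.\<close>

lemma start_solution_exists:
  fixes pt :: "'n::finite \<Rightarrow> complex"
  assumes inj: "inj pt" and ij: "i \<noteq> j" and vi: "vi \<noteq> 0" and vj: "vj \<noteq> 0"
  obtains f \<rho> F where "0 < \<rho>" "analytic_bidisc \<rho> f" "f 0 0 = 1"
    "F = (\<lambda>z w. f (z - pt i) (w - pt j) *
               monodromy_power ((z - pt i) / vi) (tt (Pt i) Zs) *
               monodromy_power ((w - pt j) / vj) (tt (Pt j) Ws))"
    "\<And>z w. norm (z - pt i) < \<rho> \<Longrightarrow> norm (w - pt j) < \<rho> \<Longrightarrow>
           (z - pt i) / vi \<notin> \<real>\<^sub>\<le>\<^sub>0 \<Longrightarrow> (w - pt j) / vj \<notin> \<real>\<^sub>\<le>\<^sub>0 \<Longrightarrow> solves_at pt F z w"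
proof -
  have ne: "pt k - pt l \<noteq> 0" if "k \<noteq> l" for k l using inj that by (auto simp: inj_def)
  obtain \<rho>0 where \<rho>0: "0 < \<rho>0" "\<And>p. p \<in> {(k, l). k \<noteq> l} \<Longrightarrow> \<rho>0 \<le> norm (case p of (k, l) \<Rightarrow> pt k - pt l)"
    by (rule finite_lower_bound[of "{(k, l). k \<noteq> l}" "\<lambda>p. norm (case p of (k, l) \<Rightarrow> pt k - pt l)"])
      (use ne in auto)
  \<comment> \<open>Half the least distance between marked points: on this bidisc every affine
    denominator, including z - w, is invertible.\<close>
  define \<rho> where "\<rho> = \<rho>0 / 2"
  have \<rho>: "0 < \<rho>" "\<And>k l. k \<noteq> l \<Longrightarrow> 2 * \<rho> \<le> norm (pt k - pt l)"
    using \<rho>0 by (auto simp: \<rho>_def)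
  define K where "K = (\<lambda>c \<alpha> \<beta> x y :: complex. 1 / (c + \<alpha> * x + \<beta> * y))"
  have anK: "bianalytic \<rho> (K (pt k - pt l) \<alpha> \<beta>)" if "k \<noteq> l" "norm \<alpha> \<le> 1" "norm \<beta> \<le> 1" for k l \<alpha> \<beta>
    unfolding K_def using \<rho> ne that by (intro bianalytic_inverse_affine) auto
  \<comment> \<open>\<open>al k\<close> is x / (z - pt k) and \<open>be k\<close> is y / (w - pt k);
    at \<open>k = i\<close> and \<open>k = j\<close> respectively the pole cancels and leaves
    1.\<close>
  define al where "al = (\<lambda>k x y. if k = i then 1 else x * K (pt i - pt k) 1 0 x y)"
  define be where "be = (\<lambda>k x y. if k = j then 1 else y * K (pt j - pt k) 0 1 x y)"
  \<comment> \<open>\<open>ga\<close> is x / (z - w) and \<open>de\<close> is y / (w - z), the two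
    components of dlog(z - w) times the coordinates.\<close>
  define ga where "ga = (\<lambda>x y. x * K (pt i - pt j) 1 (- 1) x y)"
  define de where "de = (\<lambda>x y. (- 1) * (y * K (pt i - pt j) 1 (- 1) x y))"
  have an: "bianalytic \<rho> (al k)" "bianalytic \<rho> (be k)" "bianalytic \<rho> ga" "bianalytic \<rho> de" for k
  proof -
    show "bianalytic \<rho> (al k)"
      using bianalytic_simps(5)[OF bianalytic_simps(2) anK[of i k 1 0]] bianalytic_simps(1)
      by (cases "k = i") (simp_all add: al_def)
    show "bianalytic \<rho> (be k)"
      using bianalytic_simps(5)[OF bianalytic_simps(3) anK[of j k 0 1]] bianalytic_simps(1)
      by (cases "k = j") (simp_all add: be_def)
    have K: "bianalytic \<rho> (K (pt i - pt j) 1 (- 1))" using anK[OF ij] by simp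
    show "bianalytic \<rho> ga" "bianalytic \<rho> de"
      unfolding ga_def de_def by (intro bianalytic_simps K)+
  qed
  define \<Omega>1 where "\<Omega>1 = (\<lambda>x y. (1 / two_pi_i) *\<^sub>C ((\<Sum>k\<in>UNIV. al k x y *\<^sub>C free_t (Pt k) Zs) + ga x y
      *\<^sub>C free_t Zs Ws))"
  define \<Omega>2 where "\<Omega>2 = (\<lambda>x y. (1 / two_pi_i) *\<^sub>C ((\<Sum>k\<in>UNIV. be k x y *\<^sub>C free_t (Pt k) Ws) + de x y
      *\<^sub>C free_t Zs Ws))"
  note cl = ncs_bianalytic_simps ncs_bianalytic_sum bianalytic_simps an
  have an\<Omega>: "ncs_bianalytic \<rho> \<Omega>1" "ncs_bianalytic \<rho> \<Omega>2"
    unfolding \<Omega>1_def \<Omega>2_def by (intro cl)+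
  have lin: "linear_form (\<Omega>1 x y)" "linear_form (\<Omega>2 x y)" for x y
    unfolding \<Omega>1_def \<Omega>2_def by (intro linear_form_simps linear_form_free_t)+
  have "al k 0 0 = (if k = i then 1 else 0)" "be k 0 0 = (if k = j then 1 else 0)" "ga 0 0 = 0"
      "de 0 0 = 0" for k
    by (auto simp: al_def be_def ga_def de_def)
  then have \<Omega>0: "\<Omega>1 0 0 = (1 / two_pi_i) *\<^sub>C free_t (Pt i) Zs"
      "\<Omega>2 0 0 = (1 / two_pi_i) *\<^sub>C free_t (Pt j) Ws"
    by (simp_all add: \<Omega>1_def \<Omega>2_def if_distrib[of "\<lambda>c. c *\<^sub>C _"] scaleC_one sum.delta cong: if_cong)
  obtain f where f: "ncs_bianalytic \<rho> f" "f 0 0 = 1" "\<And>x y. ncs_coeff (f x y) [] = 1"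
      "\<And>x y. norm x < \<rho> \<Longrightarrow> norm y < \<rho> \<Longrightarrow> x *\<^sub>C ncs_partial1 f x y + y *\<^sub>C ncs_partial2 f x y =
        (\<Omega>1 x y + \<Omega>2 x y) * f x y - f x y * (\<Omega>1 0 0 + \<Omega>2 0 0)"
    by (rule euler_equation_solution[where \<Omega> = "\<lambda>x y. \<Omega>1 x y + \<Omega>2 x y", OF \<rho>(1)])
      (use an\<Omega> lin in \<open>auto intro: cl linear_form_simps\<close>)
  have nz: "pt k - pt l + \<alpha> * x + \<beta> * y \<noteq> 0"
    if "k \<noteq> l" "norm x < \<rho>" "norm y < \<rho>" "norm \<alpha> \<le> 1" "norm \<beta> \<le> 1" for k l x y \<alpha> \<beta>
    using affine_nonzero[OF \<rho>(2)] that by blast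
  have closed: "x *\<^sub>C ncs_partial1 \<Omega>2 x y = y *\<^sub>C ncs_partial2 \<Omega>1 x y"
    if xy: "norm x < \<rho>" "norm y < \<rho>" for x y
  proof -
    \<comment> \<open>\<open>al\<close> depends on x alone and \<open>be\<close> on y alone, so
      closedness concerns only the coefficient of \<open>t_zw\<close>.\<close>
    have "partial2 (al k) x y = 0" "partial1 (be k) x y = 0" for k
      by (cases "k = i"; cases "k = j"; simp add: partial1_def partial2_def al_def be_def K_def)+
    moreover have "x * partial1 de x y = y * partial2 ga x y"
    proof -
      define \<kappa> where "\<kappa> = K (pt i - pt j) 1 (- 1)"
      have an\<kappa>: "bianalytic \<rho> \<kappa>" using anK[OF ij] by (simp add: \<kappa>_def)
      have y\<kappa>: "bianalytic \<rho> (\<lambda>x y. y * \<kappa> x y)" by (intro bianalytic_simps an\<kappa>)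
      have "partial1 \<kappa> x y = - 1 / (pt i - pt j + 1 * x + (- 1) * y) ^ 2"
          "partial2 \<kappa> x y = - (- 1) / (pt i - pt j + 1 * x + (- 1) * y) ^ 2"
        using partial_inverse_affine[OF nz[OF ij xy, of 1 "- 1"]] unfolding \<kappa>_def K_def by simp_all
      moreover have "partial1 de x y = - (y * partial1 \<kappa> x y)"
        using partial_mult(1)[OF bianalytic_simps(1) y\<kappa> xy, of
            "- 1"] partial_mult(1)[OF bianalytic_simps(3) an\<kappa> xy]
        by (simp only: de_def \<kappa>_def[symmetric] partial_const partial_coords) simp
      moreover have "partial2 ga x y = x * partial2 \<kappa> x y"
        using partial_mult(2)[OF bianalytic_simps(2) an\<kappa> xy]
        by (simp only: ga_def \<kappa>_def[symmetric] partial_const partial_coords) simp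
      ultimately show ?thesis by simp
    qed
    ultimately show ?thesis
      unfolding \<Omega>1_def \<Omega>2_def
      by (simp add: ncs_partial_scaleC[OF bianalytic_simps(1) _ xy] ncs_partial_add[OF _ _ xy]
          ncs_partial_sum[OF _ xy]
          ncs_partial_scaleC_const[OF _ xy] cl partial_const scaleC_scaleC)
  qed
  have commute: "abs_dk (\<Omega>1 x y * \<Omega>2 x y) = abs_dk (\<Omega>2 x y * \<Omega>1 x y)"
    if xy: "norm x < \<rho>" "norm y < \<rho>" for x y
  proof -
    \<comment> \<open>The Arnold relation multiplied by x y, in which form it persists on the
      axes.\<close>
    have "al k x y * be k x y = al k x y * de x y + ga x y * be k x y" for k
    proof -
      have D: "pt i - pt j + x - y \<noteq> 0" using nz[OF ij xy, of 1 "- 1"] by simp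
      have I: "pt i - pt k + x \<noteq> 0" if "k \<noteq> i" using nz[of i k x y 1 0] xy that by simp
      have J: "pt j - pt k + y \<noteq> 0" if "k \<noteq> j" using nz[of j k x y 0 1] xy that by simp
      show ?thesis
        using D I J ij by (auto simp: al_def be_def ga_def de_def K_def divide_simps)
            (auto simp: algebra_simps, metis distrib_left)
    qed
    from arnold_commute[of "\<lambda>k. al k x y" "\<lambda>k. be k x y" "de x y" "ga x y", OF this] show ?thesis
      by (simp add: commutator_def \<Omega>1_def \<Omega>2_def dk.q_simps tt_abs mult_scaleC_left mult_scaleC_right)
  qed
  have flat: "abs_dk (x *\<^sub>C ncs_partial1 f x y) = abs_dk (\<Omega>1 x y * f x y - f x y * \<Omega>1 0 0)"
      "abs_dk (y *\<^sub>C ncs_partial2 f x y) = abs_dk (\<Omega>2 x y * f x y - f x y * \<Omega>2 0 0)"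
    if "norm x < \<rho>" "norm y < \<rho>" for x y
    by (rule dk.flat_euler_solution[where r = \<rho> and f = f and ?\<Omega>1.0 = \<Omega>1 and ?\<Omega>2.0 = \<Omega>2],
        (rule that \<rho>(1) f(1,2,4) an\<Omega> lin closed commute | assumption)+)+
  define a1 a2 where "a1 = Abs_gen {Pt i, Zs}" and "a2 = Abs_gen {Pt j, Ws}"
  have comm: "abs_dk (letter a1) * abs_dk (letter a2) = abs_dk (letter a2) * abs_dk (letter a1)"
    using tt_disjoint_commute[of "Pt i" Zs "Pt j" Ws] ij
        by (simp add: a1_def a2_def tt_abs free_t_letter)
  define F where "F = (\<lambda>z w. abs_dk (f (z - pt i) (w - pt j)) *
               monodromy_power ((z - pt i) / vi) (tt (Pt i) Zs) *
               monodromy_power ((w - pt j) / vj) (tt (Pt j) Ws))"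
  show ?thesis
  proof (rule that[OF \<rho>(1) _ _ F_def])
    show "analytic_bidisc \<rho> (\<lambda>x y. abs_dk (f x y))"
      by (intro dk.analytic_bidisc_q ncs_bianalytic_analytic_bidisc f)
    show "abs_dk (f 0 0) = 1" by (simp add: f dk.q_one)
    fix z w assume zw: "norm (z - pt i) < \<rho>" "norm (w - pt j) < \<rho>"
      "(z - pt i) / vi \<notin> \<real>\<^sub>\<le>\<^sub>0" "(w - pt j) / vj \<notin> \<real>\<^sub>\<le>\<^sub>0"
    define x y where "x = z - pt i" and "y = w - pt j"
    have xy: "norm x < \<rho>" "norm y < \<rho>" "x / vi \<notin> \<real>\<^sub>\<le>\<^sub>0" "y / vj \<notin> \<real>\<^sub>\<le>\<^sub>0"
      using zw by (auto simp: x_def y_def)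
    \<comment> \<open>The slit domains of the logarithms exclude the axes, so the equations for x
      and y times the derivatives may be divided by x and y.\<close>
    have xy0: "x \<noteq> 0" "y \<noteq> 0" using xy by auto
    show "solves_at pt F z w"
      unfolding solves_at_def
    proof (intro allI)
      fix dz dw :: complex
      define L1 where "L1 = (\<lambda>h. Ln ((x + h * dz) / vi) / two_pi_i)"
      define L2 where "L2 = (\<lambda>h. Ln ((y + h * dw) / vj) / two_pi_i)"
      have "(L1 has_field_derivative dz * (1 / (two_pi_i * x))) (at 0)"
        unfolding L1_def using xy xy0 vi by (auto intro!: derivative_eq_intros simp: field_simps)
      moreover have "(L2 has_field_derivative dw * (1 / (two_pi_i * y))) (at 0)"
        unfolding L2_def using xy xy0 vj by (auto intro!: derivative_eq_intros simp: field_simps)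
      moreover have "abs_dk (ncs_partial1 f x y) =
          abs_dk (((1 / x) *\<^sub>C \<Omega>1 x y) * f x y - f x y * ((1 / (two_pi_i * x)) *\<^sub>C letter a1))"
      proof -
        have "abs_dk (ncs_partial1 f x y) = (1 / x) *\<^sub>C abs_dk (x *\<^sub>C ncs_partial1 f x y)"
          using xy0 by (simp add: dk.q_simps scaleC_scaleC scaleC_one)
        then show ?thesis
          unfolding flat(1)[OF xy(1,2)] \<Omega>0
          by (simp add: dk.q_simps scaleC_diff_right mult_scaleC_left mult_scaleC_right
              scaleC_scaleC mult_ac free_t_letter a1_def)
      qed
      moreover have "abs_dk (ncs_partial2 f x y) =
          abs_dk (((1 / y) *\<^sub>C \<Omega>2 x y) * f x y - f x y * ((1 / (two_pi_i * y)) *\<^sub>C letter a2))"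
      proof -
        have "abs_dk (ncs_partial2 f x y) = (1 / y) *\<^sub>C abs_dk (y *\<^sub>C ncs_partial2 f x y)"
          using xy0 by (simp add: dk.q_simps scaleC_scaleC scaleC_one)
        then show ?thesis
          unfolding flat(2)[OF xy(1,2)] \<Omega>0
          by (simp add: dk.q_simps scaleC_diff_right mult_scaleC_left mult_scaleC_right
              scaleC_scaleC mult_ac free_t_letter a2_def)
      qed
      ultimately have "has_complex_deriv (\<lambda>h. abs_dk (f (x + h * dz) (y + h * dw)) * abs_dk
          (letter_exp a1 (L1 h)) * abs_dk (letter_exp a2 (L2 h)))
         (abs_dk (dz *\<^sub>C ((1 / x) *\<^sub>C \<Omega>1 x y) + dw *\<^sub>C ((1 / y) *\<^sub>C \<Omega>2 x y)) *
           (abs_dk (f x y) * abs_dk (letter_exp a1 (L1 0)) * abs_dk (letter_exp a2 (L2 0)))) 0"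
        by (intro dk.local_solution_deriv[OF f(1) xy(1,2) comm])
      moreover have "(\<lambda>h. F (z + h * dz) (w + h * dw)) =
          (\<lambda>h. abs_dk (f (x + h * dz) (y + h * dw)) * abs_dk (letter_exp a1 (L1 h)) * abs_dk
              (letter_exp a2 (L2 h)))"
        by (auto simp: F_def x_def y_def L1_def L2_def a1_def a2_def tt_abs free_t_letter
            dk.monodromy_power_letter add_diff_eq diff_add_eq)
      moreover have "F z w = abs_dk (f x y) * abs_dk (letter_exp a1 (L1 0)) * abs_dk
          (letter_exp a2 (L2 0))"
        by (auto simp: F_def x_def y_def L1_def L2_def a1_def a2_def tt_abs free_t_letter
            dk.monodromy_power_letter)
      moreover have "dz *\<^sub>C ((1 / x) *\<^sub>C \<Omega>1 x y) + dw *\<^sub>C ((1 / y) *\<^sub>C \<Omega>2 x y) = A_free pt z w dz dw"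
      proof -
        have z: "z = pt i + x" and w: "w = pt j + y" by (simp_all add: x_def y_def)
        have 1: "dz * (1 / x * al k x y) = dz / (z - pt k)" for k
          using xy0 by (auto simp: al_def K_def z)
        have 2: "dw * (1 / y * be k x y) = dw / (w - pt k)" for k
          using xy0 by (auto simp: be_def K_def w)
        have "z - w = pt i - pt j + 1 * x + (- 1) * y" by (simp add: z w)
        then have 3: "dz * (1 / x * ga x y) + dw * (1 / y * de x y) = (dz - dw) / (z - w)"
          using xy0 by (simp add: ga_def de_def K_def diff_divide_distrib)
        show ?thesis
          unfolding A_free_def \<Omega>1_def \<Omega>2_def sum.distrib 3[symmetric] 1[symmetric] 2[symmetric]
          by (simp only: scaleC_add_right scaleC_add_left scaleC_sum_right scaleC_scaleC mult_ac add_ac)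
      qed
      ultimately show "has_complex_deriv (\<lambda>h. F (z + h * dz) (w + h * dw))
          (A_zw pt z w dz dw * F z w) 0"
        by (simp only: A_zw_abs)
    qed
  qed
qed

text \<open>In the coordinates x = z - a, y = w - z only the diagonal y = 0 is singular, so there is
  a single power. The last conclusion records a lift with constant coefficient 1, which later makes
  the solution at the crossing invertible.\<close>

lemma end_solution_exists:
  fixes pt :: "'n::finite \<Rightarrow> complex"
  assumes a: "a \<notin> range pt" and u: "u \<noteq> 0"
  obtains f \<rho> F where "0 < \<rho>" "analytic_bidisc \<rho> f" "f 0 0 = 1"
    "F = (\<lambda>z w. f (z - a) (w - z) * monodromy_power ((w - z) / (- u)) (tt Zs Ws))"
    "\<And>z w. norm (z - a) < \<rho> \<Longrightarrow> norm (w - z) < \<rho> \<Longrightarrow>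
           (w - z) / (- u) \<notin> \<real>\<^sub>\<le>\<^sub>0 \<Longrightarrow> solves_at pt F z w"
    "\<And>x y. \<exists>g. f x y = abs_dk g \<and> ncs_coeff g [] = 1"
proof -
  have ne: "a - pt k \<noteq> 0" for k using a by auto
  obtain \<rho>0 where \<rho>0: "0 < \<rho>0" "\<And>k. k \<in> UNIV \<Longrightarrow> \<rho>0 \<le> norm (a - pt k)"
    by (rule finite_lower_bound[of UNIV "\<lambda>k. norm (a - pt k)"]) (use ne in auto)
  define \<rho> where "\<rho> = \<rho>0 / 2"
  have \<rho>: "0 < \<rho>" "\<And>k. 2 * \<rho> \<le> norm (a - pt k)"
    using \<rho>0 by (auto simp: \<rho>_def)
  define Kz where "Kz = (\<lambda>k x y. 1 / (a - pt k + 1 * x + 0 * y))"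
  define Kw where "Kw = (\<lambda>k x y. 1 / (a - pt k + 1 * x + 1 * y))"
  have an: "bianalytic \<rho> (Kz k)" "bianalytic \<rho> (Kw k)" for k
    unfolding Kz_def Kw_def by (intro bianalytic_inverse_affine ne \<rho>(2); simp)+
  define \<Omega>1 where "\<Omega>1 = (\<lambda>x y. (1 / two_pi_i) *\<^sub>C (\<Sum>k\<in>UNIV. (x * Kz k x y) *\<^sub>C free_t (Pt k) Zs +
      (x * Kw k x y) *\<^sub>C free_t (Pt k) Ws))"
  \<comment> \<open>Moving x with y fixed moves z and w together, hence both kinds of terms; the
    dlog(z - w) term drops out, so this component is regular even before multiplication by
    x.\<close>
  define R1 where "R1 = (\<lambda>x y. (1 / two_pi_i) *\<^sub>C (\<Sum>k\<in>UNIV. Kz k x y *\<^sub>C free_t (Pt k) Zs + Kw k x y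
      *\<^sub>C free_t (Pt k) Ws))"
  define \<Omega>2 where "\<Omega>2 = (\<lambda>x y. (1 / two_pi_i) *\<^sub>C ((\<Sum>k\<in>UNIV. (y * Kw k x y) *\<^sub>C free_t (Pt k) Ws) +
      free_t Zs Ws))"
  note cl = ncs_bianalytic_simps ncs_bianalytic_sum bianalytic_simps an
  have an\<Omega>: "ncs_bianalytic \<rho> \<Omega>1" "ncs_bianalytic \<rho> \<Omega>2" "ncs_bianalytic \<rho> R1"
    unfolding \<Omega>1_def \<Omega>2_def R1_def by (intro cl)+
  have lin: "linear_form (\<Omega>1 x y)" "linear_form (\<Omega>2 x y)" for x y
    unfolding \<Omega>1_def \<Omega>2_def by (intro linear_form_simps linear_form_free_t)+
  have \<Omega>1R: "\<Omega>1 x y = x *\<^sub>C R1 x y" for x y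
    by (simp add: \<Omega>1_def R1_def scaleC_sum_right scaleC_add_right scaleC_scaleC mult_ac)
  have \<Omega>0: "\<Omega>1 0 0 = 0" "\<Omega>2 0 0 = (1 / two_pi_i) *\<^sub>C free_t Zs Ws"
    by (simp_all add: \<Omega>1_def \<Omega>2_def)
  obtain f where f: "ncs_bianalytic \<rho> f" "f 0 0 = 1" "\<And>x y. ncs_coeff (f x y) [] = 1"
      "\<And>x y. norm x < \<rho> \<Longrightarrow> norm y < \<rho> \<Longrightarrow> x *\<^sub>C ncs_partial1 f x y + y *\<^sub>C ncs_partial2 f x y =
        (\<Omega>1 x y + \<Omega>2 x y) * f x y - f x y * (\<Omega>1 0 0 + \<Omega>2 0 0)"
    by (rule euler_equation_solution[where \<Omega> = "\<lambda>x y. \<Omega>1 x y + \<Omega>2 x y", OF \<rho>(1)])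
      (use an\<Omega> lin in \<open>auto intro: cl linear_form_simps\<close>)
  have nz: "a - pt k + \<alpha> * x + \<beta> * y \<noteq> 0"
    if "norm x < \<rho>" "norm y < \<rho>" "norm \<alpha> \<le> 1" "norm \<beta> \<le> 1" for k x y \<alpha> \<beta>
    using affine_nonzero[OF \<rho>(2)] that by blast
  have closed: "x *\<^sub>C ncs_partial1 \<Omega>2 x y = y *\<^sub>C ncs_partial2 \<Omega>1 x y"
    if xy: "norm x < \<rho>" "norm y < \<rho>" for x y
  proof -
    have 1: "partial1 (\<lambda>x y. y * Kw k x y) x y = y * partial1 (Kw k) x y"
        "partial2 (\<lambda>x y. x * Kw k x y) x y = x * partial2 (Kw k) x y"
        "partial2 (\<lambda>x y. x * Kz k x y) x y = 0" for k
      using partial_mult(1)[OF bianalytic_simps(3) an(2) xy] partial_mult(2)[OF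
          bianalytic_simps(2) an(2) xy]
      by (simp_all add: partial_coords) (simp add: partial2_def Kz_def)
    have 2: "partial1 (Kw k) x y = partial2 (Kw k) x y" for k
      using partial_inverse_affine[OF nz[OF xy, of 1 1]] unfolding Kw_def by simp
    show ?thesis
      unfolding \<Omega>1_def \<Omega>2_def
      by (simp add: ncs_partial_scaleC[OF bianalytic_simps(1) _ xy] ncs_partial_add[OF _ _ xy]
          ncs_partial_sum[OF _ xy]
          ncs_partial_scaleC_const[OF _ xy] cl partial_const ncs_partial_const 1 2 scaleC_scaleC
              scaleC_sum_right mult_ac)
  qed
  have commute: "abs_dk (\<Omega>1 x y * \<Omega>2 x y) = abs_dk (\<Omega>2 x y * \<Omega>1 x y)"
    if xy: "norm x < \<rho>" "norm y < \<rho>" for x y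
  proof -
    define s where "s = (\<Sum>k\<in>UNIV. Kz k x y *\<^sub>C tt (Pt k) Zs + Kw k x y *\<^sub>C tt (Pt k) Ws)"
    define t where "t = (\<Sum>k\<in>UNIV. (y * Kw k x y) *\<^sub>C tt (Pt k) Ws) + 1 *\<^sub>C tt Zs Ws"
    have "commutator s t = 0"
    proof (cases "y = 0")
      \<comment> \<open>Here the factor y used in the other case cannot be cancelled. But on the
        diagonal \<open>s\<close> is a combination of the sums t_kz + t_kw, which commute with t_zw
        by the triangle relation.\<close>
      case True
      have "commutator (tt (Pt k) Ws) (tt Zs Ws) = - commutator (tt Zs Ws) (tt (Pt k) Ws)" for k :: 'n
        by (simp add: commutator_def)
      then have "commutator (tt (Pt k) Zs) (tt Zs Ws) + commutator (tt (Pt k) Ws) (tt Zs Ws) =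
          0" for k :: 'n
        by (simp add: tt_brackets)
      moreover have "Kw k x y = Kz k x y" for k using True by (simp add: Kz_def Kw_def)
      ultimately show ?thesis
        by (simp add: s_def t_def True scaleC_one commutator_sum_left commutator_add
            commutator_scaleC scaleC_add_right[symmetric])
    next
      case False
      \<comment> \<open>The identity Kz - Kw = y Kz Kw multiplied by y, in the shape of the Arnold
        relation.\<close>
      have "(y * Kz k x y) * (y * Kw k x y) = (y * Kz k x y) * 1 + (- 1) * (y * Kw k x y)" for k
      proof -
        have "a - pt k + x \<noteq> 0" "a - pt k + x + y \<noteq> 0" using nz[OF xy, of 1 0] nz[OF xy, of 1 1]
            by simp_all
        then show ?thesis by (simp add: Kz_def Kw_def divide_simps) (simp add: algebra_simps)
      qed
      from arnold_commute[of "\<lambda>k. y * Kz k x y" "\<lambda>k. y * Kw k x y" 1 "- 1", OF this]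
      have "commutator ((\<Sum>k\<in>UNIV. (y * Kz k x y) *\<^sub>C tt (Pt k) Zs) + (- 1) *\<^sub>C tt Zs Ws) t = 0"
        by (simp only: t_def)
      moreover have "commutator t t = 0" by (simp add: commutator_def)
      \<comment> \<open>The x-component times y is the z-component of the Arnold pair plus the
        w-component \<open>t\<close>, because x moves both points; \<open>t\<close> commutes with
        itself.\<close>
      moreover have "y *\<^sub>C s = ((\<Sum>k\<in>UNIV. (y * Kz k x y) *\<^sub>C tt (Pt k) Zs) + (- 1) *\<^sub>C tt Zs Ws) + t"
        by (simp add: s_def t_def scaleC_sum_right scaleC_add_right scaleC_scaleC sum.distrib
            scaleC_minus_left)
      ultimately have "y *\<^sub>C commutator s t = 0"
        by (simp only: commutator_scaleC(1)[symmetric] commutator_add(1)) simp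
      then have "(1 / y) *\<^sub>C y *\<^sub>C commutator s t = 0" by simp
      then show ?thesis using False by (simp add: scaleC_scaleC scaleC_one)
    qed
    moreover have "abs_dk (\<Omega>1 x y) = (1 / two_pi_i) *\<^sub>C x *\<^sub>C s" "abs_dk (\<Omega>2 x y) = (1 / two_pi_i) *\<^sub>C t"
      by (simp_all add: \<Omega>1_def \<Omega>2_def s_def t_def dk.q_simps tt_abs scaleC_one scaleC_sum_right
          scaleC_add_right scaleC_scaleC)
    ultimately show ?thesis
      by (simp add: commutator_def dk.q_mult mult_scaleC_left mult_scaleC_right scaleC_scaleC mult_ac)
  qed
  have flat: "abs_dk (x *\<^sub>C ncs_partial1 f x y) = abs_dk (\<Omega>1 x y * f x y - f x y * \<Omega>1 0 0)"
      "abs_dk (y *\<^sub>C ncs_partial2 f x y) = abs_dk (\<Omega>2 x y * f x y - f x y * \<Omega>2 0 0)"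
    if "norm x < \<rho>" "norm y < \<rho>" for x y
    by (rule dk.flat_euler_solution[where r = \<rho> and f = f and ?\<Omega>1.0 = \<Omega>1 and ?\<Omega>2.0 = \<Omega>2],
        (rule that \<rho>(1) f(1,2,4) an\<Omega> lin closed commute | assumption)+)+
  \<comment> \<open>The flat solution gives this only after multiplication by x. The domain contains
    points with x = 0, where the equation is recovered by continuity.\<close>
  have d1: "abs_dk (ncs_partial1 f x y) = abs_dk (R1 x y * f x y)" if xy: "norm x < \<rho>"
      "norm y < \<rho>" for x y
  proof -
    define U where "U = (\<lambda>x y. ncs_partial1 f x y - R1 x y * f x y)"
    have U: "ncs_bianalytic \<rho> U" unfolding U_def by (intro cl an\<Omega> f)
    have nonzero: "abs_dk (U x y) = 0" if "norm x < \<rho>" "norm y < \<rho>" "x \<noteq> 0" for x y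
    proof -
      have "x *\<^sub>C abs_dk (U x y) = 0"
        using flat(1)[OF that(1,2)] unfolding \<Omega>0 \<Omega>1R
        by (simp add: U_def dk.q_simps scaleC_diff_right mult_scaleC_left)
      then have "(1 / x) *\<^sub>C x *\<^sub>C abs_dk (U x y) = 0" by simp
      then show ?thesis using that by (simp add: scaleC_scaleC scaleC_one)
    qed
    have "abs_dk (U x y) = 0"
    proof (cases "x = 0")
      case True
      have "((\<lambda>h. U h y) \<longlongrightarrow> U 0 y) (at 0)"
        unfolding tendsto_ncs_iff
      proof
        fix w
        have "isCont (\<lambda>h. ncs_coeff (U (0 + h * 1) (y + h * 0)) w) 0"
        proof -
          have "norm (0::complex) < \<rho>" using \<rho>(1) by simp
          from ncs_bianalytic_has_deriv[OF U this xy(2), of 1 0] show ?thesis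
            unfolding has_complex_deriv_ncs_iff by (intro DERIV_isCont) (rule spec)
        qed
        then show "((\<lambda>h. ncs_coeff (U h y) w) \<longlongrightarrow> ncs_coeff (U 0 y) w) (at 0)"
          by (simp add: isCont_def)
      qed
      from dk.tendsto_q[OF this] have 1: "((\<lambda>h. abs_dk (U h y)) \<longlongrightarrow> abs_dk (U 0 y)) (at 0)" .
      have "\<forall>\<^sub>F h in at 0. norm h < \<rho> \<and> h \<noteq> (0::complex)"
        using \<rho>(1) by (auto simp: eventually_at intro!: exI[of _ \<rho>])
      then have "((\<lambda>h. abs_dk (U h y)) \<longlongrightarrow> 0) (at 0)"
        by (intro tendsto_eventually) (auto elim!: eventually_mono intro: nonzero xy)
      from dk.tendsto_unique_q[OF _ 1 this] show ?thesis using True by simp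
    qed (use nonzero xy in blast)
    then show ?thesis by (simp add: U_def dk.q_diff)
  qed
  define b where "b = Abs_gen {Zs, Ws :: 'n strand}"
  define F where "F = (\<lambda>z w. abs_dk (f (z - a) (w - z)) * monodromy_power ((w - z) / (- u)) (tt Zs Ws))"
  show ?thesis
  proof (rule that[OF \<rho>(1) _ _ F_def])
    show "analytic_bidisc \<rho> (\<lambda>x y. abs_dk (f x y))"
      by (intro dk.analytic_bidisc_q ncs_bianalytic_analytic_bidisc f)
    show "abs_dk (f 0 0) = 1" by (simp add: f dk.q_one)
    show "\<exists>g. abs_dk (f x y) = abs_dk g \<and> ncs_coeff g [] = 1" for x y
      using f(3) by blast
    fix z w assume zw: "norm (z - a) < \<rho>" "norm (w - z) < \<rho>" "(w - z) / (- u) \<notin> \<real>\<^sub>\<le>\<^sub>0"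
    define x y where "x = z - a" and "y = w - z"
    have xy: "norm x < \<rho>" "norm y < \<rho>" "y / (- u) \<notin> \<real>\<^sub>\<le>\<^sub>0"
      using zw by (auto simp: x_def y_def)
    have y0: "y \<noteq> 0" using xy by auto
    show "solves_at pt F z w"
      unfolding solves_at_def
    proof (intro allI)
      fix dz dw :: complex
      define dy where "dy = dw - dz"
      define L2 where "L2 = (\<lambda>h. Ln ((y + h * dy) / (- u)) / two_pi_i)"
      have "(L2 has_field_derivative dy * (1 / (two_pi_i * y))) (at 0)"
        unfolding L2_def using xy y0 u by (auto intro!: derivative_eq_intros simp: field_simps)
      \<comment> \<open>The first exponential is made trivial by a zero exponent; with the same
        letter in both places the commutation hypothesis is reflexivity.\<close>
      moreover have "((\<lambda>h :: complex. 0) has_field_derivative dz * 0) (at 0)" by simp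
      moreover have "abs_dk (ncs_partial1 f x y) = abs_dk (R1 x y * f x y - f x y * (0 *\<^sub>C letter b))"
        using d1[OF xy(1,2)] by simp
      moreover have "abs_dk (ncs_partial2 f x y) =
          abs_dk (((1 / y) *\<^sub>C \<Omega>2 x y) * f x y - f x y * ((1 / (two_pi_i * y)) *\<^sub>C letter b))"
      proof -
        have "abs_dk (ncs_partial2 f x y) = (1 / y) *\<^sub>C abs_dk (y *\<^sub>C ncs_partial2 f x y)"
          using y0 by (simp add: dk.q_simps scaleC_scaleC scaleC_one)
        then show ?thesis
          unfolding flat(2)[OF xy(1,2)] \<Omega>0
          by (simp add: dk.q_simps scaleC_diff_right mult_scaleC_left mult_scaleC_right
              scaleC_scaleC mult_ac free_t_letter b_def)
      qed
      ultimately have "has_complex_deriv (\<lambda>h. abs_dk (f (x + h * dz) (y + h * dy)) * abs_dk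
          (letter_exp b 0) * abs_dk (letter_exp b (L2 h)))
         (abs_dk (dz *\<^sub>C R1 x y + dy *\<^sub>C ((1 / y) *\<^sub>C \<Omega>2 x y)) *
           (abs_dk (f x y) * abs_dk (letter_exp b 0) * abs_dk (letter_exp b (L2 0)))) 0"
        by (intro dk.local_solution_deriv[OF f(1) xy(1,2) refl, where ?L1.0 = "\<lambda>h. 0"])
      moreover have "(\<lambda>h. F (z + h * dz) (w + h * dw)) =
          (\<lambda>h. abs_dk (f (x + h * dz) (y + h * dy)) * abs_dk (letter_exp b 0) * abs_dk
              (letter_exp b (L2 h)))"
      proof
        fix h
        have "z + h * dz - a = x + h * dz" "w + h * dw - (z + h * dz) = y + h * dy"
          by (simp_all add: x_def y_def dy_def algebra_simps)
        then show "F (z + h * dz) (w + h * dw) =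
            abs_dk (f (x + h * dz) (y + h * dy)) * abs_dk (letter_exp b 0) * abs_dk
            (letter_exp b (L2 h))"
          unfolding F_def L2_def by (simp only: tt_abs free_t_letter dk.monodromy_power_letter
              b_def letter_exp_zero dk.q_one mult_1_right)
      qed
      moreover have "F z w = abs_dk (f x y) * abs_dk (letter_exp b 0) * abs_dk (letter_exp b (L2 0))"
        by (simp add: F_def x_def y_def L2_def b_def tt_abs free_t_letter
            dk.monodromy_power_letter letter_exp_zero dk.q_one)
      moreover have "dz *\<^sub>C R1 x y + dy *\<^sub>C ((1 / y) *\<^sub>C \<Omega>2 x y) = A_free pt z w dz dw"
      proof -
        have z: "z = a + x" and w: "w = a + x + y" by (simp_all add: x_def y_def)
        have 1: "Kz k x y = 1 / (z - pt k)" "Kw k x y = 1 / (w - pt k)" for k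
          by (simp_all add: Kz_def Kw_def z w algebra_simps)
        have 2: "(dz - dw) / (z - w) = dy / y"
          using y0 by (simp add: z w dy_def divide_simps)
        have 3: "(dz / (w - pt k)) *\<^sub>C free_t (Pt k) Ws + (dy / (w - pt k)) *\<^sub>C free_t (Pt k) Ws =
            (dw / (w - pt k)) *\<^sub>C free_t (Pt k) Ws" for k :: 'n
          by (simp add: scaleC_add_left[symmetric] dy_def add_divide_distrib[symmetric])
        have "dz *\<^sub>C R1 x y + dy *\<^sub>C ((1 / y) *\<^sub>C \<Omega>2 x y) = (1 / two_pi_i) *\<^sub>C
           ((\<Sum>k\<in>UNIV. (dz / (z - pt k)) *\<^sub>C free_t (Pt k) Zs + ((dz / (w - pt k)) *\<^sub>C free_t (Pt k)
               Ws + (dy / (w - pt k)) *\<^sub>C free_t (Pt k) Ws))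
            + (dy / y) *\<^sub>C free_t Zs Ws)"
          using y0 by (simp add: R1_def \<Omega>2_def 1 scaleC_sum_right scaleC_add_right scaleC_scaleC
              sum.distrib mult_ac add_ac)
        then show ?thesis
          unfolding A_free_def 2 3 .
      qed
      ultimately show "has_complex_deriv (\<lambda>h. F (z + h * dz) (w + h * dw))
          (A_zw pt z w dz dw * F z w) 0"
        by (simp only: A_zw_abs)
    qed
  qed
qed

section \<open>Solutions along the segment of a self-intersection\<close>

lemma vanishes_below_power:
  fixes u :: "'g ncs"
  assumes "vanishes_below 1 u"
  shows "vanishes_below k (u ^ k)"
proof (induction k)
  case (Suc k)
  show ?case
    unfolding vanishes_below_def power_Suc coeff_mult
  proof (intro allI impI sum.neutral ballI)
    fix w :: "'g list" and i assume "length w < Suc k" "i \<in> {..length w}"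
    then show "ncs_coeff u (take i w) * ncs_coeff (u ^ k) (drop i w) = 0"
      using assms Suc by (cases "i = 0") (auto simp: vanishes_below_def)
  qed
qed (simp add: vanishes_below_def)

text \<open>Geometric series in 1 - f. The coefficient at a word is constant in the partial sums as
  soon as the number of terms exceeds the length of the word.\<close>

lemma ncs_unit:
  fixes f :: "'g ncs"
  assumes "ncs_coeff f [] = 1"
  obtains g where "f * g = 1" "g * f = 1"
proof -
  define u where "u = 1 - f"
  have "vanishes_below 1 u" using assms by (simp add: vanishes_below_def u_def)
  note up = vanishes_below_power[OF this]
  define S where "S = (\<lambda>n. \<Sum>k<n. u ^ k)"
  define g where "g = Abs_ncs (\<lambda>w. ncs_coeff (S (Suc (length w))) w)"
  have tail: "vanishes_below n (S (n + m) - S n)" for n m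
  proof (induction m)
    case (Suc m)
    have "vanishes_below n (u ^ (n + m))"
      using up[of "n + m"] by (auto simp: vanishes_below_def)
    then show ?case using Suc by (simp add: S_def vanishes_below_def)
  qed (simp add: vanishes_below_def)
  have gS: "vanishes_below n (g - S n)" for n
    unfolding vanishes_below_def
  proof (intro allI impI)
    fix w :: "'g list" assume w: "length w < n"
    then obtain m where "n = Suc (length w) + m" using less_iff_Suc_add by auto
    with tail[of "Suc (length w)" m] show "ncs_coeff (g - S n) w = 0"
      by (simp add: vanishes_below_def g_def)
  qed
  have comm: "u ^ n * f = f * u ^ n" for n
    by (rule power_commuting_commutes) (simp add: u_def algebra_simps)
  have tele: "f * S n = 1 - u ^ n" "S n * f = 1 - u ^ n" for n
  proof (induction n)
    case (Suc n)
    have f: "f = 1 - u" by (simp add: u_def)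
    have "f * S (Suc n) = f * S n + f * u ^ n" "S (Suc n) * f = S n * f + u ^ n * f"
      by (simp_all add: S_def algebra_simps)
    moreover have "f * u ^ n = u ^ n - u ^ Suc n" by (simp add: f left_diff_distrib)
    ultimately show "f * S (Suc n) = 1 - u ^ Suc n" "S (Suc n) * f = 1 - u ^ Suc n"
      using Suc comm by simp_all
  qed (simp_all add: S_def)
  have "f * g = 1"
  proof (rule ncs_eqI)
    fix w :: "'g list"
    let ?n = "Suc (length w)"
    have "f * g = f * (g - S ?n) + (1 - u ^ ?n)" by (simp add: right_diff_distrib tele)
    then show "ncs_coeff (f * g) w = ncs_coeff 1 w"
      using vanishes_below_mult(1)[OF gS[of ?n], of f] up[of ?n] by (simp add: vanishes_below_def)
  qed
  moreover have "g * f = 1"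
  proof (rule ncs_eqI)
    fix w :: "'g list"
    let ?n = "Suc (length w)"
    have "g * f = (g - S ?n) * f + (1 - u ^ ?n)" by (simp add: left_diff_distrib tele)
    then show "ncs_coeff (g * f) w = ncs_coeff 1 w"
      using vanishes_below_mult(2)[OF gS[of ?n], of f] up[of ?n] by (simp add: vanishes_below_def)
  qed
  ultimately show ?thesis by (rule that)
qed

lemma alg_inverse_eqI:
  assumes "x * y = 1" "y * x = 1"
  shows "alg_inverse x = y"
  unfolding alg_inverse_def
proof (rule the_equality)
  fix z assume "x * z = 1 \<and> z * x = 1"
  then have "z = z * (x * y)" "z * x = 1" using assms by simp_all
  then show "z = y" by (simp add: mult.assoc[symmetric])
qed (use assms in simp)

lemma has_real_deriv_cong:
  assumes "has_real_deriv \<Psi> D t S" "t \<in> S" "\<And>s. s \<in> S \<Longrightarrow> \<Psi> s = \<Phi> s"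
  shows "has_real_deriv \<Phi> D t S"
  using assms unfolding has_real_deriv_def
  by (subst Lim_cong_within[where g = "\<lambda>s. complex_of_real (1 / (s - t)) *\<^sub>C (\<Psi> s - \<Psi> t)"]) auto

lemma solves_at_line:
  assumes "solves_at pt F (z0 + of_real t * dz) (w0 + of_real t * dw)"
  shows "has_real_deriv (\<lambda>s. F (z0 + of_real s * dz) (w0 + of_real s * dw))
    (A_zw pt (z0 + of_real t * dz) (w0 + of_real t * dw) dz dw * F (z0 + of_real t * dz)
        (w0 + of_real t * dw)) t S"
proof -
  let ?z = "z0 + of_real t * dz" and ?w = "w0 + of_real t * dw"
  have lim: "filterlim (\<lambda>s. complex_of_real (s - t)) (at 0) (at t within S)"
    unfolding filterlim_at
    by (auto simp: eventually_at_filter intro!: always_eventually tendsto_eq_intros)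
  have "((\<lambda>h. (1 / (h - 0)) *\<^sub>C (F (?z + h * dz) (?w + h * dw) - F (?z + 0 * dz) (?w + 0 * dw)))
      \<longlongrightarrow> A_zw pt ?z ?w dz dw * F ?z ?w) (at 0)"
    using assms by (auto simp: solves_at_def has_complex_deriv_def)
  from filterlim_compose[OF this lim] show ?thesis
    by (simp add: has_real_deriv_def algebra_simps)
qed

section \<open>The projection modulo \<open>t_zw\<close>\<close>

lemma proj_abs: "proj (abs_dk f) = abs_dkq f"
  by (simp add: proj.abs_eq)

lemma proj_simps: "proj (x + y) = proj x + proj y" "proj (x * y) = proj x * proj y"
  "proj (x - y) = proj x - proj y" "proj (c *\<^sub>C x) = c *\<^sub>C proj x"
proof -
  obtain f g where "x = abs_dk f" "y = abs_dk g"
    using dk.obtain_lift by metis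
  then show "proj (x + y) = proj x + proj y" "proj (x * y) = proj x * proj y"
    "proj (x - y) = proj x - proj y" "proj (c *\<^sub>C x) = c *\<^sub>C proj x"
    by (simp_all add: proj_abs dk.q_simps[symmetric] dkq.q_simps[symmetric])
qed

lemma proj_one: "proj 1 = 1"
  using proj_abs[of 1] by (simp add: dk.q_one dkq.q_one)

text \<open>Functionals pull back along \<open>proj\<close> with the same degree bound, so weak
  solutions and one-sided derivatives of tested functions descend to the smaller quotient.\<close>

lemma dual_proj:
  assumes "dkq.dual N \<phi>"
  shows "dk.dual N (\<lambda>x. \<phi> (proj x))"
  unfolding dk.dual_def
proof (intro conjI allI impI)
  show "\<phi> (proj (x + y)) = \<phi> (proj x) + \<phi> (proj y)" for x y
    by (simp add: proj_simps dkq.dual_add[OF assms])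
  show "\<phi> (proj (c *\<^sub>C x)) = c * \<phi> (proj x)" for c x
    by (simp add: proj_simps dkq.dual_scaleC[OF assms])
  have "continuous_on UNIV (\<phi> \<circ> abs_dkq)"
    by (intro continuous_on_compose dkq.continuous_q continuous_on_subset[OF
        dkq.dual_continuous[OF assms]]) simp
  then show "continuous_on UNIV (\<lambda>x. \<phi> (proj x))"
    by (intro dk.continuous_factor) (simp add: o_def proj_abs)
  show "\<phi> (proj (abs_dk f)) = 0" if "vanishes_below N f" for f
    using dkq.dual_vanish[OF assms that] by (simp add: proj_abs)
qed

lemma weak_solution_proj:
  "dk.weak_solution \<Omega> S \<Psi> \<Longrightarrow> dkq.weak_solution \<Omega> S (\<lambda>t. proj (\<Psi> t))"
  unfolding dk.weak_solution_def dkq.weak_solution_def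
  using dual_proj by (fastforce simp: proj_simps proj_abs)

text \<open>The preimage in the series algebra of a closed ideal containing t_zw is closed and
  contains all relators, hence contains the kernel of the projection. This turns the projected
  formula into the one with O(t_zw).\<close>

lemma proj_eq_imp_ideal:
  assumes "proj x = proj y"
  shows "x - y \<in> closed_ideal {tt Zs Ws}"
proof -
  obtain f where f: "x - y = abs_dk f" by (rule dk.obtain_lift)
  have "proj (x - y) = 0" using assms by (simp add: proj_simps)
  then have "f \<in> closed_ideal (insert (free_t Zs Ws) dk_relators)"
    unfolding f proj_abs by (simp add: zero_dkq_def dkq.abs_eq_iff)
  moreover have "closed_ideal (insert (free_t Zs Ws) dk_relators) \<subseteq> abs_dk -` I"
    if I: "two_sided_ideal I" "closed I" "{tt Zs Ws} \<subseteq> I" for I :: "'a dk set"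
  proof (rule closed_ideal_least)
    show "two_sided_ideal (abs_dk -` I)"
      using I(1) by (auto simp: two_sided_ideal_def dk.q_simps)
    have "open (- I)" using I(2) by (simp add: open_Compl)
    then have "open (abs_dk -` (- I))" by (simp add: dk.open_q)
    then show "closed (abs_dk -` I)" by (simp add: closed_def vimage_Compl)
    show "insert (free_t Zs Ws) dk_relators \<subseteq> abs_dk -` I"
      using I by (auto simp: dk_relator_zero two_sided_ideal_def tt_abs)
  qed
  ultimately show ?thesis unfolding f closed_ideal_def by blast
qed

text \<open>An element commuting with the coefficients sends solutions to solutions from either
  side. The difference of the two products is negligible at the base point and therefore
  vanishes.\<close>

lemma (in ncs_quotient) tangential_solution_commute:
  assumes path: "tangential_path pt r v \<delta> \<delta>' T"
    and x: "\<And>k. linear_form (x k)" "x r = letter a"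
    and \<Psi>: "tangential_solution pt (\<lambda>k. q (x k)) r v \<delta> T \<Psi>"
    and y: "\<And>k. y * q (x k) = q (x k) * y"
    and t: "t \<in> {0<..T}"
  shows "y * \<Psi> t = \<Psi> t * y"
proof -
  obtain f \<rho> where f: "0 < \<rho>" "analytic_disc \<rho> f" "f 0 = 1"
      "\<forall>\<^sub>F t in at_right 0. \<Psi> t = f ((\<delta> t - pt r) / v) * monodromy_power ((\<delta> t - pt r) / v) (q (x r))"
    using \<Psi> unfolding tangential_solution_def by blast
  have "log_negligible (\<lambda>t. y * f (of_real t) - f (of_real t) * y)"
  proof (rule log_negligibleI)
    fix N \<phi> assume \<phi>: "dual N \<phi>"
    obtain D E where "((\<lambda>t. \<phi> (y * f (of_real t))) has_vector_derivative D) (at 0 within {0<..})"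
        "((\<lambda>t. \<phi> (f (of_real t) * y)) has_vector_derivative E) (at 0 within {0<..})"
      using analytic_disc_dual_deriv[OF dual_comp_mult(1)[OF \<phi>] f(1,2)]
          analytic_disc_dual_deriv[OF dual_comp_mult(2)[OF \<phi>] f(1,2)] by metis
    then show "\<exists>D. ((\<lambda>t. \<phi> (y * f (of_real t) - f (of_real t) * y)) has_vector_derivative
        D) (at 0 within {0<..})"
      by (auto simp: dual_diff[OF \<phi>] intro: has_vector_derivative_diff)
  qed (simp add: f)
  from log_negligible_mult_power[OF this zero_less_one, of a]
  have neg: "log_negligible (\<lambda>t. y * \<Psi> t - \<Psi> t * y)"
  proof (rule log_negligible_cong)
    have comm: "y * monodromy_power (of_real t) (q (letter a)) =
        monodromy_power (of_real t) (q (letter a)) * y" for t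
      unfolding monodromy_power_letter using y[of r] by (intro commute_letter_exp) (simp add: x)
    show "\<forall>\<^sub>F t in at_right 0. (y * f (of_real t) - f (of_real t) * y) * monodromy_power
        (of_real (1 * t)) (q (letter a)) = y * \<Psi> t - \<Psi> t * y"
      using f(4) tangential_path_start[OF path]
      by eventually_elim (simp add: x(2) left_diff_distrib mult.assoc comm)
  qed
  have "y * q (log_form pt x p v) = q (log_form pt x p v) * y" for p v
    unfolding log_form_def q_simps
    by (simp add: y sum_distrib_left sum_distrib_right mult_scaleC_left mult_scaleC_right)
  then have "weak_solution (\<lambda>t. log_form pt x (\<delta> t) (vector_derivative \<delta> (at t within {0..T})))
      {0<..T} (\<lambda>t. y * \<Psi> t - \<Psi> t * y)"
    by (intro weak_solution_diff weak_solution_const_mult weak_solution_mult_const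
        tangential_weak_solution[OF \<Psi>])
  then have "y * \<Psi> t - \<Psi> t * y = 0"
  proof (rule weak_solution_vanish)
    show "\<forall>\<^sub>F t in at_right 0. t \<in> {0<..T}" using path by (intro eventually_at_right_interval)
        (simp add: tangential_path_def)
    show "((\<lambda>t. \<phi> (y * \<Psi> t - \<Psi> t * y)) \<longlongrightarrow> 0) (at_right 0)" if "dual N \<phi>" for N \<phi>
      by (rule log_negligible_tendsto[OF neg that])
  qed (use t in \<open>auto simp: trivial_limit_at_right_real intro: linear_form_log_form x\<close>)
  then show ?thesis by simp
qed

lemma ncs_analytic_disc_deriv:
  fixes f :: "complex \<Rightarrow> 'g ncs"
  assumes "0 < r" "analytic_disc r f"
  obtains D where "has_real_deriv (\<lambda>t. f (of_real (c * t))) D 0 S"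
proof -
  obtain b where b: "\<And>x. norm x < r \<Longrightarrow> (\<lambda>k. x ^ k *\<^sub>C b k) sums f x"
    using assms(2) by (auto simp: analytic_disc_def)
  have "\<exists>D. ((\<lambda>x. ncs_coeff (f x) w) has_field_derivative D) (at 0)" for w
    using b by (intro powser_deriv_0[OF assms(1), of "\<lambda>k. ncs_coeff (b k) w"]) (auto simp: sums_ncs_iff)
  then obtain D where D: "\<And>w. ((\<lambda>x. ncs_coeff (f x) w) has_field_derivative D w) (at 0)"
    by metis
  have "((\<lambda>x. ncs_coeff (f (of_real c * x)) w) has_field_derivative
      D w * of_real c) (at (of_real 0))" for w
    using DERIV_chain2[of "\<lambda>x. ncs_coeff (f x) w" "D w" "\<lambda>x. of_real c * x" 0 "of_real c" UNIV] D
    by (auto intro!: derivative_eq_intros)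
  then have "((\<lambda>t. ncs_coeff (f (of_real c * of_real t)) w) has_vector_derivative
      D w * of_real c) (at 0 within S)" for w
    by (rule has_vector_derivative_real_field)
  then have "has_real_deriv (\<lambda>t. f (of_real (c * t))) (Abs_ncs (\<lambda>w. D w * of_real c)) 0 S"
    by (simp add: has_real_deriv_ncs_iff)
  then show ?thesis by (rule that)
qed

text \<open>\<open>seg t0 s0\<close> has slope \<open>- \<kappa>\<close>, so that \<open>\<kappa> t\<close> is the time elapsed on the reversed path.\<close>

locale crossing =
  fixes pt :: "'n::finite \<Rightarrow> complex" and i j :: 'n and vi vj :: complex
    and \<gamma> :: "real \<Rightarrow> complex" and t0 s0 :: real
  assumes inj: "inj pt" and ij: "i \<noteq> j" and path: "admissible_path pt i vi j vj \<gamma>"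
    and cross: "(t0, s0) \<in> self_intersections \<gamma>"
begin

definition \<kappa> :: real where "\<kappa> = (1 - s0) / t0"

definition \<Omega> :: "real \<Rightarrow> 'n gen ncs" where
  "\<Omega> t = A_free pt (\<gamma> t) (\<gamma> (seg t0 s0 t)) (vector_derivative \<gamma> (at t))
     (vector_derivative (\<lambda>t. \<gamma> (seg t0 s0 t)) (at t))"

section \<open>Geometry of the segment\<close>

lemma times: "0 < t0" "t0 < s0" "s0 < 1" "\<gamma> t0 = \<gamma> s0"
  using cross by (auto simp: self_intersections_def)

lemma velocities: "vi \<noteq> 0" "vj \<noteq> 0"
  using path by (auto simp: admissible_path_def)

lemma \<kappa>_pos: "0 < \<kappa>"
  using times by (simp add: \<kappa>_def)

lemma seg_\<kappa>: "seg t0 s0 t = 1 - \<kappa> * t"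
  using times by (simp add: seg_def \<kappa>_def field_simps)

lemma \<kappa>_t0: "\<kappa> * t0 = 1 - s0"
  using times by (simp add: \<kappa>_def)

lemma seg_bounds: "0 < t \<Longrightarrow> t < t0 \<Longrightarrow> s0 < seg t0 s0 t \<and> seg t0 s0 t < 1"
  using mult_strict_left_mono[OF _ \<kappa>_pos, of t t0] \<kappa>_pos \<kappa>_t0 by (simp add: seg_\<kappa>)

lemma
  shows has_velocity: "\<And>t. t \<in> {0..1} \<Longrightarrow> (\<gamma> has_vector_derivative velocity \<gamma> t) (at t within {0..1})"
    and continuous_velocity: "continuous_on {0..1} (velocity \<gamma>)"
proof -
  obtain D where D: "D 0 = \<gamma>"
      "\<And>k t. t \<in> {0..1} \<Longrightarrow> (D k has_vector_derivative D (Suc k) t) (at t within {0..1})"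
    using path unfolding admissible_path_def smooth_on_unit_interval_def by blast
  have v: "velocity \<gamma> t = D 1 t" if "t \<in> {0..1}" for t
    unfolding velocity_def using D(2)[of t 0] that vector_derivative_within_cbox[of 0 1 t \<gamma> "D 1 t"]
    by (simp add: D(1))
  then show "\<And>t. t \<in> {0..1} \<Longrightarrow> (\<gamma> has_vector_derivative velocity \<gamma> t) (at t within {0..1})"
    using D(2)[of _ 0] by (simp add: D(1))
  have "continuous_on {0..1} (D 1)"
    unfolding continuous_on_eq_continuous_within
    using D(2)[of _ 1] has_vector_derivative_continuous by blast
  then show "continuous_on {0..1} (velocity \<gamma>)"
    using v continuous_on_cong by (metis (mono_tags, lifting))
qed

lemma has_velocity_at: "0 < t \<Longrightarrow> t < 1 \<Longrightarrow> (\<gamma> has_vector_derivative velocity \<gamma> t) (at t)"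
  using has_velocity[of t] at_within_Icc_at[of 0 t 1] by simp

lemma has_velocity_seg:
  assumes "0 < seg t0 s0 t" "seg t0 s0 t < 1"
  shows "((\<lambda>t. \<gamma> (seg t0 s0 t)) has_vector_derivative (- \<kappa>) *\<^sub>R velocity \<gamma> (seg t0 s0 t)) (at t)"
proof -
  have "(seg t0 s0 has_vector_derivative - \<kappa>) (at t)"
    unfolding seg_\<kappa>[abs_def] by (auto intro!: derivative_eq_intros)
  from vector_diff_chain_at[OF this has_velocity_at[OF assms]] show ?thesis
    by (simp add: o_def)
qed

lemma continuous_path: "continuous_on {0..1} \<gamma>"
  unfolding continuous_on_eq_continuous_within
  by (intro ballI has_vector_derivative_continuous[OF has_velocity])

lemma avoid: "0 < t \<Longrightarrow> t < 1 \<Longrightarrow> \<gamma> t \<noteq> pt k"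
  using path unfolding admissible_path_def by (metis greaterThanLessThan_iff rangeI)

text \<open>A coincidence of the two branches earlier on the segment would be a self-intersection on
  the same ray from (0, 1), which admissibility rules out. Hence the dlog(z - w) term has no pole in
  the open interval.\<close>

lemma no_collision:
  assumes "0 < t" "t < t0"
  shows "\<gamma> t \<noteq> \<gamma> (seg t0 s0 t)"
proof
  assume "\<gamma> t = \<gamma> (seg t0 s0 t)"
  then have si: "(t, seg t0 s0 t) \<in> self_intersections \<gamma>"
    using assms times seg_bounds[OF assms] by (auto simp: self_intersections_def)
  have "ray (0, 1) (t, seg t0 s0 t) = ray (0, 1) (t0, s0)"
  proof
    have p: "(t, seg t0 s0 t) - (0, 1) = (t / t0) *\<^sub>R ((t0, s0) - (0, 1))"
      using times by (simp add: seg_def field_simps)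
    show "ray (0, 1) (t, seg t0 s0 t) \<subseteq> ray (0, 1) (t0, s0)"
    proof
      fix x assume "x \<in> ray (0, 1) (t, seg t0 s0 t)"
      then obtain r where "0 \<le> r" "x = (0, 1) + r *\<^sub>R ((t, seg t0 s0 t) - (0, 1))"
          by (auto simp: ray_def)
      then have "x = (0, 1) + (r * (t / t0)) *\<^sub>R ((t0, s0) - (0, 1))" "0 \<le> r * (t / t0)"
        using p assms times by (simp_all only: scaleR_scaleR) auto
      then show "x \<in> ray (0, 1) (t0, s0)" unfolding ray_def by blast
    qed
    show "ray (0, 1) (t0, s0) \<subseteq> ray (0, 1) (t, seg t0 s0 t)"
    proof
      fix x assume "x \<in> ray (0, 1) (t0, s0)"
      then obtain r where r: "0 \<le> r" "x = (0, 1) + r *\<^sub>R ((t0, s0) - (0, 1))" by (auto simp: ray_def)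
      have "(r * (t0 / t)) *\<^sub>R ((t, seg t0 s0 t) - (0, 1)) = r *\<^sub>R ((t0, s0) - (0, 1))"
        unfolding p scaleR_scaleR using assms times by simp
      then have "x = (0, 1) + (r * (t0 / t)) *\<^sub>R ((t, seg t0 s0 t) - (0, 1))" "0 \<le> r * (t0 / t)"
        using r assms times by simp_all
      then show "x \<in> ray (0, 1) (t, seg t0 s0 t)" unfolding ray_def by blast
    qed
  qed
  with path si cross have "(t, seg t0 s0 t) = (t0, s0)"
    unfolding admissible_path_def by (blast dest: inj_onD)
  then show False using assms by simp
qed

lemma linear_form_\<Omega>: "linear_form (\<Omega> t)"
  unfolding \<Omega>_def by (rule linear_form_A_free)

lemma continuous_\<Omega>:
  assumes "0 < t" "t < t0"
  shows "isCont (\<lambda>t. ncs_coeff (\<Omega> t) w) t"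
proof -
  let ?S = "{0<..<t0}"
  have sub: "?S \<subseteq> {0..1}" "seg t0 s0 ` ?S \<subseteq> {0..1}"
  proof -
    show "?S \<subseteq> {0..1}" using times by auto
    show "seg t0 s0 ` ?S \<subseteq> {0..1}"
    proof
      fix s assume "s \<in> seg t0 s0 ` ?S"
      then obtain t where "0 < t" "t < t0" "s = seg t0 s0 t" by auto
      then show "s \<in> {0..1}" using seg_bounds[of t] times(1,2) by simp
    qed
  qed
  have c: "continuous_on ?S \<gamma>" "continuous_on ?S (velocity \<gamma>)"
    by (rule continuous_on_subset[OF continuous_path] continuous_on_subset[OF
        continuous_velocity], rule sub)+
  have "continuous_on ?S (seg t0 s0)" unfolding seg_def by (intro continuous_intros)
  then have cs: "continuous_on ?S (\<lambda>t. \<gamma> (seg t0 s0 t))"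
      "continuous_on ?S (\<lambda>t. velocity \<gamma> (seg t0 s0 t))"
    using sub by (auto intro: continuous_on_compose2[OF continuous_path] continuous_on_compose2[OF
        continuous_velocity])
  have "continuous_on ?S (\<lambda>t. ncs_coeff (A_free pt (\<gamma> t) (\<gamma> (seg t0 s0 t)) (velocity \<gamma> t)
      ((- \<kappa>) *\<^sub>R velocity \<gamma> (seg t0 s0 t))) w)"
  proof -
    have nz: "\<gamma> t - pt k \<noteq> 0" "\<gamma> (seg t0 s0 t) - pt k \<noteq> 0" "\<gamma> t - \<gamma> (seg t0 s0 t) \<noteq> 0" if
        "t \<in> ?S" for t k
    proof -
      have t: "0 < t" "t < t0" using that by auto
      show "\<gamma> t - pt k \<noteq> 0" using avoid[of t k] t times by simp
      show "\<gamma> (seg t0 s0 t) - pt k \<noteq> 0" using avoid[of "seg t0 s0 t" k] seg_bounds[OF t] times by simp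
      show "\<gamma> t - \<gamma> (seg t0 s0 t) \<noteq> 0" using no_collision[OF t] by simp
    qed
    show ?thesis
      unfolding A_free_def coeff_simps coeff_sum
      by (intro continuous_intros c cs ballI; erule nz)
  qed
  also have "?this \<longleftrightarrow> continuous_on ?S (\<lambda>t. ncs_coeff (\<Omega> t) w)"
  proof (intro continuous_on_cong refl)
    fix t assume "t \<in> ?S"
    then have t: "0 < t" "t < t0" by auto
    have "vector_derivative \<gamma> (at t) = velocity \<gamma> t"
      using t times by (intro vector_derivative_at has_velocity_at) auto
    moreover have "vector_derivative (\<lambda>t. \<gamma> (seg t0 s0 t)) (at t) = (- \<kappa>) *\<^sub>R velocity \<gamma> (seg t0 s0 t)"
      using seg_bounds[OF t] times by (intro vector_derivative_at has_velocity_seg) auto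
    ultimately show "ncs_coeff (A_free pt (\<gamma> t) (\<gamma> (seg t0 s0 t)) (velocity \<gamma> t)
        ((- \<kappa>) *\<^sub>R velocity \<gamma> (seg t0 s0 t))) w =
        ncs_coeff (\<Omega> t) w"
      by (simp only: \<Omega>_def)
  qed
  finally show ?thesis using assms by (simp add: continuous_on_eq_continuous_at)
qed

section \<open>The equation along the segment\<close>

lemma segment_solution_iff:
  "segment_solution pt \<gamma> t0 s0 \<Psi> \<longleftrightarrow>
     (\<forall>t\<in>{0<..<t0}. has_real_deriv \<Psi> (abs_dk (\<Omega> t) * \<Psi> t) t {0<..<t0})"
  by (simp add: segment_solution_def \<Omega>_def A_zw_abs)

lemma segment_weak_solution:
  "segment_solution pt \<gamma> t0 s0 \<Psi> \<Longrightarrow> dk.weak_solution \<Omega> {0<..<t0} \<Psi>"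
  unfolding segment_solution_iff by (intro dk.weak_solutionI) auto

text \<open>The value at \<open>t1\<close> is lifted and continued upstairs; uniqueness gives
  agreement with \<open>G\<close>. Working with the lift keeps track of the constant coefficient,
  which the equation preserves.\<close>

lemma segment_solution_extends:
  assumes G: "dk.weak_solution \<Omega> {a<..<b} G" and ab: "0 \<le> a" "a < t1" "t1 < b" "b \<le> t0"
    and g: "G t1 = abs_dk g"
  obtains \<Psi> where "segment_solution pt \<gamma> t0 s0 \<Psi>" "\<And>t. t \<in> {a<..<b} \<Longrightarrow> \<Psi> t = G t"
    "\<And>t. \<exists>h. \<Psi> t = abs_dk h \<and> ncs_coeff h [] = ncs_coeff g []"
proof -
  have t1: "ereal 0 < ereal t1" "ereal t1 < ereal t0" using ab by auto
  obtain H where H: "H t1 = g" "\<And>t. ncs_coeff (H t) [] = ncs_coeff g []"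
      "\<And>t S. ereal 0 < ereal t \<Longrightarrow> ereal t < ereal t0 \<Longrightarrow> has_real_deriv H (\<Omega> t * H t) t S"
  proof (rule linear_equation_solution[where a = "ereal 0" and b = "ereal t0" and \<Omega> = \<Omega>
      and ?\<Psi>1.0 = g, OF _ linear_form_\<Omega> t1])
    show "isCont (\<lambda>t. ncs_coeff (\<Omega> t) w) t" if "ereal 0 < ereal t" "ereal t < ereal t0" for t w
      using continuous_\<Omega> that by simp
  qed (use that in auto)
  have ode: "has_real_deriv (\<lambda>t. abs_dk (H t)) (abs_dk (\<Omega> t) * abs_dk (H t)) t S" if
      "t \<in> {0<..<t0}" for t S
    using dk.has_real_deriv_q[OF H(3)[of t S]] that by (simp add: dk.q_mult)
  show ?thesis
  proof (rule that[of "\<lambda>t. abs_dk (H t)"])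
    show "segment_solution pt \<gamma> t0 s0 (\<lambda>t. abs_dk (H t))"
      unfolding segment_solution_iff using ode by blast
    have "dk.weak_solution \<Omega> {a<..<b} (\<lambda>t. abs_dk (H t))"
      using ode ab by (intro dk.weak_solutionI) auto
    from dk.weak_solution_unique[OF this G _ linear_form_\<Omega>, of t1]
    show "abs_dk (H t) = G t" if "t \<in> {a<..<b}" for t
      using that ab H(1) g by auto
    show "\<exists>h. abs_dk (H t) = abs_dk h \<and> ncs_coeff h [] = ncs_coeff g []" for t
      using H(2) by blast
  qed
qed

text \<open>Where both branches are affine the segment is a straight line in the (z, w)-plane, along
  which a local solution in two variables restricts to a solution of the pulled-back
  equation.\<close>

lemma line_weak_solution:
  assumes line: "\<And>t. t \<in> {a<..<b} \<Longrightarrow> \<gamma> t = z0 + of_real t * dz"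
      "\<And>t. t \<in> {a<..<b} \<Longrightarrow> \<gamma> (seg t0 s0 t) = w0 + of_real t * dw"
    and F: "\<And>t. t \<in> {a<..<b} \<Longrightarrow> solves_at pt F (\<gamma> t) (\<gamma> (seg t0 s0 t))"
  shows "dk.weak_solution \<Omega> {a<..<b} (\<lambda>t. F (\<gamma> t) (\<gamma> (seg t0 s0 t)))"
proof (rule dk.weak_solutionI)
  fix t assume t: "t \<in> {a<..<b}"
  have "((\<lambda>s. z0 + of_real s * dz) has_vector_derivative dz) (at t)"
      "((\<lambda>s. w0 + of_real s * dw) has_vector_derivative dw) (at t)"
    by (auto intro!: derivative_eq_intros)
  then have "(\<gamma> has_vector_derivative dz) (at t)"
      "((\<lambda>t. \<gamma> (seg t0 s0 t)) has_vector_derivative dw) (at t)"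
    using line t by (auto intro: has_vector_derivative_transform_within_open[where S = "{a<..<b}"])
  then have \<Omega>: "abs_dk (\<Omega> t) = A_zw pt (\<gamma> t) (\<gamma> (seg t0 s0 t)) dz dw"
    by (simp add: \<Omega>_def A_zw_abs vector_derivative_at)
  have "has_real_deriv (\<lambda>s. F (z0 + of_real s * dz) (w0 + of_real s * dw))
      (A_zw pt (\<gamma> t) (\<gamma> (seg t0 s0 t)) dz dw * F (\<gamma> t) (\<gamma> (seg t0 s0 t))) t {a<..<b}"
    using solves_at_line[of pt F z0 t dz w0 dw] F[OF t] line[OF t] by simp
  from has_real_deriv_cong[OF this t]
  show "has_real_deriv (\<lambda>t. F (\<gamma> t) (\<gamma> (seg t0 s0 t))) (abs_dk (\<Omega> t) * F (\<gamma> t) (\<gamma> (seg t0 s0 t)))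
      t {a<..<b}"
    unfolding \<Omega> using line by simp
qed

lemma start_line:
  obtains b where "0 < b" "b < t0" "\<And>t. t \<in> {0..b} \<Longrightarrow> \<gamma> t = pt i + of_real t * vi"
    "\<And>t. t \<in> {0..b} \<Longrightarrow> \<gamma> (1 - \<kappa> * t) = pt j + of_real t * (of_real \<kappa> * vj)"
proof -
  obtain e1 e2 where e: "0 < e1" "0 < e2" "\<forall>t\<in>{0..e1}. \<gamma> t = pt i + vi * of_real t"
      "\<forall>t\<in>{1 - e2..1}. \<gamma> t = pt j + vj * of_real (1 - t)"
    using path unfolding admissible_path_def by blast
  define b where "b = Min {e1, e2 / \<kappa>, t0 / 2}"
  have b: "0 < b" "b \<le> e1" "b \<le> e2 / \<kappa>" "b < t0"
    using e \<kappa>_pos times by (auto simp: b_def)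
  have "\<kappa> * t \<le> e2" "0 \<le> \<kappa> * t" if "t \<in> {0..b}" for t
  proof -
    have "\<kappa> * t \<le> \<kappa> * b" using that \<kappa>_pos by (intro mult_left_mono) auto
    also have "\<kappa> * b \<le> e2" using b(3) \<kappa>_pos by (simp add: pos_le_divide_eq mult.commute)
    finally show "\<kappa> * t \<le> e2" .
    show "0 \<le> \<kappa> * t" using that \<kappa>_pos by simp
  qed
  then show ?thesis
    using e b by (intro that[of b]) (auto simp: mult_ac)
qed

definition u :: complex where "u = vector_derivative (\<lambda>t. \<gamma> (seg t0 s0 t) - \<gamma> t) (at t0)"

lemma end_line:
  obtains b where "0 < b" "b < t0"
      "\<And>t. t \<in> {t0 - b..t0} \<Longrightarrow> \<gamma> t = \<gamma> t0 + of_real (t - t0) * velocity \<gamma> t0"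
    "\<And>t. t \<in> {t0 - b..t0} \<Longrightarrow> \<gamma> (seg t0 s0 t) = \<gamma> t0 + of_real (t - t0) * ((- \<kappa>) *\<^sub>R velocity \<gamma> s0)"
    "u = (- \<kappa>) *\<^sub>R velocity \<gamma> s0 - velocity \<gamma> t0" "u \<noteq> 0"
proof -
  have aff: "affine_near \<gamma> t0" "affine_near \<gamma> s0" and tr: "transverse (velocity \<gamma> t0) (velocity \<gamma> s0)"
    using path cross unfolding admissible_path_def by auto
  have near: "\<exists>e>0. \<forall>s. \<bar>s - t\<bar> < e \<longrightarrow> \<gamma> s = \<gamma> t + of_real (s - t) * velocity \<gamma> t" if
      "affine_near \<gamma> t" "0 < t" "t < 1" for t
  proof -
    obtain c where "\<forall>\<^sub>F s in nhds t. \<gamma> s = \<gamma> t + of_real (s - t) * c"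
      using \<open>affine_near \<gamma> t\<close> by (auto simp: affine_near_def)
    then obtain e where e: "e > 0" "\<And>s. dist s t < e \<Longrightarrow> \<gamma> s = \<gamma> t + of_real (s - t) * c"
      unfolding eventually_nhds_metric by blast
    have "((\<lambda>s. \<gamma> t + of_real (s - t) * c) has_vector_derivative c) (at t)"
      by (auto intro!: derivative_eq_intros)
    then have "(\<gamma> has_vector_derivative c) (at t)"
    proof (rule has_vector_derivative_transform_within_open[where S = "ball t e"])
      show "\<gamma> t + of_real (s - t) * c = \<gamma> s" if "s \<in> ball t e" for s
        using that by (intro e(2)[symmetric]) (simp add: dist_commute)
    qed (use e(1) in auto)
    then have "c = velocity \<gamma> t" using has_velocity_at[of t] that vector_derivative_unique_at by blast
    then show ?thesis using e unfolding dist_real_def by blast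
  qed
  obtain e1 where e1: "e1 > 0" "\<And>s. \<bar>s - t0\<bar> < e1 \<Longrightarrow> \<gamma> s = \<gamma> t0 + of_real (s - t0) * velocity \<gamma> t0"
    using near[OF aff(1)] times by (metis less_trans)
  obtain e2 where e2: "e2 > 0" "\<And>s. \<bar>s - s0\<bar> < e2 \<Longrightarrow> \<gamma> s = \<gamma> s0 + of_real (s - s0) * velocity \<gamma> s0"
    using near[OF aff(2)] times by (metis less_trans)
  \<comment> \<open>A time step shorter than this moves the second parameter by less than
    \<open>e2\<close>.\<close>
  define c where "c = e2 / \<kappa>"
  define b where "b = Min {e1 / 2, c / 2, t0 / 2}"
  have "0 < c" using e2(1) \<kappa>_pos by (simp add: c_def)
  moreover have "b \<le> e1 / 2" "b \<le> c / 2" "b \<le> t0 / 2" unfolding b_def by (rule Min_le; simp)+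
  ultimately have b: "0 < b" "b < e1" "b < c" "b < t0"
    using e1(1) times(1) by (simp_all add: b_def)
  have seg0: "seg t0 s0 t - s0 = - \<kappa> * (t - t0)" for t
    using \<kappa>_t0 by (simp add: seg_\<kappa> algebra_simps)
  have g2: "\<gamma> (seg t0 s0 t) = \<gamma> t0 + of_real (t - t0) * ((- \<kappa>) *\<^sub>R velocity \<gamma> s0)" if
      "t \<in> {t0 - b..t0}" for t
  proof -
    have "\<kappa> * (t0 - t) \<le> \<kappa> * b" using that \<kappa>_pos by auto
    also have "\<kappa> * b < e2" using b(3) \<kappa>_pos by (simp add: c_def pos_less_divide_eq mult.commute)
    finally have "\<bar>seg t0 s0 t - s0\<bar> < e2" unfolding seg0 using that \<kappa>_pos by (simp add: abs_mult)
    from e2(2)[OF this] show ?thesis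
      unfolding seg0 by (simp add: times scaleR_conv_of_real algebra_simps)
  qed
  have "((\<lambda>t. \<gamma> (seg t0 s0 t) - \<gamma> t) has_vector_derivative
      (- \<kappa>) *\<^sub>R velocity \<gamma> (seg t0 s0 t0) - velocity \<gamma> t0) (at t0)"
    using times \<kappa>_t0 by (intro has_vector_derivative_diff has_velocity_seg has_velocity_at)
        (auto simp: seg_\<kappa>)
  moreover have "seg t0 s0 t0 = s0" using \<kappa>_t0 by (simp add: seg_\<kappa>)
  ultimately have u: "u = (- \<kappa>) *\<^sub>R velocity \<gamma> s0 - velocity \<gamma> t0"
    by (simp add: u_def vector_derivative_at)
  \<comment> \<open>If it were zero, the two velocities at the crossing would be linearly dependent,
    against transversality.\<close>
  moreover have "u \<noteq> 0"
  proof
    assume "u = 0"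
    then have "(- 1) *\<^sub>R velocity \<gamma> t0 + (- \<kappa>) *\<^sub>R velocity \<gamma> s0 = 0" by (simp add: u)
    then show False using tr unfolding transverse_def by fastforce
  qed
  moreover have "\<gamma> t = \<gamma> t0 + of_real (t - t0) * velocity \<gamma> t0" if "t \<in> {t0 - b..t0}" for t
    using that b by (intro e1) auto
  ultimately show ?thesis using b g2 that by blast
qed

end

text \<open>Two directions are allowed because \<open>end_form\<close> provides its direction only
  existentially; agreement at the origin is all that matters.\<close>

lemma (in ncs_quotient) log_negligible_bidisc_diff:
  assumes f: "0 < r" "analytic_bidisc r f" and g: "0 < r'" "analytic_bidisc r' g"
      and eq: "f 0 0 = g 0 0"
  shows "log_negligible (\<lambda>t. f (of_real t * x) (of_real t * y) - g (of_real t * x') (of_real t * y'))"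
proof (rule log_negligibleI)
  fix N \<phi> assume \<phi>: "dual N \<phi>"
  obtain D where D: "((\<lambda>t. \<phi> (f (of_real t * x) (of_real t * y))) has_vector_derivative
      D) (at 0 within {0<..})"
    using analytic_bidisc_dual_deriv[OF \<phi> f] by blast
  obtain E where E: "((\<lambda>t. \<phi> (g (of_real t * x') (of_real t * y'))) has_vector_derivative
      E) (at 0 within {0<..})"
    using analytic_bidisc_dual_deriv[OF \<phi> g] by blast
  show "\<exists>D. ((\<lambda>t. \<phi> (f (of_real t * x) (of_real t * y) - g (of_real t * x') (of_real t * y')))
      has_vector_derivative D) (at 0 within {0<..})"
    using has_vector_derivative_diff[OF D E] by (auto simp: dual_diff[OF \<phi>])
qed (simp add: eq)

context crossing
begin

section \<open>Existence and uniqueness of the two normalized solutions\<close>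

lemma start_base:
  "0 < t \<Longrightarrow> \<gamma> t = pt i + of_real t * vi \<Longrightarrow> (\<gamma> t - pt i) / vi = of_real t"
  "0 < t \<Longrightarrow> \<gamma> (1 - \<kappa> * t) = pt j + of_real t * (of_real \<kappa> * vj) \<Longrightarrow>
     (\<gamma> (seg t0 s0 t) - pt j) / vj = of_real (\<kappa> * t)"
  using velocities by (simp_all add: seg_\<kappa>)

lemma start_exists:
  obtains \<Psi> where "segment_solution pt \<gamma> t0 s0 \<Psi>" "starts_normalized pt i vi j vj \<gamma> t0 s0 \<Psi>"
proof -
  obtain f \<rho> F where f: "0 < \<rho>" "analytic_bidisc \<rho> f" "f 0 0 = 1"
    and F: "F = (\<lambda>z w. f (z - pt i) (w - pt j) *
               monodromy_power ((z - pt i) / vi) (tt (Pt i) Zs) *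
               monodromy_power ((w - pt j) / vj) (tt (Pt j) Ws))"
    and sol: "\<And>z w. norm (z - pt i) < \<rho> \<Longrightarrow> norm (w - pt j) < \<rho> \<Longrightarrow>
           (z - pt i) / vi \<notin> \<real>\<^sub>\<le>\<^sub>0 \<Longrightarrow> (w - pt j) / vj \<notin> \<real>\<^sub>\<le>\<^sub>0 \<Longrightarrow> solves_at pt F z w"
    by (rule start_solution_exists[OF inj ij velocities]) (rule that)
  obtain b1 where b1: "0 < b1" "b1 < t0" "\<And>t. t \<in> {0..b1} \<Longrightarrow> \<gamma> t = pt i + of_real t * vi"
    "\<And>t. t \<in> {0..b1} \<Longrightarrow> \<gamma> (1 - \<kappa> * t) = pt j + of_real t * (of_real \<kappa> * vj)"
    by (rule start_line) (rule that)
  \<comment> \<open>For times below \<open>\<rho> / m\<close> both coordinates stay within the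
    bidisc of the local solution.\<close>
  define m where "m = norm vi + norm (of_real \<kappa> * vj)"
  have m: "0 < m" using velocities by (simp add: m_def add_pos_nonneg)
  define b where "b = min b1 (\<rho> / m)"
  have b: "0 < b" "b \<le> b1" "b \<le> \<rho> / m" using b1 f m by (auto simp: b_def)
  have G: "dk.weak_solution \<Omega> {0<..<b} (\<lambda>t. F (\<gamma> t) (\<gamma> (seg t0 s0 t)))"
  proof (rule line_weak_solution)
    fix t assume t: "t \<in> {0<..<b}"
    then have t1: "t \<in> {0..b1}" "0 < t" using b by auto
    show 1: "\<gamma> t = pt i + of_real t * vi" by (rule b1(3)[OF t1(1)])
    show 2: "\<gamma> (seg t0 s0 t) = pt j + of_real t * (of_real \<kappa> * vj)"
      unfolding seg_\<kappa> by (rule b1(4)[OF t1(1)])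
    have "t * m < \<rho>" using t b m by (simp add: pos_le_divide_eq) (smt (verit) mult_strict_right_mono)
    then have "t * norm vi < \<rho>" "t * norm (of_real \<kappa> * vj) < \<rho>"
      using t1 unfolding m_def distrib_left by (smt (verit) mult_nonneg_nonneg norm_ge_zero)+
    then have n: "norm (of_real t * vi) < \<rho>" "norm (of_real t * (of_real \<kappa> * vj)) < \<rho>"
      using t1 by (simp_all add: norm_mult)
    have "\<gamma> t - pt i = of_real t * vi" "\<gamma> (seg t0 s0 t) - pt j = of_real t * (of_real \<kappa> * vj)"
      unfolding 1 2 by simp_all
    moreover have "complex_of_real (\<kappa> * t) \<notin> \<real>\<^sub>\<le>\<^sub>0" "complex_of_real t \<notin> \<real>\<^sub>\<le>\<^sub>0"
      using t1 \<kappa>_pos by (auto simp: complex_nonpos_Reals_iff mult_le_0_iff)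
    ultimately show "solves_at pt F (\<gamma> t) (\<gamma> (seg t0 s0 t))"
      using n start_base(1)[OF t1(2) 1] start_base(2)[OF t1(2) b1(4)[OF t1(1)]] by (intro sol) simp_all
  qed
  obtain g where g: "F (\<gamma> (b / 2)) (\<gamma> (seg t0 s0 (b / 2))) = abs_dk g" by (rule dk.obtain_lift)
  obtain \<Psi> where \<Psi>: "segment_solution pt \<gamma> t0 s0 \<Psi>" "\<And>t. t \<in> {0<..<b} \<Longrightarrow> \<Psi> t = F (\<gamma> t) (\<gamma> (seg t0 s0 t))"
    by (rule segment_solution_extends[OF G _ _ _ _ g]) (use b b1 in auto)
  have "\<forall>\<^sub>F t in at_right 0. t \<in> {0<..<b}"
    using b by (auto simp: eventually_at_right_field)
  then have "\<forall>\<^sub>F t in at_right 0. \<Psi> t = F (\<gamma> t) (\<gamma> (seg t0 s0 t))"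
    by eventually_elim (rule \<Psi>(2))
  with \<Psi>(1) f F sol show ?thesis
    by (intro that[of \<Psi>]) (auto simp: starts_normalized_def)
qed

text \<open>Time is reversed so that the crossing is approached from the right of 0, where
  logarithmic negligibility is formulated; the base of the power is then the time itself.\<close>

lemma end_coordinates:
  obtains b v where "0 < b" "b < t0"
    "\<And>t. 0 \<le> t \<Longrightarrow> t \<le> b \<Longrightarrow> \<gamma> (t0 - t) - \<gamma> t0 = of_real t * v"
    "\<And>t. 0 \<le> t \<Longrightarrow> t \<le> b \<Longrightarrow> \<gamma> (seg t0 s0 (t0 - t)) - \<gamma> (t0 - t) = of_real t * (- u)"
    "u \<noteq> 0"
proof -
  obtain b where b: "0 < b" "b < t0"
      and g: "\<And>t. t \<in> {t0 - b..t0} \<Longrightarrow> \<gamma> t = \<gamma> t0 + of_real (t - t0) * velocity \<gamma> t0"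
    "\<And>t. t \<in> {t0 - b..t0} \<Longrightarrow> \<gamma> (seg t0 s0 t) = \<gamma> t0 + of_real (t - t0) * ((- \<kappa>) *\<^sub>R velocity \<gamma> s0)"
    and u: "u = (- \<kappa>) *\<^sub>R velocity \<gamma> s0 - velocity \<gamma> t0" "u \<noteq> 0"
    by (rule end_line) (rule that)
  show ?thesis
  proof (rule that[OF b _ _ u(2), of "- velocity \<gamma> t0"])
    fix t :: real assume "0 \<le> t" "t \<le> b"
    then have t: "t0 - t \<in> {t0 - b..t0}" by auto
    show "\<gamma> (t0 - t) - \<gamma> t0 = of_real t * (- velocity \<gamma> t0)"
      using g(1)[OF t] by (simp add: algebra_simps)
    show "\<gamma> (seg t0 s0 (t0 - t)) - \<gamma> (t0 - t) = of_real t * (- u)"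
      unfolding u(1) g(1)[OF t] g(2)[OF t] by (simp add: algebra_simps)
  qed
qed

lemma eventually_left_iff: "(\<forall>\<^sub>F t in at_left t0. P t) \<longleftrightarrow> (\<forall>\<^sub>F t in at_right 0. P (t0 - t))" for P ::
    "real \<Rightarrow> bool"
proof
  assume "\<forall>\<^sub>F t in at_left t0. P t"
  then obtain b where "b < t0" "\<And>y. b < y \<Longrightarrow> y < t0 \<Longrightarrow> P y" by (auto simp: eventually_at_left_field)
  then show "\<forall>\<^sub>F t in at_right 0. P (t0 - t)"
    by (auto simp: eventually_at_right_field intro!: exI[of _ "t0 - b"])
next
  assume "\<forall>\<^sub>F t in at_right 0. P (t0 - t)"
  then obtain b where "0 < b" "\<And>y. 0 < y \<Longrightarrow> y < b \<Longrightarrow> P (t0 - y)" by (auto simp: eventually_at_right_field)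
  from this(1) this(2)[of "t0 - _"] show "\<forall>\<^sub>F t in at_left t0. P t"
    by (auto simp: eventually_at_left_field intro!: exI[of _ "t0 - b"])
qed

lemma tendsto_left_iff: "(g \<longlongrightarrow> l) (at_left t0) \<longleftrightarrow> ((\<lambda>t. g (t0 - t)) \<longlongrightarrow> l) (at_right 0)"
  by (simp add: tendsto_def eventually_left_iff)

lemma end_exists:
  obtains \<Psi> where "segment_solution pt \<gamma> t0 s0 \<Psi>" "ends_normalized pt \<gamma> t0 s0 \<Psi>"
    "\<And>t. \<exists>h. \<Psi> t = abs_dk h \<and> ncs_coeff h [] = 1"
proof -
  obtain b1 v where b1: "0 < b1" "b1 < t0"
    "\<And>t. 0 \<le> t \<Longrightarrow> t \<le> b1 \<Longrightarrow> \<gamma> (t0 - t) - \<gamma> t0 = of_real t * v"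
    "\<And>t. 0 \<le> t \<Longrightarrow> t \<le> b1 \<Longrightarrow> \<gamma> (seg t0 s0 (t0 - t)) - \<gamma> (t0 - t) = of_real t * (- u)"
    and u: "u \<noteq> 0"
    by (rule end_coordinates) (rule that)
  have a: "\<gamma> t0 \<notin> range pt" using avoid[of t0] times by auto
  obtain f \<rho> F where f: "0 < \<rho>" "analytic_bidisc \<rho> f" "f 0 0 = 1"
    and F: "F = (\<lambda>z w. f (z - \<gamma> t0) (w - z) * monodromy_power ((w - z) / (- u)) (tt Zs Ws))"
    and sol: "\<And>z w. norm (z - \<gamma> t0) < \<rho> \<Longrightarrow> norm (w - z) < \<rho> \<Longrightarrow>
           (w - z) / (- u) \<notin> \<real>\<^sub>\<le>\<^sub>0 \<Longrightarrow> solves_at pt F z w"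
    and unit: "\<And>x y. \<exists>g. f x y = abs_dk g \<and> ncs_coeff g [] = 1"
    by (rule end_solution_exists[OF a u]) (rule that)
  define m where "m = norm v + norm u"
  have m: "0 < m" using u by (simp add: m_def add_nonneg_pos)
  define b where "b = min b1 (\<rho> / m)"
  have b: "0 < b" "b \<le> b1" "b \<le> \<rho> / m" using b1 f m by (auto simp: b_def)
  have G: "dk.weak_solution \<Omega> {t0 - b<..<t0} (\<lambda>t. F (\<gamma> t) (\<gamma> (seg t0 s0 t)))"
  proof (rule line_weak_solution)
    fix t assume t: "t \<in> {t0 - b<..<t0}"
    define s where "s = t0 - t"
    have s: "0 < s" "s < b" "0 \<le> s" "s \<le> b1" "t = t0 - s" using t b by (auto simp: s_def)
    show "\<gamma> t = (\<gamma> t0 + of_real t0 * v) + of_real t * (- v)"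
      using b1(3)[OF s(3,4)] by (simp add: s(5) algebra_simps)
    show "\<gamma> (seg t0 s0 t) = (\<gamma> t0 + of_real t0 * (v - u)) + of_real t * (u - v)"
      using b1(3)[OF s(3,4)] b1(4)[OF s(3,4)] by (simp add: s(5) algebra_simps)
    have "s * m < \<rho>" using s b m by (simp add: pos_le_divide_eq) (smt (verit) mult_strict_right_mono)
    then have n: "s * norm v < \<rho>" "s * norm u < \<rho>"
      using s unfolding m_def distrib_left by (smt (verit) mult_nonneg_nonneg norm_ge_zero)+
    show "solves_at pt F (\<gamma> t) (\<gamma> (seg t0 s0 t))"
      unfolding s(5)
    proof (rule sol; (subst b1(3)[OF s(3,4)] b1(4)[OF s(3,4)])?)
      show "norm (of_real s * v) < \<rho>" "norm (of_real s * (- u)) < \<rho>" using n s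
          by (simp_all add: norm_mult)
      show "of_real s * (- u) / (- u) \<notin> \<real>\<^sub>\<le>\<^sub>0" using s u by simp
    qed
  qed
  obtain g where g: "f (\<gamma> (t0 - b / 2) - \<gamma> t0) (\<gamma> (seg t0 s0 (t0 - b / 2)) - \<gamma> (t0 - b / 2)) =
      abs_dk g" "ncs_coeff g [] = 1"
    using unit by blast
  \<comment> \<open>A lift of the local solution at the starting time; both of its factors have
    constant coefficient 1, so the continued solution is invertible everywhere.\<close>
  define g' where "g' = g * letter_exp (Abs_gen {Zs,
      Ws}) (Ln ((\<gamma> (seg t0 s0 (t0 - b / 2)) - \<gamma> (t0 - b / 2)) / (- u)) / two_pi_i)"
  have g': "F (\<gamma> (t0 - b / 2)) (\<gamma> (seg t0 s0 (t0 - b / 2))) = abs_dk g'"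
    unfolding F g(1) g'_def tt_abs free_t_letter dk.monodromy_power_letter dk.q_mult ..
  have g'1: "ncs_coeff g' [] = 1"
    by (simp add: g'_def coeff_mult_Nil g(2) coeff_letter_exp)
  obtain \<Psi> where \<Psi>: "segment_solution pt \<gamma> t0 s0 \<Psi>"
      "\<And>t. t \<in> {t0 - b<..<t0} \<Longrightarrow> \<Psi> t = F (\<gamma> t) (\<gamma> (seg t0 s0 t))"
      "\<And>t. \<exists>h. \<Psi> t = abs_dk h \<and> ncs_coeff h [] = ncs_coeff g' []"
    by (rule segment_solution_extends[OF G _ _ _ _ g']) (use b b1 in auto)
  have "\<forall>\<^sub>F t in at_left t0. t \<in> {t0 - b<..<t0}"
    using b by (auto simp: eventually_at_left_field intro!: exI[of _ "t0 - b"])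
  then have "\<forall>\<^sub>F t in at_left t0. \<Psi> t = F (\<gamma> t) (\<gamma> (seg t0 s0 t))"
    by eventually_elim (rule \<Psi>(2))
  then have "ends_normalized pt \<gamma> t0 s0 \<Psi>"
    using f F sol unfolding ends_normalized_def Let_def u_def[symmetric]
    by (intro exI[of _ f] exI[of _ \<rho>] exI[of _ F]) auto
  with \<Psi>(1,3) g'1 show ?thesis by (intro that[of \<Psi>]) auto
qed

lemma start_form:
  assumes "starts_normalized pt i vi j vj \<gamma> t0 s0 \<Psi>"
  obtains f \<rho> where "0 < \<rho>" "analytic_bidisc \<rho> f" "f 0 0 = 1"
    "\<forall>\<^sub>F t in at_right 0. \<Psi> t = f (of_real t * vi) (of_real t * (of_real \<kappa> * vj)) *
       monodromy_power (of_real (1 * t)) (tt (Pt i) Zs) * monodromy_power (of_real (\<kappa> * t))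
           (tt (Pt j) Ws)"
proof -
  obtain f \<rho> F where f: "0 < \<rho>" "analytic_bidisc \<rho> f" "f 0 0 = 1"
    and F: "F = (\<lambda>z w. f (z - pt i) (w - pt j) *
               monodromy_power ((z - pt i) / vi) (tt (Pt i) Zs) *
               monodromy_power ((w - pt j) / vj) (tt (Pt j) Ws))"
    and \<Psi>: "\<forall>\<^sub>F t in at_right 0. \<Psi> t = F (\<gamma> t) (\<gamma> (seg t0 s0 t))"
    using assms unfolding starts_normalized_def by blast
  obtain b where b: "0 < b" "b < t0" "\<And>t. t \<in> {0..b} \<Longrightarrow> \<gamma> t = pt i + of_real t * vi"
    "\<And>t. t \<in> {0..b} \<Longrightarrow> \<gamma> (1 - \<kappa> * t) = pt j + of_real t * (of_real \<kappa> * vj)"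
    by (rule start_line) (rule that)
  have "\<forall>\<^sub>F t in at_right 0. t \<in> {0<..b}"
    using b by (auto simp: eventually_at_right_field)
  with \<Psi> have "\<forall>\<^sub>F t in at_right 0. \<Psi> t = f (of_real t * vi) (of_real t * (of_real \<kappa> * vj)) *
       monodromy_power (of_real (1 * t)) (tt (Pt i) Zs) * monodromy_power (of_real (\<kappa> * t))
           (tt (Pt j) Ws)"
  proof eventually_elim
    case (elim t)
    then have t: "0 < t" "t \<in> {0..b}" by auto
    have "\<gamma> t - pt i = of_real t * vi" "\<gamma> (seg t0 s0 t) - pt j = of_real t * (of_real \<kappa> * vj)"
      unfolding seg_\<kappa> b(3)[OF t(2)] b(4)[OF t(2)] by simp_all
    then show ?case
      using elim(1) start_base(1)[OF t(1) b(3)[OF t(2)]] start_base(2)[OF t(1) b(4)[OF t(2)]]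
      by (simp add: F)
  qed
  with f show ?thesis by (rule that)
qed

lemma end_form:
  assumes "ends_normalized pt \<gamma> t0 s0 \<Psi>"
  obtains f \<rho> v where "0 < \<rho>" "analytic_bidisc \<rho> f" "f 0 0 = 1"
    "\<forall>\<^sub>F t in at_right 0. \<Psi> (t0 - t) =
        f (of_real t * v) (of_real t * (- u)) * monodromy_power (of_real (1 * t)) (tt Zs Ws)"
proof -
  obtain f \<rho> F where f: "0 < \<rho>" "analytic_bidisc \<rho> f" "f 0 0 = 1"
    and F: "F = (\<lambda>z w. f (z - \<gamma> t0) (w - z) * monodromy_power ((w - z) / (- u)) (tt Zs Ws))"
    and \<Psi>: "\<forall>\<^sub>F t in at_left t0. \<Psi> t = F (\<gamma> t) (\<gamma> (seg t0 s0 t))"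
    using assms unfolding ends_normalized_def Let_def u_def[symmetric] by blast
  obtain b v where b: "0 < b" "b < t0"
    "\<And>t. 0 \<le> t \<Longrightarrow> t \<le> b \<Longrightarrow> \<gamma> (t0 - t) - \<gamma> t0 = of_real t * v"
    "\<And>t. 0 \<le> t \<Longrightarrow> t \<le> b \<Longrightarrow> \<gamma> (seg t0 s0 (t0 - t)) - \<gamma> (t0 - t) = of_real t * (- u)"
    and u: "u \<noteq> 0"
    by (rule end_coordinates) (rule that)
  have "\<forall>\<^sub>F t in at_right 0. t \<in> {0<..b}"
    using b by (auto simp: eventually_at_right_field)
  with \<Psi>[unfolded eventually_left_iff]
  have "\<forall>\<^sub>F t in at_right 0. \<Psi> (t0 - t) =
      f (of_real t * v) (of_real t * (- u)) * monodromy_power (of_real (1 * t)) (tt Zs Ws)"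
  proof eventually_elim
    case (elim t)
    then have t: "0 \<le> t" "t \<le> b" by auto
    have "of_real t * (- u) / (- u) = of_real (1 * t)" using u by simp
    then show ?case unfolding elim(1) F b(3)[OF t] b(4)[OF t] by simp
  qed
  with f show ?thesis by (rule that)
qed

lemma start_unique:
  assumes \<Psi>: "segment_solution pt \<gamma> t0 s0 \<Psi>" "starts_normalized pt i vi j vj \<gamma> t0 s0 \<Psi>"
    and \<Phi>: "segment_solution pt \<gamma> t0 s0 \<Phi>" "starts_normalized pt i vi j vj \<gamma> t0 s0 \<Phi>"
    and t: "t \<in> {0<..<t0}"
  shows "\<Psi> t = \<Phi> t"
proof -
  let ?P = "\<lambda>t. monodromy_power (of_real (1 * t)) (tt (Pt i) Zs)"
      and ?Q = "\<lambda>t. monodromy_power (of_real (\<kappa> * t)) (tt (Pt j) Ws)"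
  obtain f \<rho> where f: "0 < \<rho>" "analytic_bidisc \<rho> f" "f 0 0 = 1"
      "\<forall>\<^sub>F t in at_right 0. \<Psi> t = f (of_real t * vi) (of_real t * (of_real \<kappa> * vj)) * ?P t * ?Q t"
    by (rule start_form[OF \<Psi>(2)]) (rule that)
  obtain g \<rho>' where g: "0 < \<rho>'" "analytic_bidisc \<rho>' g" "g 0 0 = 1"
      "\<forall>\<^sub>F t in at_right 0. \<Phi> t = g (of_real t * vi) (of_real t * (of_real \<kappa> * vj)) * ?P t * ?Q t"
    by (rule start_form[OF \<Phi>(2)]) (rule that)
  have "dk.log_negligible (\<lambda>t. f (of_real t * vi) (of_real t * (of_real \<kappa> * vj)) - g
      (of_real t * vi) (of_real t * (of_real \<kappa> * vj)))"
    by (rule dk.log_negligible_bidisc_diff[OF f(1,2) g(1,2)]) (simp add: f g)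
  \<comment> \<open>The two powers are multiplied on successively; the base of the second is
    \<open>\<kappa> * t\<close> because the reversed branch is traversed at relative speed
    \<open>\<kappa>\<close>.\<close>
  from dk.log_negligible_mult_power[OF dk.log_negligible_mult_power[OF this zero_less_one, of
      "Abs_gen {Pt i, Zs}"] \<kappa>_pos, of "Abs_gen {Pt j, Ws}"]
  have neg: "dk.log_negligible (\<lambda>t. \<Psi> t - \<Phi> t)"
  proof (rule dk.log_negligible_cong)
    show "\<forall>\<^sub>F t in at_right 0. (f (of_real t * vi) (of_real t * (of_real \<kappa> * vj)) - g
        (of_real t * vi) (of_real t * (of_real \<kappa> * vj))) *
        monodromy_power (of_real (1 * t)) (abs_dk (letter (Abs_gen {Pt i, Zs}))) *
        monodromy_power (of_real (\<kappa> * t)) (abs_dk (letter (Abs_gen {Pt j, Ws}))) = \<Psi> t - \<Phi> t"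
      using f(4) g(4) by eventually_elim (simp only: tt_abs free_t_letter left_diff_distrib)
  qed
  have "\<Psi> t - \<Phi> t = 0"
  proof (rule dk.weak_solution_vanish[OF dk.weak_solution_diff[OF segment_weak_solution[OF \<Psi>(1)]
      segment_weak_solution[OF \<Phi>(1)]]])
    show "\<forall>\<^sub>F t in at_right 0. t \<in> {0<..<t0}" using times by (auto simp: eventually_at_right_field)
    show "((\<lambda>t. \<phi> (\<Psi> t - \<Phi> t)) \<longlongrightarrow> 0) (at_right 0)" if "dk.dual N \<phi>" for N \<phi>
      by (rule dk.log_negligible_tendsto[OF neg that])
  qed (use t in \<open>auto simp: trivial_limit_at_right_real linear_form_\<Omega>\<close>)
  then show ?thesis by simp
qed

lemma end_unique:
  assumes \<Psi>: "segment_solution pt \<gamma> t0 s0 \<Psi>" "ends_normalized pt \<gamma> t0 s0 \<Psi>"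
    and \<Phi>: "segment_solution pt \<gamma> t0 s0 \<Phi>" "ends_normalized pt \<gamma> t0 s0 \<Phi>"
    and t: "t \<in> {0<..<t0}"
  shows "\<Psi> t = \<Phi> t"
proof -
  let ?P = "\<lambda>t. monodromy_power (of_real (1 * t)) (tt Zs Ws)"
  obtain f \<rho> v where f: "0 < \<rho>" "analytic_bidisc \<rho> f" "f 0 0 = 1"
      "\<forall>\<^sub>F t in at_right 0. \<Psi> (t0 - t) = f (of_real t * v) (of_real t * (- u)) * ?P t"
    by (rule end_form[OF \<Psi>(2)]) (rule that)
  obtain g \<rho>' v' where g: "0 < \<rho>'" "analytic_bidisc \<rho>' g" "g 0 0 = 1"
      "\<forall>\<^sub>F t in at_right 0. \<Phi> (t0 - t) = g (of_real t * v') (of_real t * (- u)) * ?P t"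
    by (rule end_form[OF \<Phi>(2)]) (rule that)
  have "dk.log_negligible (\<lambda>t. f (of_real t * v) (of_real t * (- u)) - g (of_real t * v')
      (of_real t * (- u)))"
    by (rule dk.log_negligible_bidisc_diff[OF f(1,2) g(1,2)]) (simp add: f g)
  from dk.log_negligible_mult_power[OF this zero_less_one, of "Abs_gen {Zs, Ws}"]
  have neg: "dk.log_negligible (\<lambda>t. \<Psi> (t0 - t) - \<Phi> (t0 - t))"
  proof (rule dk.log_negligible_cong)
    show "\<forall>\<^sub>F t in at_right 0. (f (of_real t * v) (of_real t * (- u)) - g (of_real t * v')
        (of_real t * (- u))) *
        monodromy_power (of_real (1 * t)) (abs_dk (letter (Abs_gen {Zs, Ws}))) =
            \<Psi> (t0 - t) - \<Phi> (t0 - t)"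
      using f(4) g(4) by eventually_elim (simp only: tt_abs free_t_letter left_diff_distrib)
  qed
  have "\<Psi> t - \<Phi> t = 0"
  proof (rule dk.weak_solution_vanish[OF dk.weak_solution_diff[OF segment_weak_solution[OF \<Psi>(1)]
      segment_weak_solution[OF \<Phi>(1)]]])
    show "\<forall>\<^sub>F t in at_left t0. t \<in> {0<..<t0}" using times by (auto simp: eventually_at_left_field)
    show "((\<lambda>t. \<phi> (\<Psi> t - \<Phi> t)) \<longlongrightarrow> 0) (at_left t0)" if "dk.dual N \<phi>" for N \<phi>
      unfolding tendsto_left_iff by (rule dk.log_negligible_tendsto[OF neg that])
  qed (use t in \<open>auto simp: trivial_limit_at_left_real linear_form_\<Omega>\<close>)
  then show ?thesis by simp
qed

text \<open>Resolves the definite description once and for all, and states the outcome as a product,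
  so that the inverse does not reappear.\<close>

lemma C_hol_property:
  obtains \<Psi>5 \<Psi>a where "segment_solution pt \<gamma> t0 s0 \<Psi>5" "starts_normalized pt i vi j vj \<gamma> t0 s0 \<Psi>5"
    "segment_solution pt \<gamma> t0 s0 \<Psi>a" "ends_normalized pt \<gamma> t0 s0 \<Psi>a"
    "\<And>t. t \<in> {0<..<t0} \<Longrightarrow> \<Psi>a t * C_hol pt i vi j vj \<gamma> t0 s0 = \<Psi>5 t"
proof -
  obtain \<Psi>5 where \<Psi>5: "segment_solution pt \<gamma> t0 s0 \<Psi>5" "starts_normalized pt i vi j vj \<gamma> t0 s0 \<Psi>5"
    by (rule start_exists) (rule that)
  obtain \<Psi>a where \<Psi>a: "segment_solution pt \<gamma> t0 s0 \<Psi>a" "ends_normalized pt \<gamma> t0 s0 \<Psi>a"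
      "\<And>t. \<exists>h. \<Psi>a t = abs_dk h \<and> ncs_coeff h [] = 1"
    by (rule end_exists) (rule that)
  have inv: "\<Psi>a t * alg_inverse (\<Psi>a t) = 1" "alg_inverse (\<Psi>a t) * \<Psi>a t = 1" for t
  proof -
    obtain h where h: "\<Psi>a t = abs_dk h" "ncs_coeff h [] = 1" using \<Psi>a(3) by blast
    obtain g where "h * g = 1" "g * h = 1" by (rule ncs_unit[OF h(2)])
    then have "\<Psi>a t * abs_dk g = 1" "abs_dk g * \<Psi>a t = 1"
      by (simp_all add: h(1) dk.q_mult[symmetric] dk.q_one)
    then show "\<Psi>a t * alg_inverse (\<Psi>a t) = 1" "alg_inverse (\<Psi>a t) * \<Psi>a t = 1"
      using alg_inverse_eqI by metis+
  qed
  define C where "C = alg_inverse (\<Psi>a (t0 / 2)) * \<Psi>5 (t0 / 2)"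
  \<comment> \<open>Right multiplication by a constant preserves solutions, and both sides agree at
    the midpoint by the choice of \<open>C\<close>.\<close>
  have C: "\<Psi>a t * C = \<Psi>5 t" if "t \<in> {0<..<t0}" for t
  proof (rule dk.weak_solution_unique[OF dk.weak_solution_mult_const[OF segment_weak_solution[OF
      \<Psi>a(1)]] segment_weak_solution[OF \<Psi>5(1)]])
    show "\<Psi>a (t0 / 2) * C = \<Psi>5 (t0 / 2)"
      by (simp add: C_def mult.assoc[symmetric] inv)
  qed (use that times in \<open>auto simp: linear_form_\<Omega>\<close>)
  have "C_hol pt i vi j vj \<gamma> t0 s0 = C"
    unfolding C_hol_def
  proof (rule the_equality)
    have "C = alg_inverse (\<Psi>a t) * \<Psi>5 t" if "t \<in> {0<..<t0}" for t
      unfolding C[OF that, symmetric] by (simp add: mult.assoc[symmetric] inv)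
    then show "\<exists>\<Psi>5 \<Psi>a. segment_solution pt \<gamma> t0 s0 \<Psi>5 \<and> starts_normalized pt i vi j vj \<gamma> t0 s0 \<Psi>5 \<and>
        segment_solution pt \<gamma> t0 s0 \<Psi>a \<and> ends_normalized pt \<gamma> t0 s0 \<Psi>a \<and>
        (\<forall>t\<in>{0<..<t0}. C = alg_inverse (\<Psi>a t) * \<Psi>5 t)"
      using \<Psi>5 \<Psi>a(1,2) by blast
    fix C' assume "\<exists>\<Psi>5 \<Psi>a. segment_solution pt \<gamma> t0 s0 \<Psi>5 \<and> starts_normalized pt i vi j vj \<gamma> t0 s0 \<Psi>5 \<and>
        segment_solution pt \<gamma> t0 s0 \<Psi>a \<and> ends_normalized pt \<gamma> t0 s0 \<Psi>a \<and>
        (\<forall>t\<in>{0<..<t0}. C' = alg_inverse (\<Psi>a t) * \<Psi>5 t)"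
    then obtain \<Phi>5 \<Phi>a where \<Phi>: "segment_solution pt \<gamma> t0 s0 \<Phi>5"
        "starts_normalized pt i vi j vj \<gamma> t0 s0 \<Phi>5"
        "segment_solution pt \<gamma> t0 s0 \<Phi>a" "ends_normalized pt \<gamma> t0 s0 \<Phi>a"
        "\<forall>t\<in>{0<..<t0}. C' = alg_inverse (\<Phi>a t) * \<Phi>5 t"
      by blast
    have "t0 / 2 \<in> {0<..<t0}" using times by simp
    then show "C' = C"
      using \<Phi>(5) start_unique[OF \<Psi>5 \<Phi>(1,2)] end_unique[OF \<Psi>a(1,2) \<Phi>(3,4)] by (simp add: C_def)
  qed
  with C show ?thesis using \<Psi>5 \<Psi>a that by blast
qed

section \<open>The two branches as tangential paths\<close>

lemma tangential_path_z: "tangential_path pt i vi \<gamma> (velocity \<gamma>) t0"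
  unfolding tangential_path_def
proof (intro conjI ballI)
  have sub: "{0..t0} \<subseteq> {0..1}" using times by auto
  show "(\<gamma> has_vector_derivative velocity \<gamma> t) (at t within {0..t0})" if "t \<in> {0..t0}" for t
    using has_vector_derivative_within_subset[OF has_velocity sub] that sub by blast
  show "continuous_on {0..t0} (velocity \<gamma>)" by (rule continuous_on_subset[OF continuous_velocity sub])
  show "\<gamma> t \<notin> range pt" if "t \<in> {0<..t0}" for t using that avoid[of t] times by auto
  show "\<exists>\<epsilon>>0. \<forall>t\<in>{0..\<epsilon>}. \<gamma> t = pt i + vi * of_real t"
    using path by (simp add: admissible_path_def)
qed (use inj times velocities in auto)

lemma tangential_path_w: "tangential_path pt j vj (\<lambda>t. \<gamma> (1 - t)) (\<lambda>t. - velocity \<gamma> (1 - t)) (1 - s0)"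
  unfolding tangential_path_def
proof (intro conjI ballI)
  have sub: "(\<lambda>t. 1 - t) ` {0..1 - s0} \<subseteq> {0..1}" using times by auto
  show "((\<lambda>t. \<gamma> (1 - t)) has_vector_derivative - velocity \<gamma> (1 - t)) (at t within {0..1 - s0})" if
      "t \<in> {0..1 - s0}" for t
  proof -
    have "((\<lambda>t. 1 - t) has_vector_derivative - 1) (at t within {0..1 - s0})"
      by (auto intro!: derivative_eq_intros)
    moreover have "(\<gamma> has_vector_derivative
        velocity \<gamma> (1 - t)) (at (1 - t) within (\<lambda>t. 1 - t) ` {0..1 - s0})"
      using has_vector_derivative_within_subset[OF has_velocity sub] that sub by blast
    ultimately show ?thesis
      using vector_diff_chain_within by (fastforce simp: o_def)
  qed
  show "continuous_on {0..1 - s0} (\<lambda>t. - velocity \<gamma> (1 - t))"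
    using sub by (intro continuous_intros continuous_on_compose2[OF continuous_velocity]) auto
  show "\<gamma> (1 - t) \<notin> range pt" if "t \<in> {0<..1 - s0}" for t using that avoid[of "1 - t"] times by auto
  obtain e where e: "0 < e" "\<forall>t\<in>{1 - e..1}. \<gamma> t = pt j + vj * of_real (1 - t)"
    using path unfolding admissible_path_def by blast
  then show "\<exists>\<epsilon>>0. \<forall>t\<in>{0..\<epsilon>}. \<gamma> (1 - t) = pt j + vj * of_real t"
    by (intro exI[of _ e]) auto
qed (use inj times velocities in auto)

end

section \<open>Reduction modulo \<open>t_zw\<close>\<close>

lemma dkq_tzw: "abs_dkq (free_t Zs Ws) = 0"
  using closed_ideal_superset[of "insert (free_t Zs Ws) dk_relators"]
  by (auto simp: zero_dkq_def dkq.abs_eq_iff)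

text \<open>Distinct points give disjoint strands. For equal points the bracket is, up to sign, a
  bracket with t_zw, which is zero in this quotient.\<close>

lemma dkq_commute:
  "abs_dkq (free_t (Pt k) Zs) * abs_dkq (free_t (Pt l) Ws) =
      abs_dkq (free_t (Pt l) Ws) * abs_dkq (free_t (Pt k) Zs)"
proof (cases "k = l")
  case True
  have "proj (commutator (tt Zs Ws) (tt (Pt k) Ws)) = proj (- commutator (tt (Pt k) Zs) (tt (Pt k) Ws))"
    by (simp add: tt_brackets)
  then show ?thesis
    by (simp add: True commutator_def tt_abs dk.q_simps[symmetric] proj_abs dkq.q_simps dkq_tzw)
next
  case False
  then have "proj (tt (Pt k) Zs * tt (Pt l) Ws) = proj (tt (Pt l) Ws * tt (Pt k) Zs)"
    by (simp add: tt_disjoint_commute)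
  then show ?thesis by (simp add: tt_abs proj_simps proj_abs)
qed

lemma dkq_power_tzw: "proj (monodromy_power b (tt Zs Ws)) = (1 :: 'n dkq)"
proof -
  \<comment> \<open>The letter becomes 0 in the quotient, so the scalar is irrelevant and the known
    formula may be used at scalar 0.\<close>
  have "alg_exp (c *\<^sub>C abs_dkq (letter (Abs_gen {Zs, Ws}))) = (1 :: 'n dkq)" for c
    using dkq.alg_exp_letter[of 0 "Abs_gen {Zs, Ws :: 'n strand}"] dkq_tzw[where ?'a = 'n]
    by (simp add: free_t_letter letter_exp_zero dkq.q_one)
  then show ?thesis
    by (simp add: tt_abs free_t_letter dk.monodromy_power_letter proj_abs dkq.alg_exp_letter[symmetric])
qed

lemma has_real_deriv_ncs_compose:
  fixes f :: "real \<Rightarrow> 'g ncs"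
  assumes "has_real_deriv f D (c * t) S" "(\<lambda>t. c * t) ` T \<subseteq> S"
  shows "has_real_deriv (\<lambda>t. f (c * t)) (of_real c *\<^sub>C D) t T"
  unfolding has_real_deriv_ncs_iff
proof
  fix w
  have "((\<lambda>t. c * t) has_vector_derivative c) (at t within T)"
    by (auto intro!: derivative_eq_intros)
  moreover have "((\<lambda>s. ncs_coeff (f s) w) has_vector_derivative
      ncs_coeff D w) (at (c * t) within (\<lambda>t. c * t) ` T)"
    using assms by (auto simp: has_real_deriv_ncs_iff intro: has_vector_derivative_within_subset)
  ultimately show "((\<lambda>t. ncs_coeff (f (c * t)) w) has_vector_derivative
      ncs_coeff (of_real c *\<^sub>C D) w) (at t within T)"
    using vector_diff_chain_within by (fastforce simp: o_def scaleR_conv_of_real)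
qed

lemma has_real_deriv_subset: "has_real_deriv f D t S \<Longrightarrow> T \<subseteq> S \<Longrightarrow> has_real_deriv f D t T"
  unfolding has_real_deriv_def by (rule tendsto_within_subset)

lemma (in crossing) projection_formula:
  assumes z: "tangential_solution pt (\<lambda>k. free_t (Pt k) Zs) i vi \<gamma> t0 \<Psi>z"
    and w: "tangential_solution pt (\<lambda>k. free_t (Pt k) Ws) j vj (\<lambda>t. \<gamma> (1 - t)) (1 - s0) \<Psi>w"
  shows "proj (C_hol pt i vi j vj \<gamma> t0 s0) = abs_dkq (\<Psi>z t0) * abs_dkq (\<Psi>w (1 - s0))"
proof -
  define a1 a2 where "a1 = Abs_gen {Pt i, Zs}" and "a2 = Abs_gen {Pt j, Ws}"
  \<comment> \<open>The holonomy along the reversed branch, run with the parameter of the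
    segment.\<close>
  define W where "W = (\<lambda>t. \<Psi>w (\<kappa> * t))"
  let ?S = "{0<..<t0}"
  obtain \<Psi>5 \<Psi>a where \<Psi>5: "segment_solution pt \<gamma> t0 s0 \<Psi>5" "starts_normalized pt i vi j vj \<gamma> t0 s0 \<Psi>5"
    and \<Psi>a: "segment_solution pt \<gamma> t0 s0 \<Psi>a" "ends_normalized pt \<gamma> t0 s0 \<Psi>a"
    and C: "\<And>t. t \<in> ?S \<Longrightarrow> \<Psi>a t * C_hol pt i vi j vj \<gamma> t0 s0 = \<Psi>5 t"
    by (rule C_hol_property) (rule that)
  note linz = linear_form_free_t[of "Pt _" Zs] and linw = linear_form_free_t[of "Pt _" Ws]
  have zq: "tangential_solution pt (\<lambda>k. abs_dkq (free_t (Pt k) Zs)) i vi \<gamma> t0 (\<lambda>t. abs_dkq (\<Psi>z t))"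
    by (rule dkq.tangential_solution_q[OF z free_t_letter])
  have wq: "tangential_solution pt (\<lambda>k. abs_dkq (free_t (Pt k) Ws)) j vj (\<lambda>t. \<gamma> (1 - t)) (1 - s0)
      (\<lambda>t. abs_dkq (\<Psi>w t))"
    by (rule dkq.tangential_solution_q[OF w free_t_letter])
  have commz: "abs_dkq (free_t (Pt l) Ws) * abs_dkq (\<Psi>z t) =
      abs_dkq (\<Psi>z t) * abs_dkq (free_t (Pt l) Ws)" if "t \<in> {0<..t0}" for l t
    by (rule dkq.tangential_solution_commute[OF tangential_path_z linear_form_free_t free_t_letter
        zq _ that])
      (simp add: dkq_commute)
  have commw: "abs_dkq (free_t (Pt l) Zs) * abs_dkq (\<Psi>w t) =
      abs_dkq (\<Psi>w t) * abs_dkq (free_t (Pt l) Zs)" if "t \<in> {0<..1 - s0}" for l t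
    by (rule dkq.tangential_solution_commute[OF tangential_path_w linear_form_free_t free_t_letter
        wq _ that])
      (simp add: dkq_commute)
  have \<kappa>t: "0 < \<kappa> * t" "\<kappa> * t < 1 - s0" if "t \<in> ?S" for t
    using that \<kappa>_pos mult_strict_left_mono[of t t0 \<kappa>] \<kappa>_t0 by auto
  have \<kappa>S: "(\<lambda>t. \<kappa> * t) ` ?S \<subseteq> {0<..1 - s0}"
  proof
    fix x assume "x \<in> (\<lambda>t. \<kappa> * t) ` ?S"
    then obtain t where "x = \<kappa> * t" "t \<in> ?S" by blast
    then show "x \<in> {0<..1 - s0}" using \<kappa>t[of t] by simp
  qed
  have prod: "dkq.weak_solution \<Omega> ?S (\<lambda>t. abs_dkq (\<Psi>z t * W t))"
  proof (rule dkq.weak_solutionI)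
    fix t assume t: "t \<in> ?S"
    define \<Omega>z where "\<Omega>z = log_form pt (\<lambda>k. free_t (Pt k) Zs) (\<gamma> t) (velocity \<gamma> t)"
    define \<Omega>w where "\<Omega>w = log_form pt (\<lambda>k. free_t (Pt k) Ws) (\<gamma> (seg t0 s0 t))
        ((- \<kappa>) *\<^sub>R velocity \<gamma> (seg t0 s0 t))"
    have vz: "vector_derivative \<gamma> (at t within {0..t0}) = velocity \<gamma> t"
      using tangential_path_z t times vector_derivative_within_cbox[of 0 t0 t \<gamma> "velocity \<gamma> t"]
      by (auto simp: tangential_path_def)
    have vw: "vector_derivative (\<lambda>t. \<gamma> (1 - t)) (at (\<kappa> * t) within {0..1 - s0}) =
        - velocity \<gamma> (seg t0 s0 t)"
      using tangential_path_w \<kappa>t[OF t] times vector_derivative_within_cbox[of 0 "1 - s0" "\<kappa> * t"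
          "\<lambda>t. \<gamma> (1 - t)" "- velocity \<gamma> (1 - \<kappa> * t)"]
      by (auto simp: tangential_path_def seg_\<kappa>)
    have "has_real_deriv \<Psi>z (\<Omega>z * \<Psi>z t) t {0<..t0}"
      using z t unfolding tangential_solution_def vz[symmetric] \<Omega>z_def by auto
    then have dz: "has_real_deriv \<Psi>z (\<Omega>z * \<Psi>z t) t ?S"
      by (rule has_real_deriv_subset) auto
    have "has_real_deriv \<Psi>w (log_form pt (\<lambda>k. free_t (Pt k) Ws) (\<gamma> (1 - \<kappa> * t))
        (vector_derivative (\<lambda>t. \<gamma> (1 - t)) (at (\<kappa> * t) within {0..1 - s0})) * \<Psi>w (\<kappa> * t)) (\<kappa> * t)
            {0<..1 - s0}"
      using w \<kappa>t[OF t] unfolding tangential_solution_def by simp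
    then have "has_real_deriv W (of_real \<kappa> *\<^sub>C (log_form pt (\<lambda>k. free_t (Pt k) Ws)
        (\<gamma> (seg t0 s0 t)) (- velocity \<gamma> (seg t0 s0 t)) * W t)) t ?S"
      unfolding W_def vw seg_\<kappa>[symmetric] by (rule has_real_deriv_ncs_compose[OF _ \<kappa>S])
    \<comment> \<open>The chain rule factor \<open>\<kappa>\<close> and the sign from reversing the
      path combine to the slope of the segment.\<close>
    moreover have "of_real \<kappa> *\<^sub>C log_form pt (\<lambda>k. free_t (Pt k) Ws) (\<gamma> (seg t0 s0 t))
        (- velocity \<gamma> (seg t0 s0 t)) = \<Omega>w"
      by (simp add: \<Omega>w_def log_form_def scaleC_scaleC scaleC_sum_right scaleR_conv_of_real mult_ac)
    ultimately have dw: "has_real_deriv W (\<Omega>w * W t) t ?S"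
      by (simp add: mult_scaleC_left[symmetric])
    \<comment> \<open>The w-part of the connection has to pass the z-solution standing to its left;
      this is where commutation modulo t_zw enters the product rule.\<close>
    have "abs_dkq \<Omega>w * abs_dkq (\<Psi>z t) = abs_dkq (\<Psi>z t) * abs_dkq \<Omega>w"
      using t unfolding \<Omega>w_def log_form_def dkq.q_simps
      by (simp add: commz sum_distrib_left sum_distrib_right mult_scaleC_left mult_scaleC_right)
    then have "abs_dkq (\<Omega>z * \<Psi>z t * W t + \<Psi>z t * (\<Omega>w * W t)) = abs_dkq (\<Omega>z + \<Omega>w) * abs_dkq (\<Psi>z t * W t)"
      by (simp add: dkq.q_simps distrib_right mult.assoc) (simp add: mult.assoc[symmetric])
    also have "abs_dkq (\<Omega>z + \<Omega>w) = abs_dkq (\<Omega> t)"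
    proof -
      have "vector_derivative \<gamma> (at t) = velocity \<gamma> t"
        using t times by (intro vector_derivative_at has_velocity_at) auto
      moreover have "vector_derivative (\<lambda>t. \<gamma> (seg t0 s0 t)) (at t) = (- \<kappa>) *\<^sub>R velocity \<gamma> (seg t0 s0 t)"
        using t seg_bounds[of t] times by (intro vector_derivative_at has_velocity_seg) auto
      ultimately show ?thesis
        by (simp add: \<Omega>_def \<Omega>z_def \<Omega>w_def log_form_def A_free_def dkq.q_simps dkq_tzw
            scaleC_add_right sum.distrib)
    qed
    finally show "has_real_deriv (\<lambda>t. abs_dkq (\<Psi>z t * W t)) (abs_dkq (\<Omega> t) * abs_dkq (\<Psi>z t * W t)) t ?S"
      using dkq.has_real_deriv_q[OF has_real_deriv_ncs_mult[OF dz dw]] by simp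
  qed
  have eq: "proj (\<Psi>5 t) = abs_dkq (\<Psi>z t * W t)" if "t \<in> ?S" for t
  proof -
    obtain f \<rho> where f: "0 < \<rho>" "analytic_bidisc \<rho> f" "f 0 0 = 1"
        "\<forall>\<^sub>F t in at_right 0. \<Psi>5 t = f (of_real t * vi) (of_real t * (of_real \<kappa> * vj)) *
         monodromy_power (of_real (1 * t)) (tt (Pt i) Zs) * monodromy_power (of_real (\<kappa> * t))
             (tt (Pt j) Ws)"
      by (rule start_form[OF \<Psi>5(2)]) (rule that)
    obtain fz \<rho>z where fz: "0 < \<rho>z" "analytic_disc \<rho>z fz" "fz 0 = 1"
        "\<forall>\<^sub>F t in at_right 0. \<Psi>z t = fz ((\<gamma> t - pt i) / vi) * monodromy_power ((\<gamma> t - pt i) / vi)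
            (free_t (Pt i) Zs)"
      using z unfolding tangential_solution_def by blast
    obtain fw \<rho>w where fw: "0 < \<rho>w" "analytic_disc \<rho>w fw" "fw 0 = 1"
        "\<forall>\<^sub>F t in at_right 0. \<Psi>w t = fw ((\<gamma> (1 - t) - pt j) / vj) * monodromy_power
            ((\<gamma> (1 - t) - pt j) / vj) (free_t (Pt j) Ws)"
      using w unfolding tangential_solution_def by blast
    \<comment> \<open>Transfers the asymptotics of the second solution from its own time to the time
      of the segment.\<close>
    have "filterlim (\<lambda>t. \<kappa> * t) (at_right 0) (at_right 0)"
      unfolding filterlim_at using \<kappa>_pos eventually_at_right_less[of "0::real"]
      by (auto intro!: tendsto_eq_intros elim!: eventually_mono)
    note scaled = eventually_compose_filterlim[OF _ this]
    \<comment> \<open>All three analytic factors equal 1 at the origin. The first lives in the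
      larger algebra without a lift and is tested by a pulled-back functional; the other two are
      lifted, so the product rule applies to them.\<close>
    have y: "dkq.log_negligible (\<lambda>t. proj (f (of_real t * vi) (of_real t * (of_real \<kappa> * vj))) -
        abs_dkq (fz (of_real (1 * t)) * fw (of_real (\<kappa> * t))))"
    proof (rule dkq.log_negligibleI)
      fix N \<phi> assume \<phi>: "dkq.dual N (\<phi> :: 'n dkq \<Rightarrow> complex)"
      obtain D where D: "((\<lambda>t. \<phi> (proj (f (of_real t * vi) (of_real t * (of_real \<kappa> * vj)))))
          has_vector_derivative D) (at 0 within {0<..})"
        using dk.analytic_bidisc_dual_deriv[OF dual_proj[OF \<phi>] f(1,2)] by blast
      obtain Dz where Dz: "has_real_deriv (\<lambda>t. fz (of_real (1 * t))) Dz 0 {0<..}"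
        by (rule ncs_analytic_disc_deriv[OF fz(1,2)])
      obtain Dw where Dw: "has_real_deriv (\<lambda>t. fw (of_real (\<kappa> * t))) Dw 0 {0<..}"
        by (rule ncs_analytic_disc_deriv[OF fw(1,2)])
      have E: "((\<lambda>t. \<phi> (abs_dkq (fz (of_real (1 * t)) * fw (of_real (\<kappa> * t))))) has_vector_derivative
          \<phi> (abs_dkq (Dz * fw (of_real (\<kappa> * 0)) + fz (of_real (1 * 0)) * Dw))) (at 0 within {0<..})"
        by (rule dkq.dual_deriv[OF \<phi> dkq.has_real_deriv_q[OF has_real_deriv_ncs_mult[OF Dz Dw]]])
      show "\<exists>D. ((\<lambda>t. \<phi> (proj (f (of_real t * vi) (of_real t * (of_real \<kappa> * vj))) - abs_dkq
          (fz (of_real (1 * t)) * fw (of_real (\<kappa> * t)))))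
          has_vector_derivative D) (at 0 within {0<..})"
        using has_vector_derivative_diff[OF D E] unfolding dkq.dual_diff[OF \<phi>] by blast
    qed (simp add: f fz fw proj_one dkq.q_one)
    have neg: "dkq.log_negligible (\<lambda>t. proj (\<Psi>5 t) - abs_dkq (\<Psi>z t * W t))"
    proof (rule dkq.log_negligible_cong[OF dkq.log_negligible_mult_power[OF
        dkq.log_negligible_mult_power[OF y zero_less_one, of a1] \<kappa>_pos, of a2]])
      have "\<forall>\<^sub>F t in at_right 0. t \<in> ?S" using times by (auto simp: eventually_at_right_field)
      with f(4) fz(4) scaled[OF fw(4)] tangential_path_start[OF tangential_path_z] scaled[OF
          tangential_path_start[OF tangential_path_w]]
      show "\<forall>\<^sub>F t in at_right 0. (proj (f (of_real t * vi) (of_real t * (of_real \<kappa> * vj))) -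
          abs_dkq (fz (of_real (1 * t)) * fw (of_real (\<kappa> * t)))) *
          monodromy_power (of_real (1 * t)) (abs_dkq (letter a1)) * monodromy_power
              (of_real (\<kappa> * t)) (abs_dkq (letter a2)) =
          proj (\<Psi>5 t) - abs_dkq (\<Psi>z t * W t)"
      proof eventually_elim
        case (elim t)
        let ?P = "monodromy_power (of_real (1 * t)) (abs_dkq (letter a1))"
            and ?Q = "monodromy_power (of_real (\<kappa> * t)) (abs_dkq (letter a2))"
        have P: "proj (monodromy_power (of_real (1 * t)) (tt (Pt i) Zs)) = ?P"
            "abs_dkq (monodromy_power (of_real t) (free_t (Pt i) Zs)) = ?P"
          by (simp_all add: tt_abs free_t_letter dk.monodromy_power_letter
              dkq.monodromy_power_letter ncs_id.monodromy_power_letter proj_abs a1_def)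
        have Q: "proj (monodromy_power (of_real (\<kappa> * t)) (tt (Pt j) Ws)) = ?Q"
            "abs_dkq (monodromy_power (of_real (\<kappa> * t)) (free_t (Pt j) Ws)) = ?Q"
          by (simp_all add: tt_abs free_t_letter dk.monodromy_power_letter
              dkq.monodromy_power_letter ncs_id.monodromy_power_letter proj_abs a2_def)
        \<comment> \<open>In the product of the two solutions the power of t_iz stands between the
          analytic factors; it is moved to the right to match the order in the normalization of the
          segment solution.\<close>
        have "abs_dkq (W t) * ?P = ?P * abs_dkq (W t)"
        proof -
          have "\<kappa> * t \<in> {0<..1 - s0}" using \<kappa>t[of t] elim(6) by simp
          from commw[OF this, of i] show ?thesis
            unfolding dkq.monodromy_power_letter W_def a1_def
            by (intro dkq.commute_letter_exp) (simp add: free_t_letter)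
        qed
        moreover have W: "abs_dkq (W t) = abs_dkq (fw (of_real (\<kappa> * t))) * ?Q"
          using elim(3) unfolding elim(5) W_def by (simp only: dkq.q_mult Q(2))
        moreover have "?P * ?Q = ?Q * ?P"
          unfolding dkq.monodromy_power_letter
          using dkq_commute[of i j]
          by (intro dkq.commute_letter_exp dkq.commute_letter_exp[symmetric])
              (simp add: a1_def a2_def free_t_letter)
        ultimately have "?P * (abs_dkq (fw (of_real (\<kappa> * t))) * ?Q) =
            abs_dkq (fw (of_real (\<kappa> * t))) * (?P * ?Q)"
          by (metis mult.assoc)
        moreover have "abs_dkq (\<Psi>z t) = abs_dkq (fz (of_real t)) * ?P"
          using elim(2) unfolding elim(4) by (simp only: dkq.q_mult P(2))
        ultimately have "abs_dkq (\<Psi>z t * W t) =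
            abs_dkq (fz (of_real (1 * t)) * fw (of_real (\<kappa> * t))) * ?P * ?Q"
          by (simp only: dkq.q_mult W mult.assoc mult_1_left)
        moreover have "proj (\<Psi>5 t) = proj (f (of_real t * vi) (of_real t * (of_real \<kappa> * vj))) * ?P * ?Q"
          unfolding elim(1) by (simp only: proj_simps P Q)
        ultimately show ?case by (simp only: left_diff_distrib)
      qed
    qed
    have "proj (\<Psi>5 t) - abs_dkq (\<Psi>z t * W t) = 0"
    proof (rule dkq.weak_solution_vanish[OF dkq.weak_solution_diff[OF weak_solution_proj[OF
        segment_weak_solution[OF \<Psi>5(1)]] prod]])
      show "\<forall>\<^sub>F t in at_right 0. t \<in> ?S" using times by (auto simp: eventually_at_right_field)
      show "((\<lambda>t. \<phi> (proj (\<Psi>5 t) - abs_dkq (\<Psi>z t * W t))) \<longlongrightarrow> 0) (at_right 0)" if "dkq.dual N \<phi>" for N \<phi>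
        by (rule dkq.log_negligible_tendsto[OF neg that])
    qed (use that in \<open>auto simp: trivial_limit_at_right_real linear_form_\<Omega>\<close>)
    then show ?thesis by simp
  qed
  \<comment> \<open>Modulo t_zw the power in the solution at the crossing is 1, so that solution has
    the weak limit 1 there and C can be recovered as a limit at \<open>t0\<close>.\<close>
  obtain f \<rho> v where f: "0 < \<rho>" "analytic_bidisc \<rho> f" "f 0 0 = 1"
      "\<forall>\<^sub>F t in at_right 0. \<Psi>a (t0 - t) =
          f (of_real t * v) (of_real t * (- u)) * monodromy_power (of_real (1 * t)) (tt Zs Ws)"
    by (rule end_form[OF \<Psi>a(2)]) (rule that)
  have near: "\<forall>\<^sub>F t in at_left t0. t \<in> ?S" using times by (auto simp: eventually_at_left_field)
  show ?thesis
  proof (rule dkq.dual_eqI)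
    fix N \<phi> assume \<phi>: "dkq.dual N (\<phi> :: 'n dkq \<Rightarrow> complex)"
    let ?C = "C_hol pt i vi j vj \<gamma> t0 s0"
    obtain D where "((\<lambda>t. \<phi> (proj (f (of_real t * v) (of_real t * (- u))) * proj ?C))
        has_vector_derivative D) (at 0 within {0<..})"
      using dk.analytic_bidisc_dual_deriv[OF dual_proj[OF dkq.dual_comp_mult(2)[OF \<phi>]] f(1,2)] by blast
    then have "((\<lambda>t. \<phi> (proj (f (of_real t * v) (of_real t * (- u))) * proj ?C)) \<longlongrightarrow>
        \<phi> (proj ?C)) (at_right 0)"
      using has_vector_derivative_continuous by (fastforce simp: continuous_within f proj_one)
    then have "((\<lambda>t. \<phi> (proj (\<Psi>a (t0 - t)) * proj ?C)) \<longlongrightarrow> \<phi> (proj ?C)) (at_right 0)"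
      by (rule Lim_transform_eventually)
          (use f(4) in \<open>auto elim!: eventually_mono simp: proj_simps dkq_power_tzw simp del:
          of_real_mult\<close>)
    then have "((\<lambda>t. \<phi> (proj (\<Psi>a t) * proj ?C)) \<longlongrightarrow> \<phi> (proj ?C)) (at_left t0)"
      by (simp add: tendsto_left_iff)
    moreover have "\<forall>\<^sub>F t in at_left t0. \<phi> (proj (\<Psi>a t) * proj ?C) = \<phi> (abs_dkq (\<Psi>z t * W t))"
      using near by eventually_elim (simp add: eq[symmetric] C[symmetric] proj_simps)
    ultimately have 1: "((\<lambda>t. \<phi> (abs_dkq (\<Psi>z t * W t))) \<longlongrightarrow> \<phi> (proj ?C)) (at_left t0)"
      by (rule Lim_transform_eventually)
    \<comment> \<open>The tangential solutions are differentiable at the end point within a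
      half-closed interval, hence continuous from the left there.\<close>
    have lim: "filterlim (\<lambda>t. t) (at t0 within {0<..t0}) (at_left t0)"
      unfolding filterlim_at using times by (auto simp: eventually_at_left_field tendsto_ident_at)
    have "(\<Psi>z \<longlongrightarrow> \<Psi>z t0) (at t0 within {0<..t0})"
      using z times by (auto simp: tangential_solution_def intro!: has_real_deriv_ncs_tendsto)
    from filterlim_compose[OF this lim] have cz: "(\<Psi>z \<longlongrightarrow> \<Psi>z t0) (at_left t0)" .
    have "has_real_deriv \<Psi>w (log_form pt (\<lambda>k. free_t (Pt k) Ws) (\<gamma> (1 - (\<kappa> * t0)))
        (vector_derivative (\<lambda>t. \<gamma> (1 - t)) (at (\<kappa> * t0) within {0..1 - s0})) * \<Psi>w (\<kappa> * t0))
            (\<kappa> * t0) {0<..1 - s0}"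
      by (rule bspec[OF conjunct1[OF w[unfolded tangential_solution_def]]])
          (use times in \<open>simp add: \<kappa>_t0\<close>)
    moreover have "(\<lambda>t. \<kappa> * t) ` {0<..t0} \<subseteq> {0<..1 - s0}"
      unfolding \<kappa>_t0[symmetric] using \<kappa>_pos by auto
    ultimately have "(W \<longlongrightarrow> W t0) (at t0 within {0<..t0})"
      unfolding W_def by (rule has_real_deriv_ncs_tendsto[OF has_real_deriv_ncs_compose])
    from filterlim_compose[OF this lim] have "(W \<longlongrightarrow> W t0) (at_left t0)" .
    from dkq.dual_tendsto[OF \<phi> dkq.tendsto_q[OF tendsto_mult_ncs[OF cz this]]]
    have "((\<lambda>t. \<phi> (abs_dkq (\<Psi>z t * W t))) \<longlongrightarrow> \<phi> (abs_dkq (\<Psi>z t0 * W t0))) (at_left t0)" .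
    from tendsto_unique[OF _ 1 this] show "\<phi> (proj ?C) = \<phi> (abs_dkq (\<Psi>z t0) * abs_dkq (\<Psi>w (1 - s0)))"
      by (simp add: W_def \<kappa>_t0 dkq.q_mult trivial_limit_at_left_real)
  qed
qed

theorem theorem1p3:
  fixes pt :: "'n::finite \<Rightarrow> complex" and i j :: 'n and vi vj :: complex
    and \<gamma> :: "real \<Rightarrow> complex"
  assumes "CARD('n) \<ge> 2"
    and "inj pt"
    and "i \<noteq> j"
    and "admissible_path pt i vi j vj \<gamma>"
  shows "\<forall>(t0, s0)\<in>self_intersections \<gamma>.
    C_hol pt i vi j vj \<gamma> t0 s0
      - Hol_reg pt coeff_z i vi \<gamma> t0 * Hol_reg pt coeff_w j vj (\<lambda>t. \<gamma> (1 - t)) (1 - s0)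
      \<in> closed_ideal {tt Zs Ws} \<and>
    proj (C_hol pt i vi j vj \<gamma> t0 s0) =
      Hol_reg pt (\<lambda>k. proj (coeff_z k)) i vi \<gamma> t0 *
      Hol_reg pt (\<lambda>k. proj (coeff_w k)) j vj (\<lambda>t. \<gamma> (1 - t)) (1 - s0)"
proof (intro ballI, clarify, intro conjI)
  fix t0 s0 assume cross: "(t0, s0) \<in> self_intersections \<gamma>"
  interpret crossing pt i j vi vj \<gamma> t0 s0
    by unfold_locales (use assms cross in auto)
  \<comment> \<open>Solutions in the free algebra, whose images evaluate the holonomies in both
    quotients and thus make the two forms of the formula comparable.\<close>
  obtain \<Psi>z where z: "tangential_solution pt (\<lambda>k. free_t (Pt k) Zs) i vi \<gamma> t0 \<Psi>z"
    by (rule tangential_solution_exists[OF tangential_path_z linear_form_free_t free_t_letter])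
  obtain \<Psi>w where w: "tangential_solution pt (\<lambda>k. free_t (Pt k) Ws) j vj (\<lambda>t. \<gamma> (1 - t)) (1 - s0) \<Psi>w"
    by (rule tangential_solution_exists[OF tangential_path_w linear_form_free_t free_t_letter])
  have c: "coeff_z = (\<lambda>k. abs_dk (free_t (Pt k) Zs))" "coeff_w = (\<lambda>k. abs_dk (free_t (Pt k) Ws))"
    by (simp_all add: fun_eq_iff coeff_z_def coeff_w_def tt_abs)
  have Hz: "Hol_reg pt coeff_z i vi \<gamma> t0 = abs_dk (\<Psi>z t0)"
    "Hol_reg pt (\<lambda>k. proj (coeff_z k)) i vi \<gamma> t0 = abs_dkq (\<Psi>z t0)"
    unfolding c proj_abs
    by (rule dk.Hol_reg_q[OF tangential_path_z linear_form_free_t free_t_letter z]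
        dkq.Hol_reg_q[OF tangential_path_z linear_form_free_t free_t_letter z])+
  have Hw: "Hol_reg pt coeff_w j vj (\<lambda>t. \<gamma> (1 - t)) (1 - s0) = abs_dk (\<Psi>w (1 - s0))"
    "Hol_reg pt (\<lambda>k. proj (coeff_w k)) j vj (\<lambda>t. \<gamma> (1 - t)) (1 - s0) = abs_dkq (\<Psi>w (1 - s0))"
    unfolding c proj_abs
    by (rule dk.Hol_reg_q[OF tangential_path_w linear_form_free_t free_t_letter w]
        dkq.Hol_reg_q[OF tangential_path_w linear_form_free_t free_t_letter w])+
  note formula = projection_formula[OF z w]
  then show "proj (C_hol pt i vi j vj \<gamma> t0 s0) = Hol_reg pt (\<lambda>k. proj (coeff_z k)) i vi \<gamma> t0 *
      Hol_reg pt (\<lambda>k. proj (coeff_w k)) j vj (\<lambda>t. \<gamma> (1 - t)) (1 - s0)"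
    by (simp add: Hz Hw)
  show "C_hol pt i vi j vj \<gamma> t0 s0
      - Hol_reg pt coeff_z i vi \<gamma> t0 * Hol_reg pt coeff_w j vj (\<lambda>t. \<gamma> (1 - t)) (1 - s0)
      \<in> closed_ideal {tt Zs Ws}"
    by (rule proj_eq_imp_ideal) (simp add: formula Hz Hw proj_simps proj_abs)
qed

end
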